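(* Let $n\ge2$, let $(X_k)_{k\ge1}$ be a sequence of independent identically distributed random variables with $\mathbb E[X_k]=0$ and $\mathbb E[X_k^2]=1$, $k\ge1$, whose common law is supported on an interval in the interior of which its cumulative distribution function $F$ has a continuous non-vanishing density $F'$. Let $A=(a_{k,l})_{1\le k,l\le n}$ be a real symmetric matrix with vanishing diagonal, and let $$Q_n:=\sum_{1\le k,l\le n}a_{k,l}X_kX_l$$ be normalized so that $\mathbb E[Q_n]=0$ and $\mathbb E[Q_n^2]=1$. Then $$d_W(Q_n,\mathcal N)\le4\sqrt{\mathbb E\big[(\varphi_{X_1}(X_1))^2\big]\,\big(2+\mathbb E[X_1^4]\big)L_n^2+2\sum_{1\le q,l\le n}\Big(\sum_{k=1}^na_{k,q}a_{k,l}\Big)^2-\sum_{k=1}^n\Big(\sum_{l=1}^{k-1}a_{k,l}^2\Big)^2},$$ and $d_{TV}(Q_n,\mathcal N)$ is bounded by twice this right-hand side.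
   Context: $L_n^2:=\max_{1\le k\le n}\sum_{l=1}^na_{k,l}^2$. The Stein kernel of $X_1$ is $\varphi_{X_1}(y)=-\frac1{F'(y)}\int_{-\infty}^yx\,dF(x)$ for $y$ in the interior of the support of $X_1$. $\mathcal N$ is a standard normal random variable; $d_W(X,Y)=\sup_h|\mathbb E[h(X)]-\mathbb E[h(Y)]|$ over Lipschitz $h:\mathbb R\to\mathbb R$ with constant at most $1$; $d_{TV}(X,Y)=\sup_A|\mathbb P(X\in A)-\mathbb P(Y\in A)|$ over Borel sets $A\subset\mathbb R$. The right-hand side may be $+\infty$. *)

theory Defs
  imports "HOL-Probability.Probability"
begin

definition law_support :: "real measure \<Rightarrow> real set" where
  "law_support \<mu> = {x. \<forall>U. open U \<longrightarrow> x \<in> U \<longrightarrow> measure \<mu> U > 0}"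

text \<open>The Stein kernel is only meaningful in the interior of the support; outside it we take the
  value 0, which is immaterial for laws without atoms at the end points of the support.\<close>

definition stein_kernel :: "real measure \<Rightarrow> real \<Rightarrow> real" where
  "stein_kernel \<mu> y =
     (if y \<in> interior (law_support \<mu>)
      then - (1 / deriv (cdf \<mu>) y) * (LINT x:{..y}|\<mu>. x)
      else 0)"

text \<open>The random variables compared by the following two distances may live on different
  probability spaces. In the first one the expectations are Bochner integrals, so it is to be used
  for integrable random variables only (for these, every Lipschitz function has finite
  expectation).\<close>

definition dist_W ::
    "'a measure \<Rightarrow> ('a \<Rightarrow> real) \<Rightarrow> 'b measure \<Rightarrow> ('b \<Rightarrow> real) \<Rightarrow> ereal" where
  "dist_W M X N Y =
     (SUP h\<in>{h :: real \<Rightarrow> real. 1-lipschitz_on UNIV h}.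
        ereal \<bar>(\<integral>\<omega>. h (X \<omega>) \<partial>M) - (\<integral>\<omega>. h (Y \<omega>) \<partial>N)\<bar>)"

definition dist_TV ::
    "'a measure \<Rightarrow> ('a \<Rightarrow> real) \<Rightarrow> 'b measure \<Rightarrow> ('b \<Rightarrow> real) \<Rightarrow> ereal" where
  "dist_TV M X N Y =
     (SUP A\<in>sets (borel :: real measure).
        ereal \<bar>measure M {\<omega> \<in> space M. X \<omega> \<in> A} - measure N {\<omega> \<in> space N. Y \<omega> \<in> A}\<bar>)"

definition quad_form :: "nat \<Rightarrow> (nat \<Rightarrow> nat \<Rightarrow> real) \<Rightarrow> (nat \<Rightarrow> 'a \<Rightarrow> real) \<Rightarrow> 'a \<Rightarrow> real" where
  "quad_form n a X \<omega> = (\<Sum>k=1..n. \<Sum>l=1..n. a k l * X k \<omega> * X l \<omega>)"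

definition max_row_sq :: "nat \<Rightarrow> (nat \<Rightarrow> nat \<Rightarrow> real) \<Rightarrow> real" where
  "max_row_sq n a = Max ((\<lambda>k. \<Sum>l=1..n. (a k l)\<^sup>2) ` {1..n})"

text \<open>Expectation of a nonnegative random variable, with values in the nonnegative extended reals
  (it is \<open>\<infinity>\<close> if the random variable is not integrable).\<close>

definition pos_expectation :: "'a measure \<Rightarrow> ('a \<Rightarrow> real) \<Rightarrow> ereal" where
  "pos_expectation M Y = enn2ereal (\<integral>\<^sup>+\<omega>. ennreal (Y \<omega>) \<partial>M)"

text \<open>Square root with \<open>\<surd>\<infinity> = \<infinity>\<close>; only used at nonnegative arguments.\<close>

definition sqrt_ereal :: "ereal \<Rightarrow> ereal" where
  "sqrt_ereal x = (case x of ereal r \<Rightarrow> ereal (sqrt r) | PInfty \<Rightarrow> \<infinity> | MInfty \<Rightarrow> - \<infinity>)"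

end

theory Submission
  imports Defs
begin

text \<open>Write \<open>V k = (\<Sum>l. a k l * X l)\<close>, so that \<open>Q = (\<Sum>k. X k * V k)\<close> with \<open>V k\<close>
  independent of \<open>X k\<close> and \<open>\<partial>Q/\<partial>X k = 2 * V k\<close>. The kernel identity
  \<open>E[X * g X] = E[\<phi> X * g' X]\<close>, applied in each coordinate conditionally on the others, gives
  \<open>E[Q * f Q] = E[2 * W * f' Q]\<close> with \<open>W = (\<Sum>k. \<phi> (X k) * (V k)\<^sup>2)\<close>. If \<open>f\<close> solves
  Stein's equation \<open>f' x = x * f x + h x - E[h \<N>]\<close>, then \<open>\<bar>f'\<bar> \<le> 1\<close> for 1-Lipschitz \<open>h\<close>
  and \<open>\<bar>f'\<bar> \<le> 2\<close> for \<open>h\<close> with values in \<open>[0, 1]\<close>, so both distances are controlled by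
  \<open>E\<bar>1 - 2 * W\<bar> \<le> 2 * sqrt (E[(W - 1/2)\<^sup>2])\<close>.

  To bound the variance, split \<open>W - 1/2\<close> into \<open>(\<Sum>k. (\<phi> (X k) - 1) * (V k)\<^sup>2)\<close>, whose cross terms
  nearly vanish because \<open>\<phi> (X k) - 1\<close> is centred, and the centred quadratic form
  \<open>(\<Sum>k. (V k)\<^sup>2) - 1/2\<close> with matrix \<open>A\<^sup>2\<close>, whose variance is explicit. When
  \<open>E[(\<phi> X)\<^sup>2]\<close> or \<open>E[X ^ 4]\<close> is infinite, so is the right-hand side.\<close>

section \<open>Gaussian tails\<close>

text \<open>The kernel identity needs test functions with a continuous bounded derivative, which
  Stein's equation does not give for indicators. Total variation is therefore reached through
  continuous functions with values in [0, 1], at no loss in the constant, by regularity of both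
  laws.

  The number 1/2 is the mean of \<open>W\<close>: as the diagonal vanishes, E[Q^2] is twice the sum
  of the squared entries, so the normalization makes that sum 1/2.

  The obstacle in the variance is that \<open>V k\<close> contains \<open>X q\<close>, so that the
  summands of \<open>W\<close> are dependent. Two of them interact strongly only through the entry
  \<open>a k q\<close>: the covariance of their centred parts carries the factor (a k q)^2. Summed
  over both indices this costs one maximal row sum times the total sum, which is how the maximal row
  sum enters.

  The constant 4 is 2 * 2: one 2 comes from 1 - 2 * W = -2 * (W - 1/2), the other is the root of the
  factor 4 by which the variance may exceed the radicand. Hence the bound on f' for Lipschitz
  \<open>h\<close> has to be 1, and it rests on an inequality for the product of two Gaussian tail
  integrals.\<close>

lemma set_integral_atMost_add_greaterThan:
  fixes f :: "real \<Rightarrow> real"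
  assumes "integrable M f" "sets M = sets borel"
  shows "(LINT t:{..x}|M. f t) + (LINT t:{x<..}|M. f t) = integral\<^sup>L M f"
proof -
  have "space M = UNIV" using sets_eq_imp_space_eq[OF assms(2)] by simp
  moreover have "set_integrable M A f" if "A \<in> sets borel" for A
    unfolding set_integrable_def using assms that by (intro integrable_mult_indicator) auto
  moreover have un: "{..x} \<union> {x<..} = UNIV" and di: "{..x} \<inter> {x<..} = {}" by auto
  ultimately show ?thesis
    using set_integral_Un[of "{..x}" "{x<..}" M f] di
    by (simp add: set_lebesgue_integral_def un)
qed

lemma integral_greaterThan_FTC:
  fixes f F :: "real \<Rightarrow> real"
  assumes F: "\<And>t. (F has_real_derivative f t) (at t)" and "continuous_on UNIV f"
    and "integrable lborel f" and "(F \<longlongrightarrow> 0) at_top"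
  shows "(LBINT t:{x<..}. f t) = - F x"
proof -
  have "(LBINT t=ereal x..\<infinity>. f t) = 0 - F x"
  proof (rule interval_integral_FTC_integrable)
    show "set_integrable lborel (einterval (ereal x) \<infinity>) f"
      unfolding set_integrable_def using assms by (intro integrable_mult_indicator) auto
    show "((F \<circ> real_of_ereal) \<longlongrightarrow> F x) (at_right (ereal x))"
      using DERIV_isCont[OF F, of x]
      by (simp add: ereal_tendsto_simps isCont_def filterlim_at_split)
    show "((F \<circ> real_of_ereal) \<longlongrightarrow> 0) (at_left \<infinity>)"
      using assms by (simp add: ereal_tendsto_simps)
  qed (use assms in \<open>auto simp: has_real_derivative_iff_has_vector_derivative[symmetric]
        continuous_on_eq_continuous_at\<close>)
  then show ?thesis
    by (simp add: interval_integral_to_infinity_eq)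
qed

text \<open>The left part is obtained by complement: since \<open>F\<close> vanishes at both ends,
  the total integral is 0 and the left part is minus the right tail.\<close>

lemma integral_atMost_FTC:
  fixes f F :: "real \<Rightarrow> real"
  assumes F: "\<And>t. (F has_real_derivative f t) (at t)" and "continuous_on UNIV f"
    and "integrable lborel f" and "(F \<longlongrightarrow> 0) at_bot" and "(F \<longlongrightarrow> 0) at_top"
  shows "(LBINT t:{..x}. f t) = F x"
proof -
  have "(LBINT t=-\<infinity>..\<infinity>. f t) = 0 - 0"
    by (rule interval_integral_FTC_integrable[where F=F])
      (use assms in \<open>auto simp: has_real_derivative_iff_has_vector_derivative[symmetric]
        continuous_on_eq_continuous_at ereal_tendsto_simps set_integrable_def\<close>)
  then have "integral\<^sup>L lborel f = 0"
    by (simp add: interval_lebesgue_integral_def set_lebesgue_integral_def)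
  then show ?thesis
    using set_integral_atMost_add_greaterThan[of lborel f x] integral_greaterThan_FTC[OF F assms(2,3,5)] assms
    by simp
qed

lemma std_normal_density_has_derivative [derivative_intros]:
  "(std_normal_density has_real_derivative - t * std_normal_density t) (at t)"
proof -
  have "((\<lambda>t. c * exp (- t\<^sup>2 / 2)) has_real_derivative - t * (c * exp (- t\<^sup>2 / 2))) (at t)" for c
    by (auto intro!: derivative_eq_intros)
  then show ?thesis unfolding std_normal_density_def .
qed

lemma continuous_on_std_normal_density [continuous_intros]: "continuous_on A std_normal_density"
  unfolding std_normal_density_def by (intro continuous_intros) auto

abbreviation Gauss_left :: "real \<Rightarrow> real" where
  "Gauss_left x \<equiv> LBINT t:{..x}. std_normal_density t"

abbreviation Gauss_right :: "real \<Rightarrow> real" where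
  "Gauss_right x \<equiv> LBINT t:{x<..}. std_normal_density t"

lemma integrable_std_normal_moments:
  "integrable lborel std_normal_density"
  "integrable lborel (\<lambda>t. t * std_normal_density t)"
  "integrable lborel (\<lambda>t. t\<^sup>2 * std_normal_density t)"
  using integrable_std_normal_moment[of 0] integrable_std_normal_moment[of 1]
    integrable_std_normal_moment[of 2] by (simp_all add: mult.commute)

lemma set_integrable_lborel [intro]:
  fixes f :: "real \<Rightarrow> real"
  assumes "integrable lborel f" "A \<in> sets borel"
  shows "set_integrable lborel A f"
  unfolding set_integrable_def using assms by (intro integrable_mult_indicator) auto

lemma Gauss_left_add_right: "Gauss_left x + Gauss_right x = 1"
  using set_integral_atMost_add_greaterThan[of lborel std_normal_density x]
    integral_std_normal_moment_even[of 0] integrable_std_normal_moments by simp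

lemma std_normal_density_tendsto:
  "(std_normal_density \<longlongrightarrow> 0) at_top" "(std_normal_density \<longlongrightarrow> 0) at_bot"
  "((\<lambda>t. t * std_normal_density t) \<longlongrightarrow> 0) at_top"
  "((\<lambda>t. t * std_normal_density t) \<longlongrightarrow> 0) at_bot"
  unfolding std_normal_density_def by real_asymp+

lemma Gauss_first_moment:
  "(LBINT t:{x<..}. t * std_normal_density t) = std_normal_density x"
  "(LBINT t:{..x}. t * std_normal_density t) = - std_normal_density x"
proof -
  have d: "((\<lambda>t. - std_normal_density t) has_real_derivative t * std_normal_density t) (at t)" for t
    by (auto intro!: derivative_eq_intros)
  note * = d _ integrable_std_normal_moments(2)
  show "(LBINT t:{x<..}. t * std_normal_density t) = std_normal_density x"
    using integral_greaterThan_FTC[OF *, of x] std_normal_density_tendsto[THEN tendsto_minus]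
    by (simp add: continuous_intros)
  show "(LBINT t:{..x}. t * std_normal_density t) = - std_normal_density x"
    using integral_atMost_FTC[OF *, of x] std_normal_density_tendsto[THEN tendsto_minus]
    by (simp add: continuous_intros)
qed

text \<open>The function \<open>t * std_normal_density t\<close> has derivative (1 - t^2) times the
  density, so the second moment of a tail differs from its mass by a boundary term only.\<close>

lemma Gauss_second_moment:
  "(LBINT t:{x<..}. t\<^sup>2 * std_normal_density t) = Gauss_right x + x * std_normal_density x"
  "(LBINT t:{..x}. t\<^sup>2 * std_normal_density t) = Gauss_left x - x * std_normal_density x"
proof -
  let ?f = "\<lambda>t. t\<^sup>2 * std_normal_density t - std_normal_density t"
  have d: "((\<lambda>t. - (t * std_normal_density t)) has_real_derivative ?f t) (at t)" for t
    by (auto intro!: derivative_eq_intros simp: power2_eq_square algebra_simps)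
  have i: "integrable lborel ?f" using integrable_std_normal_moments by (intro Bochner_Integration.integrable_diff)
  have c: "continuous_on UNIV ?f" by (intro continuous_intros)
  have *: "(LBINT t:A. ?f t) = (LBINT t:A. t\<^sup>2 * std_normal_density t) - (LBINT t:A. std_normal_density t)"
    if "A \<in> sets borel" for A
    using that by (intro set_integral_diff set_integrable_lborel integrable_std_normal_moments)
  show "(LBINT t:{x<..}. t\<^sup>2 * std_normal_density t) = Gauss_right x + x * std_normal_density x"
    using integral_greaterThan_FTC[OF d c i, of x] std_normal_density_tendsto[THEN tendsto_minus] *
    by (auto)
  show "(LBINT t:{..x}. t\<^sup>2 * std_normal_density t) = Gauss_left x - x * std_normal_density x"
    using integral_atMost_FTC[OF d c i, of x] std_normal_density_tendsto[THEN tendsto_minus] *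
    by (auto)
qed

lemma set_integral_std_normal_affine:
  assumes "A \<in> sets borel"
  shows "(LBINT t:A. (t - z) * std_normal_density t) =
    (LBINT t:A. t * std_normal_density t) - z * (LBINT t:A. std_normal_density t)"
    "(LBINT t:A. (t - z)\<^sup>2 * std_normal_density t) =
    (LBINT t:A. t\<^sup>2 * std_normal_density t) - 2 * z * (LBINT t:A. t * std_normal_density t)
     + z\<^sup>2 * (LBINT t:A. std_normal_density t)"
proof -
  note i = integrable_std_normal_moments[THEN set_integrable_lborel, OF assms]
  show "(LBINT t:A. (t - z) * std_normal_density t) =
    (LBINT t:A. t * std_normal_density t) - z * (LBINT t:A. std_normal_density t)"
    using i by (simp add: left_diff_distrib)
  have "(\<lambda>t. (t - z)\<^sup>2 * std_normal_density t) = (\<lambda>t. t\<^sup>2 * std_normal_density t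
      - 2 * z * (t * std_normal_density t) + z\<^sup>2 * std_normal_density t)"
    by (auto simp: power2_eq_square algebra_simps)
  then show "(LBINT t:A. (t - z)\<^sup>2 * std_normal_density t) =
    (LBINT t:A. t\<^sup>2 * std_normal_density t) - 2 * z * (LBINT t:A. t * std_normal_density t)
     + z\<^sup>2 * (LBINT t:A. std_normal_density t)"
    using i by (simp add: mult.assoc)
qed

text \<open>The two quantities are the integrals of \<bar>t - x\<bar> against the density over the
  right and the left tail. In this role they return as bounds for the increments of a Lipschitz
  function.\<close>

lemma Mills_nonneg:
  "0 \<le> std_normal_density x - x * Gauss_right x" "0 \<le> std_normal_density x + x * Gauss_left x"
proof -
  have "0 \<le> (LBINT t:{x<..}. (t - x) * std_normal_density t)"
    unfolding set_lebesgue_integral_def by (intro Bochner_Integration.integral_nonneg) (auto simp: indicator_def)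
  then show "0 \<le> std_normal_density x - x * Gauss_right x"
    by (simp add: set_integral_std_normal_affine Gauss_first_moment)
  have "0 \<le> (LBINT t:{..x}. - ((t - x) * std_normal_density t))"
    unfolding set_lebesgue_integral_def
    by (intro Bochner_Integration.integral_nonneg) (auto simp: indicator_def mult_nonpos_nonneg)
  also have "\<dots> = - (LBINT t:{..x}. (t - x) * std_normal_density t)"
    by (simp add: set_lebesgue_integral_def)
  finally show "0 \<le> std_normal_density x + x * Gauss_left x"
    by (simp add: set_integral_std_normal_affine Gauss_first_moment)
qed

text \<open>Second moments of the tails about an arbitrary centre, kept as quadratics in
  \<open>z\<close> so that the best centre can be inserted later. The left tail is centred at
  \<open>- z\<close>, which makes its inequality the image of the first one under the reflection of
  \<open>x\<close> to \<open>- x\<close>.\<close>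

lemma Gauss_tail_variance:
  "0 \<le> Gauss_right x + x * std_normal_density x - 2 * z * std_normal_density x + z\<^sup>2 * Gauss_right x"
  "0 \<le> Gauss_left x - x * std_normal_density x - 2 * z * std_normal_density x + z\<^sup>2 * Gauss_left x"
proof -
  have *: "0 \<le> (LBINT t:A. (t - y)\<^sup>2 * std_normal_density t)" for A y
    unfolding set_lebesgue_integral_def by (intro Bochner_Integration.integral_nonneg) auto
  show "0 \<le> Gauss_right x + x * std_normal_density x - 2 * z * std_normal_density x + z\<^sup>2 * Gauss_right x"
    using *[of "{x<..}" z] by (simp add: set_integral_std_normal_affine Gauss_first_moment Gauss_second_moment)
  show "0 \<le> Gauss_left x - x * std_normal_density x - 2 * z * std_normal_density x + z\<^sup>2 * Gauss_left x"
    using *[of "{..x}" "-z"]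
    by (simp only: set_integral_std_normal_affine(2) borel_closed closed_atMost) (simp add: Gauss_first_moment Gauss_second_moment)
qed

text \<open>The quotients \<open>m = q / g\<close> and \<open>a = (g - x * q) / g\<close> satisfy \<open>a = 1 - x * m\<close> and, by the
  variance inequality at its optimal \<open>z\<close>, \<open>a \<le> m\<^sup>2\<close>; with \<open>r = \<surd>a\<close> the claim
  becomes \<open>0 \<le> (1 - r)\<^sup>3 * (1 + r)\<close>.\<close>

lemma Mills_product_bound_aux:
  fixes x p q g :: real
  assumes "0 \<le> x" "0 < g" "g \<le> 1/2" "p + q = 1" "0 \<le> q" "0 \<le> g - x * q"
    and v: "\<And>z. 0 \<le> q + x * g - 2 * z * g + z\<^sup>2 * q"
  shows "2 * ((g - x * q) * (g + x * p)) \<le> g"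
proof -
  have "q > 0"
  proof (rule ccontr)
    assume "\<not> q > 0"
    then have "q = 0" using assms by simp
    \<comment> \<open>For \<open>q = 0\<close> the hypothesis reads 2 * z * g \<le> x * g, which
      fails at \<open>z = x + 1\<close> because \<open>g\<close> is positive.\<close>
    with v[of "x + 1"] assms show False by (simp add: algebra_simps) (smt (verit) mult_nonneg_nonneg)
  qed
  define m where "m = q / g"
  define r where "r = sqrt (1 - x * m)"
  have "m > 0" using \<open>q > 0\<close> assms by (simp add: m_def)
  have a0: "1 - x * m \<ge> 0" using assms by (simp add: m_def field_simps)
  then have r2: "r\<^sup>2 = 1 - x * m" and "r \<ge> 0" by (simp_all add: r_def)
  have "r \<le> 1" using \<open>m > 0\<close> \<open>0 \<le> x\<close> by (auto simp: r_def)
  have "0 \<le> q + x * g - g\<^sup>2 / q" using v[of "g / q"] \<open>q > 0\<close> by (simp add: field_simps power2_eq_square)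
  then have "0 \<le> (q + x * g - g\<^sup>2 / q) * q / g\<^sup>2" using \<open>q > 0\<close> assms by auto
  also have "\<dots> = m\<^sup>2 + x * m - 1" using \<open>q > 0\<close> assms by (simp add: m_def field_simps power2_eq_square)
  finally have "r\<^sup>2 \<le> m\<^sup>2" using r2 by simp
  then have "r \<le> m" using \<open>m > 0\<close> using power2_le_imp_le[of r m] by simp
  have "x * r \<le> x * m" using \<open>r \<le> m\<close> \<open>0 \<le> x\<close> by (rule mult_left_mono)
  then have xr: "x * r \<le> 1 - r\<^sup>2" unfolding r2 by simp
  have "0 \<le> (1 - r)^3 * (1 + r)" using \<open>r \<le> 1\<close> \<open>r \<ge> 0\<close> by simp
  also have "\<dots> = 1 - 2 * r * (1 - r\<^sup>2) - r^4" by (simp add: power2_eq_square power3_eq_cube power4_eq_xxxx algebra_simps)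
  also have "\<dots> \<le> 1 - 2 * r * (x * r) - r^4"
    using mult_left_mono[OF xr \<open>r \<ge> 0\<close>] by simp
  also have "\<dots> = 1 - 2 * x * r\<^sup>2 - r^4" by (simp add: power2_eq_square)
  finally have k: "2 * x * r\<^sup>2 + r^4 \<le> 1" by simp
  have "g - x * q = g * r\<^sup>2" using assms by (simp add: r2 m_def field_simps)
  moreover have "g + x * p = x + g * r\<^sup>2"
  proof -
    have "x * p = x - x * q" using assms(4) by (metis add_diff_cancel_right' distrib_left mult.right_neutral)
    with calculation show ?thesis by simp
  qed
  ultimately have "2 * ((g - x * q) * (g + x * p)) = 2 * ((g * r\<^sup>2) * (x + g * r\<^sup>2))" by simp
  also have "\<dots> = g * (2 * x * r\<^sup>2 + 2 * g * r^4)"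
    by (simp add: algebra_simps power2_eq_square power4_eq_xxxx)
  \<comment> \<open>Here \<open>g \<le> 1/2\<close> enters; it holds because the density is at most
    1 / sqrt (2 * pi).\<close>
  also have "\<dots> \<le> g * (2 * x * r\<^sup>2 + r^4)"
    using assms \<open>r \<ge> 0\<close> mult_right_mono[of "2 * g" 1 "r^4"] by (intro mult_left_mono) auto
  also have "\<dots> \<le> g * 1" using k assms by (intro mult_left_mono) auto
  finally show ?thesis by simp
qed

lemma std_normal_density_le_half: "std_normal_density x \<le> 1/2"
proof -
  have "sqrt (2 * pi) \<ge> sqrt 4" using pi_gt3 by (intro real_sqrt_le_mono) auto
  then have "1 / sqrt (2 * pi) \<le> 1/2" by (intro frac_le) auto
  moreover have "exp (- x\<^sup>2 / 2) \<le> 1" by simp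
  ultimately have "(1 / sqrt (2 * pi)) * exp (- x\<^sup>2 / 2) \<le> 1/2 * 1"
    by (intro mult_mono) auto
  then show ?thesis by (simp only: std_normal_density_def)
qed

text \<open>This is exactly what bounds the derivative of the Stein solution by 1 for Lipschitz test
  functions. For negative \<open>x\<close> the reflection exchanges the two tails and the two
  factors.\<close>

lemma Mills_product_bound:
  "2 * ((std_normal_density x - x * Gauss_right x) * (std_normal_density x + x * Gauss_left x))
    \<le> std_normal_density x"
proof -
  have nn: "0 \<le> (LBINT t:A. std_normal_density t)" for A
    unfolding set_lebesgue_integral_def by (intro Bochner_Integration.integral_nonneg) auto
  show ?thesis
  proof (cases "x \<ge> 0")
    case True
    then show ?thesis
      by (intro Mills_product_bound_aux Gauss_tail_variance nn Mills_nonneg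
          std_normal_density_le_half Gauss_left_add_right normal_density_pos) auto
  next
    case False
    have "2 * ((std_normal_density x - (-x) * Gauss_left x) * (std_normal_density x + (-x) * Gauss_right x))
      \<le> std_normal_density x"
      using False Gauss_tail_variance(2)[of x] Mills_nonneg(2)[of x] Gauss_left_add_right[of x]
      by (intro Mills_product_bound_aux nn std_normal_density_le_half normal_density_pos)
        (auto simp: add.commute)
    then show ?thesis by (simp add: mult.commute)
  qed
qed

section \<open>Stein's equation\<close>

lemma has_real_derivative_integral_atMost:
  fixes w :: "real \<Rightarrow> real"
  assumes c: "continuous_on UNIV w" and i: "integrable lborel w"
  shows "((\<lambda>x. LBINT t:{..x}. w t) has_real_derivative w x) (at x)"
proof -
  \<comment> \<open>Anchoring the integral at \<open>x - 1\<close> reduces the half-line to a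
    compact interval around \<open>x\<close>; the mass below the anchor only adds a
    constant.\<close>
  have "((\<lambda>u. LBINT y=x-1..u. w y) has_vector_derivative w x) (at x within {x-1..x+1})"
    by (rule interval_integral_FTC2) (auto intro: continuous_on_subset[OF c])
  then have "((\<lambda>u. LBINT y=x-1..u. w y) has_real_derivative w x) (at x)"
    by (simp add: has_real_derivative_iff_has_vector_derivative at_within_Icc_at)
  then have d: "((\<lambda>u. (LBINT t:{..x-1}. w t) + (LBINT y=x-1..u. w y)) has_real_derivative w x) (at x)"
    using DERIV_add[OF DERIV_const] by fastforce
  show ?thesis
  proof (rule has_field_derivative_transform_within[OF d])
    fix u assume "dist u x < 1"
    then have u: "x - 1 \<le> u" by (auto simp: dist_real_def)
    have "(LBINT t:{..u}. w t) = (LBINT t:{..x-1} \<union> {x-1<..u}. w t)"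
      using u by (simp add: ivl_disj_un_one)
    also have "\<dots> = (LBINT t:{..x-1}. w t) + (LBINT t:{x-1<..u}. w t)"
      using i by (intro set_integral_Un set_integrable_lborel) auto
    also have "(LBINT t:{x-1<..u}. w t) = (LBINT y=x-1..u. w y)"
      using u by (simp add: interval_integral_Ioc)
    finally show "(LBINT t:{..x-1}. w t) + (LBINT y=x-1..u. w y) = (LBINT t:{..u}. w t)" by simp
  qed auto
qed

definition gauss_mean :: "(real \<Rightarrow> real) \<Rightarrow> real" where
  "gauss_mean h = (LBINT t. h t * std_normal_density t)"

text \<open>The density is an integrating factor of Stein's equation: with f the solution, the
  derivative of f times the density is (h - mean) times the density. Integrating from minus infinity
  leaves no homogeneous part.\<close>

definition stein_sol :: "(real \<Rightarrow> real) \<Rightarrow> real \<Rightarrow> real" where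
  "stein_sol h x = (LBINT t:{..x}. (h t - gauss_mean h) * std_normal_density t) / std_normal_density x"

lemma std_normal_density_pos: "0 < std_normal_density x"
  by (rule normal_density_pos) simp

lemma stein_sol_integrable:
  assumes "integrable lborel (\<lambda>t. h t * std_normal_density t)"
  shows "integrable lborel (\<lambda>t. (h t - c) * std_normal_density t)"
  using assms integrable_std_normal_moments(1) by (simp add: left_diff_distrib)

lemma stein_sol_has_derivative:
  assumes "continuous_on UNIV h" "integrable lborel (\<lambda>t. h t * std_normal_density t)"
  shows "(stein_sol h has_real_derivative x * stein_sol h x + h x - gauss_mean h) (at x)"
proof -
  have "((\<lambda>x. (LBINT t:{..x}. (h t - gauss_mean h) * std_normal_density t))
     has_real_derivative (h x - gauss_mean h) * std_normal_density x) (at x)"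
    using assms by (intro has_real_derivative_integral_atMost stein_sol_integrable continuous_intros)
  from DERIV_divide[OF this std_normal_density_has_derivative]
  have "(stein_sol h has_real_derivative ((h x - gauss_mean h) * std_normal_density x * std_normal_density x -
     (LBINT t:{..x}. (h t - gauss_mean h) * std_normal_density t) * (- x * std_normal_density x)) /
    (std_normal_density x * std_normal_density x)) (at x)"
    unfolding stein_sol_def[abs_def] using std_normal_density_pos[of x] by simp
  moreover have "((h x - gauss_mean h) * std_normal_density x * std_normal_density x -
     (LBINT t:{..x}. (h t - gauss_mean h) * std_normal_density t) * (- x * std_normal_density x)) /
    (std_normal_density x * std_normal_density x) = x * stein_sol h x + h x - gauss_mean h"
    unfolding stein_sol_def using std_normal_density_pos[of x]
    by (simp add: field_simps del: normal_density_pos)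
  ultimately show ?thesis by simp
qed

lemma stein_sol_deriv_continuous:
  assumes "continuous_on UNIV h" "integrable lborel (\<lambda>t. h t * std_normal_density t)"
  shows "continuous_on UNIV (\<lambda>x. x * stein_sol h x + h x - gauss_mean h)"
proof -
  have "continuous_on UNIV (stein_sol h)"
    by (rule DERIV_continuous_on) (rule stein_sol_has_derivative[OF assms, THEN DERIV_subset], simp)
  then show ?thesis using assms by (intro continuous_intros)
qed

lemma gauss_mean_split:
  assumes "integrable lborel (\<lambda>t. h t * std_normal_density t)"
  shows "gauss_mean h - c = (LBINT t:{..x}. (h t - c) * std_normal_density t)
    + (LBINT t:{x<..}. (h t - c) * std_normal_density t)"
  using set_integral_atMost_add_greaterThan[OF stein_sol_integrable[OF assms, of c], of x]
    assms integrable_std_normal_moments(1) integral_std_normal_moment_even[of 0]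
  by (simp add: gauss_mean_def left_diff_distrib)

text \<open>Recentring: the solution is defined with \<open>h\<close> centred at its Gaussian mean,
  while a Lipschitz condition controls only increments such as \<open>h t - h x\<close>.\<close>

lemma set_integral_shift_mean:
  assumes "integrable lborel (\<lambda>t. h t * std_normal_density t)" "A \<in> sets borel"
  shows "(LBINT t:A. (h t - c) * std_normal_density t) = (LBINT t:A. (h t - d) * std_normal_density t)
     + (d - c) * (LBINT t:A. std_normal_density t)"
proof -
  have "(\<lambda>t. (h t - c) * std_normal_density t) =
     (\<lambda>t. (h t - d) * std_normal_density t + (d - c) * std_normal_density t)"
    by (auto simp: algebra_simps)
  moreover have "set_integrable lborel A (\<lambda>t. (h t - d) * std_normal_density t)"
    "set_integrable lborel A (\<lambda>t. (d - c) * std_normal_density t)"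
    using assms by (intro set_integrable_lborel stein_sol_integrable integrable_mult_right
        integrable_std_normal_moments; simp)+
  ultimately show ?thesis by simp
qed

lemma set_integral_std_normal_abs_le:
  assumes "integrable lborel (\<lambda>t. h t * std_normal_density t)"
    "integrable lborel (\<lambda>t. k t * std_normal_density t)" "A \<in> sets borel"
    "\<And>t. t \<in> A \<Longrightarrow> \<bar>h t\<bar> \<le> k t"
  shows "\<bar>LBINT t:A. h t * std_normal_density t\<bar> \<le> (LBINT t:A. k t * std_normal_density t)"
proof -
  have "norm (LBINT t:A. h t * std_normal_density t) \<le> (LBINT t:A. norm (h t * std_normal_density t))"
    using assms by (intro set_integral_norm_bound set_integrable_lborel)
  also have "\<dots> \<le> (LBINT t:A. k t * std_normal_density t)"
    using assms by (intro set_integral_mono set_integrable_lborel integrable_norm)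
      (auto simp: abs_mult intro!: mult_right_mono)
  finally show ?thesis by simp
qed

lemma lipschitz_integrable_std_normal:
  assumes "1-lipschitz_on UNIV h"
  shows "integrable lborel (\<lambda>t. h t * std_normal_density t)"
proof -
  have "integrable lborel (\<lambda>t. \<bar>h 0\<bar> * std_normal_density t + std_normal_density t * \<bar>t\<bar>^1)"
    by (intro Bochner_Integration.integrable_add integrable_mult_right
        integrable_std_normal_moment_abs integrable_std_normal_moments)
  then show ?thesis
  proof (rule Bochner_Integration.integrable_bound)
    have "continuous_on UNIV h" using assms lipschitz_on_continuous_on by blast
    then have [measurable]: "h \<in> borel_measurable borel" by (rule borel_measurable_continuous_onI)
    show "(\<lambda>t. h t * std_normal_density t) \<in> borel_measurable lborel" by measurable
    have "\<bar>h t\<bar> \<le> \<bar>h 0\<bar> + \<bar>t\<bar>" for t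
      using lipschitz_onD[OF assms, of t 0] by (auto simp: dist_real_def)
    then have "\<bar>h t\<bar> * std_normal_density t \<le> (\<bar>h 0\<bar> + \<bar>t\<bar>) * std_normal_density t" for t
      by (intro mult_right_mono) auto
    then show "AE t in lborel. norm (h t * std_normal_density t)
        \<le> norm (\<bar>h 0\<bar> * std_normal_density t + std_normal_density t * \<bar>t\<bar>^1)"
      by (auto simp: abs_mult algebra_simps)
  qed
qed

text \<open>With increments taken from \<open>h x\<close>, the mean is \<open>h x + L + R\<close>,
  and inserting this into the solution weights \<open>L\<close> and \<open>R\<close> by the opposite
  tails. The derivative times the density \<open>g\<close> becomes -((g - x * Q) * L + (g + x * P) *
  R), with \<open>P\<close> and \<open>Q\<close> the left and right masses. The bounds for
  \<open>L\<close> and \<open>R\<close> are the two weights in exchanged order, so both terms give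
  the same product and \<open>Mills_product_bound\<close> applies.\<close>

lemma stein_sol_lipschitz:
  assumes h: "1-lipschitz_on UNIV h"
  shows "\<bar>x * stein_sol h x + h x - gauss_mean h\<bar> \<le> 1"
proof -
  note i = lipschitz_integrable_std_normal[OF h]
  let ?g = "std_normal_density x" and ?P = "Gauss_left x" and ?Q = "Gauss_right x"
  define L where "L = (LBINT t:{..x}. (h t - h x) * std_normal_density t)"
  define R where "R = (LBINT t:{x<..}. (h t - h x) * std_normal_density t)"
  have lip: "\<bar>h t - h x\<bar> \<le> \<bar>t - x\<bar>" for t
    using lipschitz_onD[OF h, of t x] by (auto simp: dist_real_def)
  have ia: "integrable lborel (\<lambda>t. (t - x) * std_normal_density t)"
    using integrable_std_normal_moments by (simp add: left_diff_distrib)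
  have ia': "integrable lborel (\<lambda>t. (x - t) * std_normal_density t)"
    using integrable_std_normal_moments by (simp add: left_diff_distrib)
  have "\<bar>R\<bar> \<le> (LBINT t:{x<..}. (t - x) * std_normal_density t)"
    unfolding R_def
    by (intro set_integral_std_normal_abs_le stein_sol_integrable[OF i] ia order_trans[OF lip]) auto
  also have "\<dots> = ?g - x * ?Q" by (simp add: set_integral_std_normal_affine Gauss_first_moment)
  finally have R: "\<bar>R\<bar> \<le> ?g - x * ?Q" .
  have "\<bar>L\<bar> \<le> (LBINT t:{..x}. (x - t) * std_normal_density t)"
    unfolding L_def
    by (intro set_integral_std_normal_abs_le stein_sol_integrable[OF i] ia' order_trans[OF lip]) auto
  also have "\<dots> = - (LBINT t:{..x}. (t - x) * std_normal_density t)"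
    unfolding set_lebesgue_integral_def Bochner_Integration.integral_minus[symmetric]
    by (intro Bochner_Integration.integral_cong) (auto simp: indicator_def algebra_simps)
  also have "\<dots> = ?g + x * ?P" by (simp add: set_integral_std_normal_affine Gauss_first_moment)
  finally have L: "\<bar>L\<bar> \<le> ?g + x * ?P" .
  have m: "gauss_mean h = h x + L + R" using gauss_mean_split[OF i, of "h x" x] by (simp add: L_def R_def)
  have "stein_sol h x = (L + (h x - gauss_mean h) * ?P) / ?g"
    unfolding stein_sol_def L_def by (subst set_integral_shift_mean[OF i, where d="h x"]) auto
  also have "\<dots> = (L * (1 - ?P) - R * ?P) / ?g" by (simp add: m algebra_simps)
  also have "\<dots> = (L * ?Q - R * ?P) / ?g" using Gauss_left_add_right[of x] by simp
  finally have sg: "stein_sol h x * ?g = L * ?Q - R * ?P" using std_normal_density_pos[of x] by simp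
  have "(x * stein_sol h x + h x - gauss_mean h) * ?g = x * (stein_sol h x * ?g) - (L + R) * ?g"
    by (simp add: m algebra_simps)
  also have "\<dots> = - ((?g - x * ?Q) * L + (?g + x * ?P) * R)" unfolding sg by (simp add: algebra_simps)
  finally have "(x * stein_sol h x + h x - gauss_mean h) * ?g
     = - ((?g - x * ?Q) * L + (?g + x * ?P) * R)" .
  then have "\<bar>x * stein_sol h x + h x - gauss_mean h\<bar> * ?g = \<bar>(?g - x * ?Q) * L + (?g + x * ?P) * R\<bar>"
    using std_normal_density_pos[of x] by (metis abs_minus_cancel abs_mult abs_of_pos)
  also have "\<dots> \<le> \<bar>(?g - x * ?Q) * L\<bar> + \<bar>(?g + x * ?P) * R\<bar>" by (rule abs_triangle_ineq)
  also have "\<dots> \<le> (?g - x * ?Q) * (?g + x * ?P) + (?g + x * ?P) * (?g - x * ?Q)"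
    unfolding abs_mult abs_of_nonneg[OF Mills_nonneg(1)] abs_of_nonneg[OF Mills_nonneg(2)]
    by (intro add_mono mult_left_mono L R Mills_nonneg)
  also have "\<dots> \<le> 1 * ?g" using Mills_product_bound[of x] by (simp add: mult.commute)
  finally show ?thesis using std_normal_density_pos[of x] mult_le_cancel_right_pos by blast
qed

text \<open>The centred integrand has total integral 0, so its integral up to \<open>x\<close> is
  bounded by the mass of either tail. The tail on the far side of \<open>x\<close> from the origin
  has mass at most the density divided by \<bar>x\<bar>, which gives \<bar>x * f x\<bar> \<le> 1;
  the remaining term \<open>h x - gauss_mean h\<close> contributes at most 1 more.\<close>

lemma stein_sol_bounded:
  assumes c: "continuous_on UNIV h" and h: "\<And>t. 0 \<le> h t" "\<And>t. h t \<le> 1"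
  shows "integrable lborel (\<lambda>t. h t * std_normal_density t)"
    and "\<bar>x * stein_sol h x + h x - gauss_mean h\<bar> \<le> 2"
proof -
  show i: "integrable lborel (\<lambda>t. h t * std_normal_density t)"
    using integrable_std_normal_moments(1)
    by (rule Bochner_Integration.integrable_bound)
      (use h borel_measurable_continuous_onI[OF c] in \<open>auto simp: abs_mult intro!: mult_left_le_one_le\<close>)
  let ?g = "std_normal_density x" and ?P = "Gauss_left x" and ?Q = "Gauss_right x"
  let ?m = "gauss_mean h"
  have "0 \<le> ?m" unfolding gauss_mean_def using h by (intro Bochner_Integration.integral_nonneg) auto
  moreover have "?m \<le> (LBINT t. std_normal_density t)"
    unfolding gauss_mean_def using h i integrable_std_normal_moments(1)
    by (intro integral_mono) (auto intro!: mult_left_le_one_le)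
  ultimately have hm: "\<bar>h t - ?m\<bar> \<le> 1" for t
    using h[of t] integral_std_normal_moment_even[of 0] by auto
  let ?L = "LBINT t:{..x}. (h t - ?m) * std_normal_density t"
  let ?R = "LBINT t:{x<..}. (h t - ?m) * std_normal_density t"
  have LR: "?L = - ?R" using gauss_mean_split[OF i, of ?m x] by simp
  have "\<bar>?L\<bar> \<le> (LBINT t:{..x}. 1 * std_normal_density t)" "\<bar>?R\<bar> \<le> (LBINT t:{x<..}. 1 * std_normal_density t)"
    by (intro set_integral_std_normal_abs_le stein_sol_integrable[OF i] hm;
        simp add: integrable_std_normal_moments)+
  then have LP: "\<bar>?L\<bar> \<le> ?P" and LQ: "\<bar>?L\<bar> \<le> ?Q" using LR by simp_all
  have "\<bar>x\<bar> * \<bar>?L\<bar> \<le> ?g"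
  proof (cases "x \<ge> 0")
    case True
    then show ?thesis using mult_left_mono[OF LQ True] Mills_nonneg(1)[of x] by simp
  next
    case False
    then have "- x * \<bar>?L\<bar> \<le> - x * ?P" using LP by (intro mult_left_mono) auto
    then have "- x * \<bar>?L\<bar> \<le> ?g" using Mills_nonneg(2)[of x] by linarith
    then show ?thesis using False by simp
  qed
  then have "\<bar>x * stein_sol h x\<bar> \<le> 1"
    using std_normal_density_pos[of x] by (simp add: stein_sol_def abs_mult field_simps)
  then show "\<bar>x * stein_sol h x + h x - gauss_mean h\<bar> \<le> 2" using hm[of x] by linarith
qed

section \<open>Stein kernels of laws on an interval\<close>

lemma open_interval_eq_einterval:
  fixes K :: "real set"
  assumes "open K" "is_interval K" "K \<noteq> {}"
  obtains a b where "a < b" "K = einterval a b"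
proof -
  define a b where "a = (INF x\<in>K. ereal x)" and "b = (SUP x\<in>K. ereal x)"
  have K: "K = einterval a b"
  proof (intro set_eqI iffI)
    fix y assume "y \<in> K"
    with \<open>open K\<close> obtain e where e: "e > 0" "ball y e \<subseteq> K" by (auto simp: open_contains_ball)
    then have "y - e/2 \<in> K" "y + e/2 \<in> K" by (auto simp: dist_real_def subset_iff)
    then have "a \<le> ereal (y - e/2)" "ereal (y + e/2) \<le> b"
      unfolding a_def b_def by (auto intro: INF_lower SUP_upper)
    moreover have "ereal (y - e/2) < ereal y" "ereal y < ereal (y + e/2)" using e by auto
    ultimately show "y \<in> einterval a b" unfolding einterval_iff by (meson order.strict_trans1 order.strict_trans2)
  next
    fix y assume "y \<in> einterval a b"
    then obtain x z where "x \<in> K" "z \<in> K" "x < y" "y < z"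
      by (auto simp: einterval_iff a_def b_def INF_less_iff less_SUP_iff)
    then show "y \<in> K" using \<open>is_interval K\<close> mem_is_interval_1_I[of K x z y] by auto
  qed
  moreover from this \<open>K \<noteq> {}\<close> have "a < b" by (auto simp: einterval_iff)
  ultimately show thesis using that by blast
qed

text \<open>Half-open intervals are the sets measured by increments of a distribution function;
  their closures are required to lie inside, so that differentiability is available up to the end
  points.\<close>

lemma emeasure_einterval_eqI:
  fixes M N :: "real measure"
  assumes sets: "sets M = sets borel" "sets N = sets borel"
    and eq: "\<And>l u. l < u \<Longrightarrow> {l..u} \<subseteq> einterval a b \<Longrightarrow> emeasure M {l<..u} = emeasure N {l<..u}"
    and "a < b"
  shows "emeasure M (einterval a b) = emeasure N (einterval a b)"
proof -
  obtain u l :: "nat \<Rightarrow> real" where A: "einterval a b = (\<Union>i. {l i .. u i})"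
    "incseq u" "decseq l" "\<And>i. l i < u i" "\<And>i. a < l i" "\<And>i. u i < b"
    "l \<longlonglongrightarrow> a" "u \<longlonglongrightarrow> b"
    by (blast intro: einterval_Icc_approximation[OF \<open>a < b\<close>])
  have U: "einterval a b = (\<Union>i. {l i <.. u i})"
  proof
    show "(\<Union>i. {l i <.. u i}) \<subseteq> einterval a b" unfolding A(1) by force
    show "einterval a b \<subseteq> (\<Union>i. {l i <.. u i})"
    proof
      fix y assume "y \<in> einterval a b"
      then obtain i where i: "l i \<le> y" "y \<le> u i" unfolding A(1) by auto
      \<comment> \<open>The closed approximating intervals contain their left ends, the half-open
        ones do not. Since \<open>l\<close> tends to \<open>a\<close>, which lies strictly below
        \<open>l i\<close>, some later left end is strictly smaller.\<close>
      have "eventually (\<lambda>j. ereal (l j) < ereal (l i)) sequentially"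
        using A(5,7) by (intro order_tendstoD(2)) auto
      then obtain j where j: "l j < l i" "j \<ge> i"
        by (metis (no_types, lifting) eventually_sequentially less_ereal.simps(1) linorder_linear)
      with i A(2) have "l j < y" "y \<le> u j" by (auto intro: order_trans dest: incseqD)
      then show "y \<in> (\<Union>i. {l i <.. u i})" by auto
    qed
  qed
  have inc: "incseq (\<lambda>i. {l i <.. u i})"
  proof (rule incseq_SucI)
    fix n show "{l n<..u n} \<subseteq> {l (Suc n)<..u (Suc n)}"
      using incseq_SucD[OF A(2), of n] decseq_SucD[OF A(3), of n] by auto
  qed
  have "emeasure M (einterval a b) = (SUP i. emeasure M {l i <.. u i})"
    unfolding U by (rule SUP_emeasure_incseq[OF _ inc, symmetric]) (simp add: sets image_subset_iff)
  also have "\<dots> = (SUP i. emeasure N {l i <.. u i})"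
  proof (intro SUP_cong eq A(4) refl)
    show "{l i..u i} \<subseteq> einterval a b" for i unfolding A(1) by blast
  qed
  also have "\<dots> = emeasure N (einterval a b)"
    unfolding U by (rule SUP_emeasure_incseq[OF _ inc]) (simp add: sets image_subset_iff)
  finally show ?thesis .
qed

locale interval_law = real_distribution \<mu> for \<mu> :: "real measure" +
  fixes I :: "real set"
  assumes is_interval: "is_interval I" and AE_I: "AE x in \<mu>. x \<in> I"
    and cdf_differentiable: "\<And>y. y \<in> interior I \<Longrightarrow> cdf \<mu> differentiable (at y)"
    and cont_deriv: "continuous_on (interior I) (deriv (cdf \<mu>))"
    and deriv_nonzero: "\<And>y. y \<in> interior I \<Longrightarrow> deriv (cdf \<mu>) y \<noteq> 0"
begin

abbreviation "J \<equiv> interior I"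

text \<open>The indicator is part of the definition because the hypotheses control
  \<open>deriv\<close> only on the interior; the product is nonnegative and measurable on the whole
  line.\<close>

definition dens :: "real \<Rightarrow> real" where
  "dens y = indicator J y * deriv (cdf \<mu>) y"

lemma convex_I: "convex I"
  using is_interval is_interval_convex_1 by blast

lemma cdf_has_derivative:
  assumes "y \<in> J" shows "(cdf \<mu> has_real_derivative deriv (cdf \<mu>) y) (at y)"
  using cdf_differentiable[OF assms] by (meson DERIV_deriv_iff_real_differentiable)

lemma deriv_pos: "y \<in> J \<Longrightarrow> 0 < deriv (cdf \<mu>) y"
  using mono_on_imp_deriv_nonneg[OF _ cdf_has_derivative, of UNIV y] deriv_nonzero[of y]
    cdf_nondecreasing by (auto simp: mono_on_def less_le)

lemma dens_nonneg: "0 \<le> dens y"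
  using deriv_pos[of y] by (auto simp: dens_def indicator_def)

lemma dens_measurable [measurable]: "dens \<in> borel_measurable borel"
  unfolding dens_def[abs_def]
  using borel_measurable_continuous_on_indicator[OF _ cont_deriv] by simp

text \<open>Connects the support used by \<open>stein_kernel\<close> with the given interval. The
  support lies in the closure of \<open>I\<close>, and a convex set has the same interior as its
  closure. Conversely, a positive derivative makes the distribution function increase strictly to
  the right of each interior point, so each neighbourhood has positive mass.\<close>

lemma interior_law_support: "interior (law_support \<mu>) = J"
proof
  have "law_support \<mu> \<subseteq> closure I"
  proof
    fix x assume x: "x \<in> law_support \<mu>"
    show "x \<in> closure I"
    proof (rule ccontr)
      assume "x \<notin> closure I"
      then have "measure \<mu> (- closure I) > 0" using x \<open>x \<notin> closure I\<close> unfolding law_support_def by (simp add: open_Compl)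
      moreover have "measure \<mu> (- closure I) = measure \<mu> {}"
        by (rule finite_measure_eq_AE) (use AE_I closure_subset[of I] in \<open>auto elim!: eventually_mono\<close>)
      ultimately show False by simp
    qed
  qed
  then have "interior (law_support \<mu>) \<subseteq> interior (closure I)" by (rule interior_mono)
  then show "interior (law_support \<mu>) \<subseteq> J" using convex_interior_closure[OF convex_I] by simp
  show "J \<subseteq> interior (law_support \<mu>)"
  proof (rule interior_maximal)
    show "J \<subseteq> law_support \<mu>" unfolding law_support_def
    proof (intro subsetI CollectI allI impI)
      fix x U assume x: "x \<in> J" "open U" "x \<in> U"
      then obtain e where e: "e > 0" "ball x e \<subseteq> U \<inter> J"
        by (metis IntI open_Int open_contains_ball open_interior)
      obtain d where d: "d > 0" "\<And>h. 0 < h \<Longrightarrow> h < d \<Longrightarrow> cdf \<mu> x < cdf \<mu> (x + h)"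
        using DERIV_pos_inc_right[OF cdf_has_derivative[OF x(1)] deriv_pos[OF x(1)]] by auto
      define h where "h = min d e / 2"
      have h: "0 < h" "h < d" "h < e" using d e by (auto simp: h_def)
      then have "0 < measure \<mu> {x<..x+h}" using d(2)[OF h(1,2)] cdf_diff_eq[of x "x + h"] by simp
      also have "\<dots> \<le> measure \<mu> U"
        using h e \<open>open U\<close> by (intro finite_measure_mono) (auto simp: subset_iff dist_real_def)
      finally show "0 < measure \<mu> U" .
    qed
  qed simp
qed

text \<open>The hypotheses do not exclude atoms at end points of \<open>I\<close>, so absolute
  continuity is claimed only for the restriction of the law to the interior.\<close>

lemma density_interior:
  "density \<mu> (\<lambda>x. indicator J x) = density lborel (\<lambda>x. ennreal (dens x))"
proof (rule measure_eqI_lessThan)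
  let ?\<nu>1 = "density \<mu> (\<lambda>x. indicator J x)" and ?\<nu>2 = "density lborel (\<lambda>x. ennreal (dens x))"
  have Jb [measurable]: "J \<in> sets borel" by simp
  show "sets ?\<nu>1 = sets borel" "sets ?\<nu>2 = sets borel" by auto
  have e1: "emeasure ?\<nu>1 A = emeasure \<mu> (A \<inter> J)" if [measurable]: "A \<in> sets borel" for A
    by (subst emeasure_density) (auto simp: indicator_inter_arith[symmetric] Int_commute
        intro!: arg_cong2[where f=emeasure] simp flip: nn_integral_indicator indicator_inter_arith)
  have e2: "emeasure ?\<nu>2 A = emeasure ?\<nu>2 (A \<inter> J)" if [measurable]: "A \<in> sets borel" for A
  proof -
    have "(\<integral>\<^sup>+y. ennreal (dens y) * indicator A y \<partial>lborel) = (\<integral>\<^sup>+y. ennreal (dens y) * indicator (A \<inter> J) y \<partial>lborel)"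
      by (intro nn_integral_cong) (auto simp: dens_def indicator_def)
    then show ?thesis by (simp add: emeasure_density)
  qed
  fix x :: real
  show "emeasure ?\<nu>1 {x<..} < \<infinity>" by (subst e1) (auto simp: less_top[symmetric])
  \<comment> \<open>The part of the half-line inside \<open>J\<close> is an open interval or empty.
    On a compact interval inside it the distribution function is a primitive of its derivative, so
    both measures of a half-open interval are the same increment.\<close>
  have "emeasure ?\<nu>1 ({x<..} \<inter> J) = emeasure ?\<nu>2 ({x<..} \<inter> J)"
  proof (cases "{x<..} \<inter> J = {}")
    case False
    have "convex ({x<..} \<inter> J)" using convex_I by (intro convex_Int convex_interior) auto
    then have "is_interval ({x<..} \<inter> J)" by (simp add: is_interval_convex_1)
    then obtain a b where ab: "a < b" "{x<..} \<inter> J = einterval a b"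
      using open_interval_eq_einterval[OF _ _ False] by (metis open_Int open_greaterThan open_interior)
    show ?thesis unfolding ab(2)
    proof (rule emeasure_einterval_eqI)
      fix l u :: real assume lu: "l < u" "{l..u} \<subseteq> einterval a b"
      then have luJ: "{l..u} \<subseteq> J" using ab(2) by auto
      have "emeasure ?\<nu>2 {l<..u} = (\<integral>\<^sup>+y. ennreal (dens y) * indicator {l<..u} y \<partial>lborel)"
        by (simp add: emeasure_density)
      also have "\<dots> = (\<integral>\<^sup>+y. ennreal (dens y) * indicator {l..u} y \<partial>lborel)"
        using AE_lborel_singleton[of l] by (intro nn_integral_cong_AE) (auto simp: indicator_def)
      also have "\<dots> = ennreal (cdf \<mu> u - cdf \<mu> l)"
        using lu luJ cdf_has_derivative by (intro nn_integral_FTC_Icc)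
          (auto simp: dens_nonneg, auto simp: dens_def subset_iff)
      also have "\<dots> = emeasure \<mu> ({l<..u} \<inter> J)"
      proof -
        have "{l<..u} \<inter> J = {l<..u}" using luJ by auto
        then show ?thesis using cdf_diff_eq[OF lu(1)] by (simp add: emeasure_eq_measure)
      qed
      finally show "emeasure ?\<nu>1 {l<..u} = emeasure ?\<nu>2 {l<..u}" by (simp add: e1)
    qed (use ab in auto)
  qed simp
  then show "emeasure ?\<nu>1 {x<..} = emeasure ?\<nu>2 {x<..}"
    using e1[of "{x<..}"] e1[of "{x<..} \<inter> J"] e2[of "{x<..}"] by simp
qed

section \<open>The partial first moment and the kernel identity\<close>

definition lower_moment :: "real \<Rightarrow> real" where
  "lower_moment y = - (LINT x:{..y}|\<mu>. x)"

lemma lower_moment_measurable [measurable]: "lower_moment \<in> borel_measurable borel"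
proof -
  have [measurable]: "(\<lambda>(y, x). indicator {..y} x *\<^sub>R x :: real) \<in> borel_measurable (borel \<Otimes>\<^sub>M \<mu>)"
  proof -
    have "(\<lambda>(y, x). (if x \<le> y then 1 else 0) *\<^sub>R x :: real) \<in> borel_measurable (borel \<Otimes>\<^sub>M borel)"
      by measurable
    moreover have "sets (borel \<Otimes>\<^sub>M \<mu>) = sets (borel \<Otimes>\<^sub>M (borel :: real measure))"
      by (intro sets_pair_measure_cong) (auto simp: M_is_borel)
    ultimately show ?thesis
      by (simp add: indicator_def of_bool_def cong: measurable_cong_sets)
  qed
  show ?thesis
    unfolding lower_moment_def[abs_def] set_lebesgue_integral_def by measurable
qed

lemma stein_kernel_eq:
  "stein_kernel \<mu> y = indicator J y * (lower_moment y / deriv (cdf \<mu>) y)"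
  by (simp add: stein_kernel_def interior_law_support lower_moment_def)

lemma stein_kernel_measurable [measurable]: "stein_kernel \<mu> \<in> borel_measurable borel"
proof -
  \<comment> \<open>Replacing \<open>deriv (cdf \<mu>)\<close> by \<open>dens\<close> makes the
    quotient measurable on the whole line; the two agree where the indicator is nonzero.\<close>
  have "stein_kernel \<mu> y = indicator J y * (lower_moment y / dens y)" for y
    by (auto simp: stein_kernel_eq dens_def indicator_def)
  then show ?thesis by (subst measurable_cong) auto
qed

end

locale centered_interval_law = interval_law +
  assumes sq_integrable: "integrable \<mu> (\<lambda>x. x\<^sup>2)" and mean_zero: "(\<integral>x. x \<partial>\<mu>) = 0"
begin

lemma id_measurable: "(\<lambda>x. x) \<in> borel_measurable \<mu>"
  by (simp add: M_is_borel)

lemma id_integrable: "integrable \<mu> (\<lambda>x. x)"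
  by (rule square_integrable_imp_integrable[OF id_measurable sq_integrable])

lemma upper_moment: "(LINT x:{y<..}|\<mu>. x) = lower_moment y"
  using set_integral_atMost_add_greaterThan[OF id_integrable M_is_borel, of y] mean_zero
  by (simp add: lower_moment_def)

text \<open>Inside \<open>J\<close> this is the definition of the kernel. A point outside
  \<open>I\<close> has all mass on one side, so the partial moment is the mean or an empty integral,
  0 in both cases. The boundary points left over form a Lebesgue null set.\<close>

lemma lower_moment_dens:
  "AE y in lborel. lower_moment y = dens y * stein_kernel \<mu> y"
proof -
  have "negligible (frontier I)" by (rule negligible_convex_frontier[OF convex_I])
  then have "frontier I \<in> null_sets lborel"
    by (simp add: negligible_iff_null_sets null_sets_completion_iff)
  then have "AE y in lborel. y \<notin> frontier I" by (rule AE_not_in)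
  then show ?thesis
  proof (rule eventually_mono)
    fix y assume y: "y \<notin> frontier I"
    show "lower_moment y = dens y * stein_kernel \<mu> y"
    proof (cases "y \<in> J")
      case True
      then show ?thesis using deriv_pos[OF True] by (simp add: dens_def stein_kernel_eq)
    next
      case False
      with y have "y \<notin> I" using closure_subset by (auto simp: frontier_def)
      then have "(\<forall>x\<in>I. x < y) \<or> (\<forall>x\<in>I. y < x)"
        using is_interval by (meson is_interval_1 less_le_not_le linorder_linear not_le)
      then have "lower_moment y = 0"
      proof
        assume *: "\<forall>x\<in>I. x < y"
        have "(LINT x:{..y}|\<mu>. x) = (\<integral>x. x \<partial>\<mu>)"
          unfolding set_lebesgue_integral_def using AE_I *
          by (intro integral_cong_AE) (auto simp: M_is_borel indicator_def elim!: eventually_mono)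
        then show ?thesis using mean_zero by (simp add: lower_moment_def)
      next
        assume *: "\<forall>x\<in>I. y < x"
        have "(LINT x:{..y}|\<mu>. x) = (\<integral>x. 0 \<partial>\<mu>)"
          unfolding set_lebesgue_integral_def using AE_I *
          by (intro integral_cong_AE) (auto simp: M_is_borel indicator_def elim!: eventually_mono)
        then show ?thesis by (simp add: lower_moment_def)
      qed
      with False show ?thesis by (simp add: dens_def)
    qed
  qed
qed

text \<open>The density in the denominator of the kernel cancels against the density of the law.
  Possible atoms at end points of \<open>I\<close> contribute nothing because the kernel has the
  value 0 there.\<close>

lemma stein_kernel_density:
  assumes [measurable]: "w \<in> borel_measurable borel"
  shows "(\<integral>x. stein_kernel \<mu> x * w x \<partial>\<mu>) = (\<integral>y. lower_moment y * w y \<partial>lborel)"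
proof -
  have [measurable]: "J \<in> sets borel" by simp
  have m [measurable]: "(\<lambda>x. stein_kernel \<mu> x * w x) \<in> borel_measurable borel" by measurable
  have m' [measurable]: "(\<lambda>x. stein_kernel \<mu> x * w x) \<in> borel_measurable \<mu>"
    "(\<lambda>x. indicator J x :: real) \<in> borel_measurable \<mu>"
    by (rule measurable_finite_borel, measurable)+
  have ae: "AE y in lborel. lower_moment y * w y = dens y *\<^sub>R (stein_kernel \<mu> y * w y)"
    using lower_moment_dens by (auto elim!: eventually_mono)
  have ind: "(\<lambda>x. indicator J x) = (\<lambda>x. ennreal (indicator J x))" by (auto simp: indicator_def)
  have e: "indicator J x * (stein_kernel \<mu> x * w x) = stein_kernel \<mu> x * w x" for x
    by (auto simp: stein_kernel_eq indicator_def)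
  have "(\<integral>y. lower_moment y * w y \<partial>lborel) = (\<integral>y. dens y *\<^sub>R (stein_kernel \<mu> y * w y) \<partial>lborel)"
    by (rule integral_cong_AE) (use ae in auto)
  also have "\<dots> = (\<integral>y. stein_kernel \<mu> y * w y \<partial>density lborel (\<lambda>y. ennreal (dens y)))"
    by (subst integral_density) (auto simp: dens_nonneg)
  also have "\<dots> = (\<integral>y. stein_kernel \<mu> y * w y \<partial>\<mu>)"
    unfolding density_interior[symmetric] ind
    by (subst integral_density) (auto simp: e m')
  finally show "(\<integral>x. stein_kernel \<mu> x * w x \<partial>\<mu>) = (\<integral>y. lower_moment y * w y \<partial>lborel)" by simp
qed

text \<open>Fubini applied to \<open>x * (g x - g 0)\<close>, where \<open>g x - g 0\<close> is the integral of \<open>g'\<close>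
  from \<open>0\<close> to \<open>x\<close>.\<close>

lemma lower_moment_identity:
  assumes g: "\<And>x. (g has_real_derivative g' x) (at x)" and c: "continuous_on UNIV g'"
    and b: "\<And>x. \<bar>g' x\<bar> \<le> C"
  shows "(\<integral>x. x * g x \<partial>\<mu>) = (\<integral>y. lower_moment y * g' y \<partial>lborel)"
proof -
  interpret P: pair_sigma_finite \<mu> lborel ..
  \<comment> \<open>The signed indicator of the segment between 0 and \<open>x\<close>: its integral
    against \<open>g'\<close> is \<open>g x - g 0\<close> for either sign of
    \<open>x\<close>.\<close>
  define s :: "real \<Rightarrow> real \<Rightarrow> real" where
    "s x y = indicator {0..<x} y - indicator {x..<0} y" for x y
  define k where "k = (\<lambda>(x, y). x * s x y * g' y)"
  have C: "C \<ge> 0" using b[of 0] by simp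
  have [measurable]: "g' \<in> borel_measurable borel" by (rule borel_measurable_continuous_onI[OF c])
  have [measurable]: "g \<in> borel_measurable borel"
    by (intro borel_measurable_continuous_onI DERIV_continuous_on[of UNIV g g'] DERIV_subset[OF g]) auto
  have sets_eq: "sets (\<mu> \<Otimes>\<^sub>M lborel) = sets (borel \<Otimes>\<^sub>M (borel :: real measure))"
    by (intro sets_pair_measure_cong) (auto simp: M_is_borel)
  have "(\<lambda>(x, y). x * ((if 0 \<le> y \<and> y < x then 1 else 0) - (if x \<le> y \<and> y < 0 then 1 else 0)) * g' y)
     \<in> borel_measurable (borel \<Otimes>\<^sub>M borel)"
    by measurable
  also have "(\<lambda>(x, y). x * ((if 0 \<le> y \<and> y < x then 1 else 0) - (if x \<le> y \<and> y < 0 then 1 else 0)) * g' y) = k"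
    by (auto simp: k_def s_def indicator_def fun_eq_iff)
  finally have k_meas: "k \<in> borel_measurable (\<mu> \<Otimes>\<^sub>M lborel)"
    by (simp add: measurable_cong_sets[OF sets_eq refl])
  have s_int: "set_integrable lborel A g'" if "A \<subseteq> {l..u}" "A \<in> sets borel" for A and l u :: real
    using that by (intro set_integrable_subset[OF borel_integrable_atLeastAtMost'[OF continuous_on_subset[OF c]], of l u]) auto
  have s1: "set_integrable lborel {0..<x} g'" and s2: "set_integrable lborel {x..<0} g'" for x
    by (rule s_int[of _ 0 x], auto)(rule s_int[of _ x 0], auto)
  have ki: "integrable lborel (\<lambda>y. k (x, y))" for x
  proof -
    have "integrable lborel (\<lambda>y. x * (indicator {0..<x} y *\<^sub>R g' y - indicator {x..<0} y *\<^sub>R g' y))"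
      using s1[of x] s2[of x] unfolding set_integrable_def
      by (intro integrable_mult_right Bochner_Integration.integrable_diff) auto
    then show ?thesis by (simp add: k_def s_def algebra_simps)
  qed
  have kv: "(\<integral>y. k (x, y) \<partial>lborel) = x * (g x - g 0)" for x
  proof -
    have FTC: "(LBINT y:{l..<u}. g' y) = g u - g l" if "l \<le> u" for l u
    proof -
      have "(LBINT y:{l..<u}. g' y) = (LBINT y=ereal l..ereal u. g' y)"
        using that by (simp add: interval_integral_Ico)
      also have "\<dots> = g u - g l"
        using that by (intro interval_integral_FTC_finite continuous_on_subset[OF c])
          (auto intro!: DERIV_subset[OF g] simp flip: has_real_derivative_iff_has_vector_derivative)
      finally show ?thesis .
    qed
    have "(\<integral>y. k (x, y) \<partial>lborel) = (\<integral>y. x * (indicator {0..<x} y *\<^sub>R g' y - indicator {x..<0} y *\<^sub>R g' y) \<partial>lborel)"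
      by (intro Bochner_Integration.integral_cong) (auto simp: k_def s_def algebra_simps)
    also have "\<dots> = x * ((LBINT y:{0..<x}. g' y) - (LBINT y:{x..<0}. g' y))"
      using s1[of x] s2[of x]
      unfolding set_integrable_def set_lebesgue_integral_def by simp
    also have "\<dots> = x * (g x - g 0)"
      using FTC[of 0 x] FTC[of x 0] by (cases "x \<ge> 0") (auto simp: set_lebesgue_integral_def)
    finally show ?thesis .
  qed
  \<comment> \<open>For fixed \<open>x\<close> the integrand is at most
    \<open>C * \<bar>x\<bar>\<close> on a segment of length \<bar>x\<bar>, so the finite second
    moment of the law justifies Fubini.\<close>
  have kb: "(\<integral>y. norm (k (x, y)) \<partial>lborel) \<le> C * x\<^sup>2" for x
  proof -
    have "(\<integral>y. norm (k (x, y)) \<partial>lborel) \<le> (\<integral>y. C * \<bar>x\<bar> * indicator {min 0 x..max 0 x} y \<partial>lborel)"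
    proof (rule integral_mono)
      show "norm (k (x, y)) \<le> C * \<bar>x\<bar> * indicator {min 0 x..max 0 x} y" for y
        using b[of y] C mult_left_mono[OF b[of y], of "\<bar>x\<bar>"]
        by (auto simp: k_def s_def abs_mult indicator_def mult.commute)
    qed (use ki in auto)
    also have "\<dots> = C * \<bar>x\<bar> * \<bar>x\<bar>" by (simp add: measure_def abs_if min_def max_def)
    finally show ?thesis by (simp add: power2_eq_square mult.assoc)
  qed
  have int: "integrable (\<mu> \<Otimes>\<^sub>M lborel) k"
  proof (rule P.Fubini_integrable[OF k_meas])
    show "integrable \<mu> (\<lambda>x. \<integral>y. norm (k (x, y)) \<partial>lborel)"
    proof (rule Bochner_Integration.integrable_bound)
      show "integrable \<mu> (\<lambda>x. C * x\<^sup>2)" using sq_integrable by simp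
      show "(\<lambda>x. \<integral>y. norm (k (x, y)) \<partial>lborel) \<in> borel_measurable \<mu>" using k_meas by measurable
      show "AE x in \<mu>. norm (\<integral>y. norm (k (x, y)) \<partial>lborel) \<le> norm (C * x\<^sup>2)"
        using kb C by (auto simp: Bochner_Integration.integral_nonneg)
    qed
  qed (simp add: ki)
  \<comment> \<open>For \<open>y \<ge> 0\<close> the inner integral is the upper partial moment, for
    \<open>y < 0\<close> minus the lower one. They are given by one formula because the law is
    centred.\<close>
  have ky: "(\<integral>x. k (x, y) \<partial>\<mu>) = lower_moment y * g' y" for y
  proof -
    have "(\<integral>x. x * s x y \<partial>\<mu>) = lower_moment y"
    proof (cases "y \<ge> 0")
      case True
      then have "(\<integral>x. x * s x y \<partial>\<mu>) = (LINT x:{y<..}|\<mu>. x)"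
        unfolding set_lebesgue_integral_def
        by (intro Bochner_Integration.integral_cong) (auto simp: s_def indicator_def)
      then show ?thesis by (simp add: upper_moment)
    next
      case False
      then have "(\<integral>x. x * s x y \<partial>\<mu>) = (\<integral>x. - (indicator {..y} x *\<^sub>R x) \<partial>\<mu>)"
        by (intro Bochner_Integration.integral_cong) (auto simp: s_def indicator_def)
      then show ?thesis by (simp add: lower_moment_def set_lebesgue_integral_def)
    qed
    then show ?thesis by (simp add: k_def)
  qed
  have i: "integrable \<mu> (\<lambda>x. x * (g x - g 0))"
    using P.integrable_fst[of "\<lambda>x y. k (x, y)"] int by (simp add: kv)
  have "(\<integral>x. x * g x \<partial>\<mu>) = (\<integral>x. x * (g x - g 0) + x * g 0 \<partial>\<mu>)" by (simp add: algebra_simps)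
  also have "\<dots> = (\<integral>x. x * (g x - g 0) \<partial>\<mu>) + (\<integral>x. x * g 0 \<partial>\<mu>)"
    by (intro Bochner_Integration.integral_add i integrable_mult_left id_integrable)
  also have "\<dots> = (\<integral>x. x * (g x - g 0) \<partial>\<mu>)" using mean_zero by simp
  also have "\<dots> = (\<integral>y. (\<integral>x. k (x, y) \<partial>\<mu>) \<partial>lborel)"
    using P.Fubini_integral[of "\<lambda>x y. k (x, y)"] int by (simp add: kv)
  finally show "(\<integral>x. x * g x \<partial>\<mu>) = (\<integral>y. lower_moment y * g' y \<partial>lborel)"
    by (simp add: ky)
qed

lemma stein_kernel_identity:
  assumes g: "\<And>x. (g has_real_derivative g' x) (at x)" and c: "continuous_on UNIV g'"
    and b: "\<And>x. \<bar>g' x\<bar> \<le> C"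
  shows "(\<integral>x. x * g x \<partial>\<mu>) = (\<integral>x. stein_kernel \<mu> x * g' x \<partial>\<mu>)"
  using lower_moment_identity[OF assms] stein_kernel_density[of g']
    borel_measurable_continuous_onI[OF c] by simp

lemma stein_kernel_mean: "(\<integral>x. stein_kernel \<mu> x \<partial>\<mu>) = (\<integral>x. x\<^sup>2 \<partial>\<mu>)"
  using stein_kernel_identity[of "\<lambda>x. x" "\<lambda>_. 1" 1] by (simp add: power2_eq_square)

end

section \<open>Linear and quadratic forms in independent variables\<close>

lemma integrable_mult_of_squares:
  fixes f g :: "'a \<Rightarrow> real"
  assumes "f \<in> borel_measurable M" "g \<in> borel_measurable M"
    "integrable M (\<lambda>x. (f x)\<^sup>2)" "integrable M (\<lambda>x. (g x)\<^sup>2)"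
  shows "integrable M (\<lambda>x. f x * g x)"
proof (rule Bochner_Integration.integrable_bound)
  show "integrable M (\<lambda>x. (f x)\<^sup>2 + (g x)\<^sup>2)" using assms by simp
  have "\<bar>y * z\<bar> \<le> y\<^sup>2 + z\<^sup>2" for y z :: real
    using sum_squares_bound[of "\<bar>y\<bar>" "\<bar>z\<bar>"] mult_nonneg_nonneg[of "\<bar>y\<bar>" "\<bar>z\<bar>"]
    unfolding abs_mult power2_abs by linarith
  then show "AE x in M. norm (f x * g x) \<le> norm ((f x)\<^sup>2 + (g x)\<^sup>2)" by auto
qed (use assms in simp)

lemma integral_Cauchy_Schwarz:
  fixes f g :: "'a \<Rightarrow> real"
  assumes "f \<in> borel_measurable M" "g \<in> borel_measurable M"
    "integrable M (\<lambda>x. (f x)\<^sup>2)" "integrable M (\<lambda>x. (g x)\<^sup>2)"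
    and pos: "0 < (\<integral>x. (g x)\<^sup>2 \<partial>M)"
  shows "(\<integral>x. f x * g x \<partial>M)\<^sup>2 \<le> (\<integral>x. (f x)\<^sup>2 \<partial>M) * (\<integral>x. (g x)\<^sup>2 \<partial>M)"
proof -
  note i = integrable_mult_of_squares[OF assms(1-4)]
  \<comment> \<open>The value of \<open>t\<close> minimizing the integral of (f - t * g)^2.\<close>
  define t where "t = (\<integral>x. f x * g x \<partial>M) / (\<integral>x. (g x)\<^sup>2 \<partial>M)"
  have "0 \<le> (\<integral>x. (f x - t * g x)\<^sup>2 \<partial>M)" by simp
  also have "(\<lambda>x. (f x - t * g x)\<^sup>2) = (\<lambda>x. (f x)\<^sup>2 - 2 * t * (f x * g x) + t\<^sup>2 * (g x)\<^sup>2)"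
    by (auto simp: power2_eq_square algebra_simps)
  also have "(\<integral>x. (f x)\<^sup>2 - 2 * t * (f x * g x) + t\<^sup>2 * (g x)\<^sup>2 \<partial>M)
     = (\<integral>x. (f x)\<^sup>2 \<partial>M) - 2 * t * (\<integral>x. f x * g x \<partial>M) + t\<^sup>2 * (\<integral>x. (g x)\<^sup>2 \<partial>M)"
    using assms i by simp
  also have "\<dots> = (\<integral>x. (f x)\<^sup>2 \<partial>M) - (\<integral>x. f x * g x \<partial>M)\<^sup>2 / (\<integral>x. (g x)\<^sup>2 \<partial>M)"
    using pos by (simp add: t_def power2_eq_square)
  finally show ?thesis using pos by (simp add: field_simps)
qed

section \<open>Independence of blocks of coordinates\<close>

locale iid_family = prob_space M + law: real_distribution \<mu> for M :: "'a measure" and \<mu> :: "real measure" +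
  fixes X :: "'i \<Rightarrow> 'a \<Rightarrow> real" and S :: "'i set"
  assumes indep: "indep_vars (\<lambda>_. borel) X S" and finite_S: "finite S"
    and law: "\<And>k. k \<in> S \<Longrightarrow> distr M borel (X k) = \<mu>"
    and first: "(\<integral>x. x \<partial>\<mu>) = 0" and second: "(\<integral>x. x\<^sup>2 \<partial>\<mu>) = 1"
begin

text \<open>The sigma-algebra generated by the coordinates in \<open>J\<close>. Measurability with
  respect to it expresses that a random variable depends on these coordinates only, without
  exhibiting it as a function of them.\<close>

definition generated :: "'i set \<Rightarrow> 'a measure" where
  "generated J = vimage_algebra (space M) (\<lambda>\<omega>. restrict (\<lambda>i. X i \<omega>) J) (PiM J (\<lambda>_. borel))"

lemma X_measurable: "k \<in> S \<Longrightarrow> X k \<in> borel_measurable M"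
  using indep by (auto simp: indep_vars_def)

lemma restrict_measurable:
  "J \<subseteq> S \<Longrightarrow> (\<lambda>\<omega>. restrict (\<lambda>i. X i \<omega>) J) \<in> measurable M (PiM J (\<lambda>_. borel))"
  by (intro measurable_restrict X_measurable) auto

lemma space_generated [simp]: "space (generated J) = space M"
  by (simp add: generated_def)

lemma X_generated [measurable]: "k \<in> J \<Longrightarrow> J \<subseteq> S \<Longrightarrow> X k \<in> borel_measurable (generated J)"
proof -
  assume k: "k \<in> J" "J \<subseteq> S"
  have "(\<lambda>\<omega>. restrict (\<lambda>i. X i \<omega>) J) \<in> measurable (generated J) (PiM J (\<lambda>_. borel))"
    unfolding generated_def
    by (rule measurable_vimage_algebra1) (auto simp: space_PiM)
  from measurable_compose[OF this measurable_component_singleton[OF k(1)]]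
  show ?thesis using k by simp
qed

lemma generated_measurable:
  assumes "Y \<in> measurable (generated J) N" "J \<subseteq> S"
  shows "Y \<in> measurable M N"
proof -
  have "sets (generated J) \<subseteq> sets M"
    unfolding generated_def by (intro sets_image_in_sets restrict_measurable assms) simp
  then show ?thesis using assms(1) unfolding measurable_def by auto
qed

lemma indep_set_generated:
  assumes "A \<inter> B = {}" "A \<subseteq> S" "B \<subseteq> S"
  shows "indep_set (sets (generated A)) (sets (generated B))"
proof -
  have "sigma_sets (space M) {(\<lambda>\<omega>. restrict (\<lambda>i. X i \<omega>) J) -` E \<inter> space M |E. E \<in> sets (PiM J (\<lambda>_. borel))}
      = sets (generated J)" if "J \<subseteq> S" for J
  proof -
    have "(\<lambda>\<omega>. restrict (\<lambda>i. X i \<omega>) J) \<in> space M \<rightarrow> space (PiM J (\<lambda>_. borel :: real measure))"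
      by (auto simp: space_PiM)
    then have "sets (generated J) = {(\<lambda>\<omega>. restrict (\<lambda>i. X i \<omega>) J) -` E \<inter> space M |E. E \<in> sets (PiM J (\<lambda>_. borel))}"
      unfolding generated_def by (rule sets_vimage_algebra2)
    then show ?thesis using sets.sigma_sets_eq[of "generated J"] by simp
  qed
  then show ?thesis
    using indep_var_restrict[OF indep assms] assms unfolding indep_var_eq by simp
qed

lemma indep_var_generated:
  fixes f g :: "'a \<Rightarrow> real"
  assumes "A \<inter> B = {}" "A \<subseteq> S" "B \<subseteq> S"
    and f: "f \<in> borel_measurable (generated A)" and g: "g \<in> borel_measurable (generated B)"
  shows "indep_var borel f borel g"
proof -
  have sub: "sigma_sets (space M) {h -` E \<inter> space M |E. E \<in> sets borel} \<subseteq> sets (generated J)"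
    if "h \<in> borel_measurable (generated J)" for h :: "'a \<Rightarrow> real" and J
    using sets.sigma_sets_subset[of "{h -` E \<inter> space M |E. E \<in> sets borel}" "generated J"]
      measurable_sets[OF that] by auto
  show ?thesis
    unfolding indep_var_eq
  proof (intro conjI generated_measurable[OF f] generated_measurable[OF g] assms(2,3))
    show "indep_set (sigma_sets (space M) {f -` E \<inter> space M |E. E \<in> sets borel})
       (sigma_sets (space M) {g -` E \<inter> space M |E. E \<in> sets borel})"
      using indep_set_generated[OF assms(1-3)] unfolding indep_set_def
      by (rule indep_sets_mono_sets) (use sub[OF f] sub[OF g] in \<open>auto split: bool.splits\<close>)
  qed
qed

text \<open>On rectangles the claim is the independence of the two blocks, and rectangles determine
  the product law. The target spaces are arbitrary because one of the variables will be a
  pair.\<close>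

lemma distr_pair_generated:
  assumes AB: "A \<inter> B = {}" "A \<subseteq> S" "B \<subseteq> S"
    and f: "f \<in> measurable (generated A) N" and g: "g \<in> measurable (generated B) L"
  shows "distr M N f \<Otimes>\<^sub>M distr M L g = distr M (N \<Otimes>\<^sub>M L) (\<lambda>\<omega>. (f \<omega>, g \<omega>))"
proof (rule pair_measure_eqI)
  note m = generated_measurable[OF f AB(2)] generated_measurable[OF g AB(3)]
  interpret f: prob_space "distr M N f" using m(1) by (rule prob_space_distr)
  interpret g: prob_space "distr M L g" using m(2) by (rule prob_space_distr)
  show "sigma_finite_measure (distr M N f)" "sigma_finite_measure (distr M L g)" by unfold_locales
  have p: "(\<lambda>\<omega>. (f \<omega>, g \<omega>)) \<in> measurable M (N \<Otimes>\<^sub>M L)" using m by measurable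
  show "sets (distr M N f \<Otimes>\<^sub>M distr M L g) = sets (distr M (N \<Otimes>\<^sub>M L) (\<lambda>\<omega>. (f \<omega>, g \<omega>)))"
    by (simp cong: sets_pair_measure_cong)
  fix E F assume "E \<in> sets (distr M N f)" "F \<in> sets (distr M L g)"
  then have EF: "E \<in> sets N" "F \<in> sets L" by auto
  have "prob ((f -` E \<inter> space M) \<inter> (g -` F \<inter> space M)) = prob (f -` E \<inter> space M) * prob (g -` F \<inter> space M)"
    using measurable_sets[OF f EF(1)] measurable_sets[OF g EF(2)]
    by (intro indep_setD[OF indep_set_generated[OF AB]]) auto
  moreover have "(\<lambda>\<omega>. (f \<omega>, g \<omega>)) -` (E \<times> F) \<inter> space M = (f -` E \<inter> space M) \<inter> (g -` F \<inter> space M)"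
    by auto
  ultimately show "emeasure (distr M N f) E * emeasure (distr M L g) F
     = emeasure (distr M (N \<Otimes>\<^sub>M L) (\<lambda>\<omega>. (f \<omega>, g \<omega>))) (E \<times> F)"
    using m p EF by (simp add: emeasure_distr emeasure_eq_measure ennreal_mult)
qed

lemma law_integral:
  fixes p :: "real \<Rightarrow> real"
  assumes "k \<in> S" "p \<in> borel_measurable borel"
  shows "integrable M (\<lambda>\<omega>. p (X k \<omega>)) \<longleftrightarrow> integrable \<mu> p"
    and "expectation (\<lambda>\<omega>. p (X k \<omega>)) = (\<integral>x. p x \<partial>\<mu>)"
  using assms X_measurable[OF assms(1)]
  by (simp_all add: law[OF assms(1), symmetric] integrable_distr_eq integral_distr)

text \<open>The step behind all moment computations below: one coordinate is integrated out against
  a variable of the others, with integrability and value obtained together.\<close>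

lemma has_integral_product:
  fixes p :: "real \<Rightarrow> real"
  assumes k: "k \<in> S" "k \<notin> J" "J \<subseteq> S" and Y: "Y \<in> borel_measurable (generated J)"
    and p: "p \<in> borel_measurable borel" "integrable \<mu> p" and iY: "integrable M Y"
  shows "has_bochner_integral M (\<lambda>\<omega>. p (X k \<omega>) * Y \<omega>) ((\<integral>x. p x \<partial>\<mu>) * expectation Y)"
proof -
  have i: "indep_var borel (\<lambda>\<omega>. p (X k \<omega>)) borel Y"
  proof (rule indep_var_generated[OF _ _ _ _ Y])
    show "(\<lambda>\<omega>. p (X k \<omega>)) \<in> borel_measurable (generated {k})"
      using k p(1) by (intro measurable_compose[OF X_generated]) auto
  qed (use k in auto)
  have "integrable M (\<lambda>\<omega>. p (X k \<omega>))" using law_integral(1)[OF k(1) p(1)] p(2) by simp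
  with indep_var_integrable[OF i _ iY] indep_var_lebesgue_integral[OF i _ iY] show ?thesis
    by (simp add: has_bochner_integral_iff law_integral(2)[OF k(1) p(1)])
qed

text \<open>Conditioning on the other coordinates, done by Fubini on the product law of
  \<open>X k\<close> and \<open>R\<close>: equal integrals in the single coordinate for each frozen
  value \<open>r\<close> give equal expectations.\<close>

lemma moment_eqI:
  fixes A B :: "real \<times> 'c \<Rightarrow> real"
  assumes k: "k \<in> S" "k \<notin> J" "J \<subseteq> S" and R: "R \<in> measurable (generated J) N"
    and A: "A \<in> borel_measurable (borel \<Otimes>\<^sub>M N)" "integrable M (\<lambda>\<omega>. A (X k \<omega>, R \<omega>))"
    and B: "B \<in> borel_measurable (borel \<Otimes>\<^sub>M N)" "integrable M (\<lambda>\<omega>. B (X k \<omega>, R \<omega>))"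
    and eq: "\<And>r. r \<in> space N \<Longrightarrow> (\<integral>x. A (x, r) \<partial>\<mu>) = (\<integral>x. B (x, r) \<partial>\<mu>)"
  shows "expectation (\<lambda>\<omega>. A (X k \<omega>, R \<omega>)) = expectation (\<lambda>\<omega>. B (X k \<omega>, R \<omega>))"
proof -
  let ?\<nu> = "distr M N R"
  have meas: "X k \<in> borel_measurable M" "R \<in> measurable M N"
    using X_measurable[OF k(1)] generated_measurable[OF R k(3)] by auto
  interpret m: prob_space \<mu> using prob_space_distr[OF meas(1)] law[OF k(1)] by simp
  interpret n: prob_space ?\<nu> using meas(2) by (rule prob_space_distr)
  interpret P: pair_sigma_finite \<mu> ?\<nu> ..
  have d: "\<mu> \<Otimes>\<^sub>M ?\<nu> = distr M (borel \<Otimes>\<^sub>M N) (\<lambda>\<omega>. (X k \<omega>, R \<omega>))"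
    unfolding law[OF k(1), symmetric]
  proof (rule distr_pair_generated[OF _ _ _ _ R])
    show "X k \<in> borel_measurable (generated {k})" using k by (intro X_generated) auto
  qed (use k in auto)
  have pm: "(\<lambda>\<omega>. (X k \<omega>, R \<omega>)) \<in> measurable M (borel \<Otimes>\<^sub>M N)" using meas by measurable
  have *: "expectation (\<lambda>\<omega>. C (X k \<omega>, R \<omega>)) = (\<integral>r. (\<integral>x. C (x, r) \<partial>\<mu>) \<partial>?\<nu>)"
    if C: "C \<in> borel_measurable (borel \<Otimes>\<^sub>M N)" "integrable M (\<lambda>\<omega>. C (X k \<omega>, R \<omega>))"
    for C :: "real \<times> 'c \<Rightarrow> real"
  proof -
    have "integrable (\<mu> \<Otimes>\<^sub>M ?\<nu>) C" unfolding d using C pm by (simp add: integrable_distr_eq)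
    then have "(\<integral>r. (\<integral>x. C (x, r) \<partial>\<mu>) \<partial>?\<nu>) = integral\<^sup>L (\<mu> \<Otimes>\<^sub>M ?\<nu>) C"
      using P.integral_snd[of "\<lambda>x r. C (x, r)"] by simp
    also have "\<dots> = expectation (\<lambda>\<omega>. C (X k \<omega>, R \<omega>))" unfolding d using C pm by (simp add: integral_distr)
    finally show ?thesis by simp
  qed
  show ?thesis unfolding *[OF A] *[OF B]
    by (rule Bochner_Integration.integral_cong[OF refl]) (simp add: eq)
qed

section \<open>Random variables with finite fourth moment\<close>

definition L4 :: "('a \<Rightarrow> real) \<Rightarrow> bool" where
  "L4 Y \<longleftrightarrow> Y \<in> borel_measurable M \<and> integrable M (\<lambda>\<omega>. Y \<omega> ^ 4)"

text \<open>A monomial of degree at most 4 is dominated by the fourth power of the maximum of 1 and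
  the two absolute values.\<close>

lemma L4_product:
  assumes Y: "L4 Y" and Z: "L4 Z" and ij: "i + j \<le> 4"
  shows "integrable M (\<lambda>\<omega>. Y \<omega> ^ i * Z \<omega> ^ j)"
proof (rule Bochner_Integration.integrable_bound)
  show "integrable M (\<lambda>\<omega>. 1 + Y \<omega> ^ 4 + Z \<omega> ^ 4)"
    using Y Z by (intro Bochner_Integration.integrable_add) (auto simp: L4_def)
  have [measurable]: "Y \<in> borel_measurable M" "Z \<in> borel_measurable M" using Y Z by (auto simp: L4_def)
  show "(\<lambda>\<omega>. Y \<omega> ^ i * Z \<omega> ^ j) \<in> borel_measurable M" by measurable
  have "\<bar>y ^ i * z ^ j\<bar> \<le> 1 + y ^ 4 + z ^ 4" for y z :: real
  proof -
    define m where "m = max 1 (max \<bar>y\<bar> \<bar>z\<bar>)"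
    have "\<bar>y\<bar> ^ i * \<bar>z\<bar> ^ j \<le> m ^ i * m ^ j"
      by (intro mult_mono power_mono) (auto simp: m_def)
    also have "\<dots> \<le> m ^ 4"
      using ij by (auto simp: power_add[symmetric] m_def intro!: power_increasing)
    also have "\<dots> \<le> 1 + \<bar>y\<bar> ^ 4 + \<bar>z\<bar> ^ 4"
      by (auto simp: m_def max_def)
    finally show ?thesis by (simp add: abs_mult power_abs)
  qed
  then show "AE \<omega> in M. norm (Y \<omega> ^ i * Z \<omega> ^ j) \<le> norm (1 + Y \<omega> ^ 4 + Z \<omega> ^ 4)"
    by (auto simp: abs_of_nonneg add_nonneg_nonneg)
qed

lemma L4_power: "L4 Y \<Longrightarrow> i \<le> 4 \<Longrightarrow> integrable M (\<lambda>\<omega>. Y \<omega> ^ i)"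
  using L4_product[of Y Y i 0] by simp

lemma L4_add: "L4 Y \<Longrightarrow> L4 Z \<Longrightarrow> L4 (\<lambda>\<omega>. Y \<omega> + Z \<omega>)"
proof -
  assume YZ: "L4 Y" "L4 Z"
  have "(\<lambda>\<omega>. (Y \<omega> + Z \<omega>) ^ 4) = (\<lambda>\<omega>. Y \<omega> ^ 4 * Z \<omega> ^ 0 + 4 * (Y \<omega> ^ 3 * Z \<omega> ^ 1) + 6 * (Y \<omega> ^ 2 * Z \<omega> ^ 2)
      + 4 * (Y \<omega> ^ 1 * Z \<omega> ^ 3) + Y \<omega> ^ 0 * Z \<omega> ^ 4)"
    by (auto simp: power2_eq_square power3_eq_cube power4_eq_xxxx algebra_simps)
  moreover have "integrable M \<dots>"
    by (intro Bochner_Integration.integrable_add integrable_mult_right L4_product YZ) auto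
  ultimately show ?thesis using YZ by (auto simp: L4_def)
qed

lemma L4_cmult: "L4 Y \<Longrightarrow> L4 (\<lambda>\<omega>. c * Y \<omega>)"
  by (auto simp: L4_def power_mult_distrib)

text \<open>The index set is a parameter for two reasons: moments are computed by induction on it,
  and through \<open>generated\<close> it records independence of the remaining coordinates.\<close>

definition lin :: "('i \<Rightarrow> real) \<Rightarrow> 'i set \<Rightarrow> 'a \<Rightarrow> real" where
  "lin b J \<omega> = (\<Sum>l\<in>J. b l * X l \<omega>)"

definition quad :: "('i \<Rightarrow> 'i \<Rightarrow> real) \<Rightarrow> 'i set \<Rightarrow> 'a \<Rightarrow> real" where
  "quad b J \<omega> = (\<Sum>l\<in>J. \<Sum>m\<in>J. b l m * X l \<omega> * X m \<omega>)"

lemma lin_generated [measurable]: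
  "J \<subseteq> K \<Longrightarrow> K \<subseteq> S \<Longrightarrow> lin b J \<in> borel_measurable (generated K)"
  unfolding lin_def[abs_def] by (intro borel_measurable_sum borel_measurable_times X_generated) auto

lemma quad_generated [measurable]:
  "J \<subseteq> K \<Longrightarrow> K \<subseteq> S \<Longrightarrow> quad b J \<in> borel_measurable (generated K)"
  unfolding quad_def[abs_def] by (intro borel_measurable_sum borel_measurable_times X_generated) auto

lemma lin_insert: "finite J \<Longrightarrow> k \<notin> J \<Longrightarrow> lin b (insert k J) \<omega> = b k * X k \<omega> + lin b J \<omega>"
  by (simp add: lin_def)

lemma quad_insert:
  assumes "finite J" "k \<notin> J" "\<And>l. l \<in> J \<Longrightarrow> b l k = b k l"
  shows "quad b (insert k J) \<omega> = quad b J \<omega> + 2 * X k \<omega> * lin (b k) J \<omega> + b k k * (X k \<omega>)\<^sup>2"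
proof -
  have "(\<Sum>l\<in>J. b l k * X l \<omega> * X k \<omega>) = X k \<omega> * lin (b k) J \<omega>"
    unfolding lin_def sum_distrib_left by (intro sum.cong) (auto simp: assms(3))
  moreover have "(\<Sum>m\<in>J. b k m * X k \<omega> * X m \<omega>) = X k \<omega> * lin (b k) J \<omega>"
    unfolding lin_def sum_distrib_left by (intro sum.cong) auto
  ultimately show ?thesis
    using assms(1,2) by (simp add: quad_def sum.distrib power2_eq_square)
qed

end

locale iid_family4 = iid_family +
  assumes fourth: "integrable \<mu> (\<lambda>x. x ^ 4)"
begin

abbreviation "m4 \<equiv> \<integral>x. x ^ 4 \<partial>\<mu>"

lemma law_power_integrable:
  assumes "i \<le> 4" shows "integrable \<mu> (\<lambda>x. x ^ i)"
proof (rule Bochner_Integration.integrable_bound)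
  show "integrable \<mu> (\<lambda>x. 1 + x ^ 4)" using fourth by simp
  have "\<bar>x ^ i\<bar> \<le> 1 + x ^ 4" for x :: real
  proof -
    have "\<bar>x\<bar> ^ i \<le> max 1 \<bar>x\<bar> ^ i" by (intro power_mono) auto
    also have "\<dots> \<le> max 1 \<bar>x\<bar> ^ 4" using assms by (intro power_increasing) auto
    also have "\<dots> \<le> 1 + \<bar>x\<bar> ^ 4" by (auto simp: max_def)
    finally show ?thesis by (simp add: power_abs)
  qed
  then show "AE x in \<mu>. norm (x ^ i) \<le> norm (1 + x ^ 4)" by (auto simp: abs_of_nonneg add_nonneg_nonneg)
qed (simp add: law.measurable_finite_borel)

lemma law_integrable: "integrable \<mu> (\<lambda>x. x)" "integrable \<mu> (\<lambda>x. x\<^sup>2)" "integrable \<mu> (\<lambda>x. x ^ 3)"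
  using law_power_integrable[of 1] law_power_integrable[of 2] law_power_integrable[of 3] by simp_all

lemma law_variance_square: "(\<integral>x. (x\<^sup>2 - 1)\<^sup>2 \<partial>\<mu>) = m4 - 1" "integrable \<mu> (\<lambda>x. (x\<^sup>2 - 1)\<^sup>2)"
proof -
  have e: "(\<lambda>x::real. (x\<^sup>2 - 1)\<^sup>2) = (\<lambda>x. x ^ 4 - 2 * x\<^sup>2 + 1)"
    by (auto simp: power2_eq_square power4_eq_xxxx algebra_simps)
  show "(\<integral>x. (x\<^sup>2 - 1)\<^sup>2 \<partial>\<mu>) = m4 - 1" "integrable \<mu> (\<lambda>x. (x\<^sup>2 - 1)\<^sup>2)"
    unfolding e using fourth law_integrable second law.prob_space by simp_all
qed

lemma m4_ge_1: "1 \<le> m4"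
proof -
  have "0 \<le> (\<integral>x. (x\<^sup>2 - 1)\<^sup>2 \<partial>\<mu>)" by simp
  then show ?thesis using law_variance_square by simp
qed

lemma L4_X: "k \<in> S \<Longrightarrow> L4 (X k)"
  using law_integral(1)[of k "\<lambda>x. x ^ 4"] fourth X_measurable by (simp add: L4_def)

lemma L4_lin: "J \<subseteq> S \<Longrightarrow> L4 (lin b J)"
proof -
  assume J: "J \<subseteq> S"
  then have "finite J" using finite_S finite_subset by blast
  then have "L4 (\<lambda>\<omega>. \<Sum>l\<in>J. b l * X l \<omega>)" using J
    by (induction J rule: finite_induct) (auto simp: L4_def[of "\<lambda>_. 0"] intro!: L4_add L4_cmult L4_X)
  then show ?thesis by (simp add: lin_def[abs_def])
qed

text \<open>Induction on the index set. When coordinate \<open>k\<close> is added, every mixed term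
  containing the first power of \<open>X k\<close> or of the old form has expectation 0, so only
  even mixed terms survive.\<close>

lemma lin_moments:
  assumes "J \<subseteq> S"
  shows "expectation (lin b J) = 0 \<and> expectation (\<lambda>\<omega>. (lin b J \<omega>)\<^sup>2) = (\<Sum>l\<in>J. (b l)\<^sup>2)
    \<and> expectation (\<lambda>\<omega>. lin b J \<omega> ^ 4) \<le> (2 + m4) * (\<Sum>l\<in>J. (b l)\<^sup>2)\<^sup>2"
proof -
  have "finite J" using assms finite_S finite_subset by blast
  then show ?thesis using assms
  proof (induction J rule: finite_induct)
    case empty
    then show ?case by (simp add: lin_def)
  next
    case (insert k J)
    then have k: "k \<in> S" "k \<notin> J" "J \<subseteq> S" by auto
    let ?V = "lin b J" and ?s = "\<Sum>l\<in>J. (b l)\<^sup>2"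
    have IH: "expectation ?V = 0" "expectation (\<lambda>\<omega>. (?V \<omega>)\<^sup>2) = ?s"
      "expectation (\<lambda>\<omega>. ?V \<omega> ^ 4) \<le> (2 + m4) * ?s\<^sup>2"
      using insert by auto
    have LV: "L4 ?V" using k by (intro L4_lin) auto
    have [measurable]: "?V \<in> borel_measurable (generated J)" using k by (intro lin_generated) auto
    have P: "has_bochner_integral M (\<lambda>\<omega>. X k \<omega> ^ i * ?V \<omega> ^ j)
       ((\<integral>x. x ^ i \<partial>\<mu>) * expectation (\<lambda>\<omega>. ?V \<omega> ^ j))" if "i + j \<le> 4" for i j
      using that by (intro has_integral_product[OF k, where p="\<lambda>x. x ^ i"] law_power_integrable L4_power[OF LV])
        auto
    note lin_k = lin_insert[OF insert.hyps(1,2)]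
    have one: "has_bochner_integral M (\<lambda>\<omega>. b k * (X k \<omega> ^ 1 * ?V \<omega> ^ 0) + X k \<omega> ^ 0 * ?V \<omega> ^ 1)
      (b k * ((\<integral>x. x ^ 1 \<partial>\<mu>) * expectation (\<lambda>\<omega>. ?V \<omega> ^ 0)) + (\<integral>x. x ^ 0 \<partial>\<mu>) * expectation (\<lambda>\<omega>. ?V \<omega> ^ 1))"
      by (intro has_bochner_integral_add has_bochner_integral_mult_right P) auto
    then have e1: "expectation (lin b (insert k J)) = 0"
      using IH(1) first law.prob_space prob_space by (simp add: has_bochner_integral_iff lin_k[abs_def])
    have "has_bochner_integral M
      (\<lambda>\<omega>. (b k)\<^sup>2 * (X k \<omega> ^ 2 * ?V \<omega> ^ 0) + 2 * b k * (X k \<omega> ^ 1 * ?V \<omega> ^ 1) + X k \<omega> ^ 0 * ?V \<omega> ^ 2)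
      ((b k)\<^sup>2 * ((\<integral>x. x ^ 2 \<partial>\<mu>) * expectation (\<lambda>\<omega>. ?V \<omega> ^ 0))
       + 2 * b k * ((\<integral>x. x ^ 1 \<partial>\<mu>) * expectation (\<lambda>\<omega>. ?V \<omega> ^ 1))
       + (\<integral>x. x ^ 0 \<partial>\<mu>) * expectation (\<lambda>\<omega>. ?V \<omega> ^ 2))"
      by (intro has_bochner_integral_add has_bochner_integral_mult_right P) auto
    then have "expectation (\<lambda>\<omega>. (b k)\<^sup>2 * (X k \<omega> ^ 2 * ?V \<omega> ^ 0) + 2 * b k * (X k \<omega> ^ 1 * ?V \<omega> ^ 1)
      + X k \<omega> ^ 0 * ?V \<omega> ^ 2) = (b k)\<^sup>2 + ?s"
      using IH first second law.prob_space prob_space by (simp add: has_bochner_integral_iff)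
    also have "(\<lambda>\<omega>. (b k)\<^sup>2 * (X k \<omega> ^ 2 * ?V \<omega> ^ 0) + 2 * b k * (X k \<omega> ^ 1 * ?V \<omega> ^ 1)
      + X k \<omega> ^ 0 * ?V \<omega> ^ 2) = (\<lambda>\<omega>. (lin b (insert k J) \<omega>)\<^sup>2)"
      by (auto simp: lin_k power2_eq_square algebra_simps)
    finally have e2: "expectation (\<lambda>\<omega>. (lin b (insert k J) \<omega>)\<^sup>2) = (b k)\<^sup>2 + ?s" .
    have "has_bochner_integral M
      (\<lambda>\<omega>. (b k)^4 * (X k \<omega> ^ 4 * ?V \<omega> ^ 0) + 4 * (b k)^3 * (X k \<omega> ^ 3 * ?V \<omega> ^ 1)
        + 6 * (b k)^2 * (X k \<omega> ^ 2 * ?V \<omega> ^ 2) + 4 * b k * (X k \<omega> ^ 1 * ?V \<omega> ^ 3) + X k \<omega> ^ 0 * ?V \<omega> ^ 4)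
      ((b k)^4 * ((\<integral>x. x ^ 4 \<partial>\<mu>) * expectation (\<lambda>\<omega>. ?V \<omega> ^ 0))
       + 4 * (b k)^3 * ((\<integral>x. x ^ 3 \<partial>\<mu>) * expectation (\<lambda>\<omega>. ?V \<omega> ^ 1))
       + 6 * (b k)^2 * ((\<integral>x. x ^ 2 \<partial>\<mu>) * expectation (\<lambda>\<omega>. ?V \<omega> ^ 2))
       + 4 * b k * ((\<integral>x. x ^ 1 \<partial>\<mu>) * expectation (\<lambda>\<omega>. ?V \<omega> ^ 3))
       + (\<integral>x. x ^ 0 \<partial>\<mu>) * expectation (\<lambda>\<omega>. ?V \<omega> ^ 4))"
      by (intro has_bochner_integral_add has_bochner_integral_mult_right P) auto
    then have "expectation (\<lambda>\<omega>. (b k)^4 * (X k \<omega> ^ 4 * ?V \<omega> ^ 0) + 4 * (b k)^3 * (X k \<omega> ^ 3 * ?V \<omega> ^ 1)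
        + 6 * (b k)^2 * (X k \<omega> ^ 2 * ?V \<omega> ^ 2) + 4 * b k * (X k \<omega> ^ 1 * ?V \<omega> ^ 3) + X k \<omega> ^ 0 * ?V \<omega> ^ 4)
      = (b k)^4 * m4 + 6 * (b k)\<^sup>2 * ?s + expectation (\<lambda>\<omega>. ?V \<omega> ^ 4)"
      using IH first second law.prob_space prob_space by (simp add: has_bochner_integral_iff)
    also have "(\<lambda>\<omega>. (b k)^4 * (X k \<omega> ^ 4 * ?V \<omega> ^ 0) + 4 * (b k)^3 * (X k \<omega> ^ 3 * ?V \<omega> ^ 1)
        + 6 * (b k)^2 * (X k \<omega> ^ 2 * ?V \<omega> ^ 2) + 4 * b k * (X k \<omega> ^ 1 * ?V \<omega> ^ 3) + X k \<omega> ^ 0 * ?V \<omega> ^ 4)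
       = (\<lambda>\<omega>. lin b (insert k J) \<omega> ^ 4)"
      by (auto simp: lin_k power2_eq_square power3_eq_cube power4_eq_xxxx algebra_simps)
    finally have e4: "expectation (\<lambda>\<omega>. lin b (insert k J) \<omega> ^ 4) =
      (b k)^4 * m4 + 6 * (b k)\<^sup>2 * ?s + expectation (\<lambda>\<omega>. ?V \<omega> ^ 4)" .
    have "0 \<le> ?s" by (intro sum_nonneg) auto
    \<comment> \<open>The constant \<open>2 + m4\<close> is at least \<open>m4\<close>, and twice it
      is at least 6 because \<open>m4 \<ge> 1\<close>; thus the three terms are dominated by those
      of a perfect square.\<close>
    have "(b k)^4 * m4 + 6 * (b k)\<^sup>2 * ?s + expectation (\<lambda>\<omega>. ?V \<omega> ^ 4)
       \<le> (b k)^4 * (2 + m4) + (2 * (2 + m4)) * ((b k)\<^sup>2 * ?s) + (2 + m4) * ?s\<^sup>2"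
      using IH(3) m4_ge_1 \<open>0 \<le> ?s\<close> mult_right_mono[of 6 "2 * (2 + m4)" "(b k)\<^sup>2 * ?s"]
        mult_left_mono[of m4 "2 + m4" "(b k)^4"]
      by simp
    also have "\<dots> = (2 + m4) * ((b k)\<^sup>2 + ?s)\<^sup>2"
      by (simp add: power2_eq_square power4_eq_xxxx algebra_simps)
    finally show ?case using e1 e2 e4 insert.hyps by simp
  qed
qed

text \<open>Induction on the index set. Coordinate \<open>k\<close> adds 2 * X k * V + b k k * ((X
  k)^2 - 1) to the centred form \<open>G\<close>. In the square, the terms with G * V and with
  \<open>G\<close> vanish because \<open>X k\<close> and (X k)^2 - 1 are centred, the term with (X
  k)^3 - X k because \<open>V\<close> is. What remains is four times the new off-diagonal squares
  plus (m4 - 1) * (b k k)^2.\<close>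

lemma quad_variance:
  assumes "J \<subseteq> S" and sym: "\<And>l m. l \<in> J \<Longrightarrow> m \<in> J \<Longrightarrow> b l m = b m l"
  shows "has_bochner_integral M (\<lambda>\<omega>. (quad b J \<omega> - (\<Sum>l\<in>J. b l l))\<^sup>2)
    (2 * (\<Sum>l\<in>J. \<Sum>m\<in>J. (b l m)\<^sup>2) + (m4 - 3) * (\<Sum>l\<in>J. (b l l)\<^sup>2))"
proof -
  have "finite J" using assms finite_S finite_subset by blast
  then show ?thesis using assms
  proof (induction J rule: finite_induct)
    case empty
    then show ?case by (simp add: quad_def has_bochner_integral_zero)
  next
    case (insert k J)
    then have k: "k \<in> S" "k \<notin> J" "J \<subseteq> S" by auto
    let ?V = "lin (b k) J" and ?G = "\<lambda>\<omega>. quad b J \<omega> - (\<Sum>l\<in>J. b l l)"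
    let ?v = "2 * (\<Sum>l\<in>J. \<Sum>m\<in>J. (b l m)\<^sup>2) + (m4 - 3) * (\<Sum>l\<in>J. (b l l)\<^sup>2)"
    have IH: "has_bochner_integral M (\<lambda>\<omega>. (?G \<omega>)\<^sup>2) ?v" using insert by auto
    have LV: "L4 ?V" using k by (intro L4_lin) auto
    have V [measurable]: "?V \<in> borel_measurable (generated J)" using k by (intro lin_generated) auto
    have [measurable]: "quad b J \<in> borel_measurable (generated J)" using k by (intro quad_generated) auto
    have G [measurable]: "?G \<in> borel_measurable (generated J)" by measurable
    have meas: "?V \<in> borel_measurable M" "?G \<in> borel_measurable M"
      using generated_measurable[OF V k(3)] generated_measurable[OF G k(3)] by auto
    have iG2: "integrable M (\<lambda>\<omega>. (?G \<omega>)\<^sup>2)" using IH by (simp add: has_bochner_integral_iff)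
    have iV2: "integrable M (\<lambda>\<omega>. (?V \<omega>)\<^sup>2)" using L4_power[OF LV] by simp
    have iV: "integrable M ?V" using L4_power[OF LV, of 1] by simp
    have iG: "integrable M ?G" by (rule square_integrable_imp_integrable[OF meas(2) iG2])
    have iGV: "integrable M (\<lambda>\<omega>. ?G \<omega> * ?V \<omega>)"
      by (rule integrable_mult_of_squares[OF meas(2,1) iG2 iV2])
    have V2: "(\<lambda>\<omega>. (?V \<omega>)\<^sup>2) \<in> borel_measurable (generated J)"
      and GV: "(\<lambda>\<omega>. ?G \<omega> * ?V \<omega>) \<in> borel_measurable (generated J)"
      using V G by simp_all
    have mom: "expectation ?V = 0" "expectation (\<lambda>\<omega>. (?V \<omega>)\<^sup>2) = (\<Sum>l\<in>J. (b k l)\<^sup>2)"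
      using lin_moments[OF k(3)] by auto
    have p1: "(\<integral>x. x\<^sup>2 - 1 \<partial>\<mu>) = 0" "integrable \<mu> (\<lambda>x. x\<^sup>2 - 1)"
      "integrable \<mu> (\<lambda>x. x ^ 3 - x)"
      using law_integrable second law.prob_space by auto
    have "has_bochner_integral M (\<lambda>\<omega>. (?G \<omega>)\<^sup>2 + 4 * ((X k \<omega>)\<^sup>2 * (?V \<omega>)\<^sup>2)
       + (b k k)\<^sup>2 * (((X k \<omega>)\<^sup>2 - 1)\<^sup>2 * 1) + 4 * (X k \<omega> * (?G \<omega> * ?V \<omega>))
       + 2 * b k k * (((X k \<omega>)\<^sup>2 - 1) * ?G \<omega>) + 4 * b k k * ((X k \<omega> ^ 3 - X k \<omega>) * ?V \<omega>))
      (?v + 4 * ((\<integral>x. x\<^sup>2 \<partial>\<mu>) * expectation (\<lambda>\<omega>. (?V \<omega>)\<^sup>2))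
       + (b k k)\<^sup>2 * ((\<integral>x. (x\<^sup>2 - 1)\<^sup>2 \<partial>\<mu>) * expectation (\<lambda>\<omega>. 1))
       + 4 * ((\<integral>x. x \<partial>\<mu>) * expectation (\<lambda>\<omega>. ?G \<omega> * ?V \<omega>))
       + 2 * b k k * ((\<integral>x. x\<^sup>2 - 1 \<partial>\<mu>) * expectation ?G)
       + 4 * b k k * ((\<integral>x. x ^ 3 - x \<partial>\<mu>) * expectation ?V))"
      by (intro has_bochner_integral_add has_bochner_integral_mult_right IH
          has_integral_product[OF k, where p="\<lambda>x. x\<^sup>2" and Y="\<lambda>\<omega>. (?V \<omega>)\<^sup>2", OF V2 _ law_integrable(2) iV2]
          has_integral_product[OF k, where p="\<lambda>x. x", OF GV _ law_integrable(1) iGV]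
          has_integral_product[OF k, where p="\<lambda>x. (x\<^sup>2 - 1)\<^sup>2", OF _ _ law_variance_square(2)]
          has_integral_product[OF k, where p="\<lambda>x. x\<^sup>2 - 1", OF G _ p1(2) iG]
          has_integral_product[OF k, where p="\<lambda>x. x ^ 3 - x", OF V _ p1(3) iV]) simp_all
    also have "(\<lambda>\<omega>. (?G \<omega>)\<^sup>2 + 4 * ((X k \<omega>)\<^sup>2 * (?V \<omega>)\<^sup>2)
       + (b k k)\<^sup>2 * (((X k \<omega>)\<^sup>2 - 1)\<^sup>2 * 1) + 4 * (X k \<omega> * (?G \<omega> * ?V \<omega>))
       + 2 * b k k * (((X k \<omega>)\<^sup>2 - 1) * ?G \<omega>) + 4 * b k k * ((X k \<omega> ^ 3 - X k \<omega>) * ?V \<omega>))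
      = (\<lambda>\<omega>. (quad b (insert k J) \<omega> - (\<Sum>l\<in>insert k J. b l l))\<^sup>2)" (is "?L = ?R")
    proof
      fix \<omega>
      have "quad b (insert k J) \<omega> - (\<Sum>l\<in>insert k J. b l l)
         = ?G \<omega> + 2 * X k \<omega> * ?V \<omega> + b k k * ((X k \<omega>)\<^sup>2 - 1)"
        using insert by (subst quad_insert) (auto simp: algebra_simps)
      then show "?L \<omega> = ?R \<omega>"
        by (simp only:) (simp add: power2_eq_square power3_eq_cube algebra_simps)
    qed
    also have "?v + 4 * ((\<integral>x. x\<^sup>2 \<partial>\<mu>) * expectation (\<lambda>\<omega>. (?V \<omega>)\<^sup>2))
       + (b k k)\<^sup>2 * ((\<integral>x. (x\<^sup>2 - 1)\<^sup>2 \<partial>\<mu>) * expectation (\<lambda>\<omega>. 1))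
       + 4 * ((\<integral>x. x \<partial>\<mu>) * expectation (\<lambda>\<omega>. ?G \<omega> * ?V \<omega>))
       + 2 * b k k * ((\<integral>x. x\<^sup>2 - 1 \<partial>\<mu>) * expectation ?G)
       + 4 * b k k * ((\<integral>x. x ^ 3 - x \<partial>\<mu>) * expectation ?V)
       = ?v + 4 * (\<Sum>l\<in>J. (b k l)\<^sup>2) + (m4 - 1) * (b k k)\<^sup>2"
      using mom p1(1) first second law_variance_square(1) prob_space by simp
    also have "\<dots> = 2 * (\<Sum>l\<in>insert k J. \<Sum>m\<in>insert k J. (b l m)\<^sup>2)
       + (m4 - 3) * (\<Sum>l\<in>insert k J. (b l l)\<^sup>2)"
    proof -
      have "(\<Sum>l\<in>J. (b l k)\<^sup>2) = (\<Sum>l\<in>J. (b k l)\<^sup>2)"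
        by (intro sum.cong) (auto simp: insert.prems(2)[of _ k])
      then show ?thesis using insert.hyps by (simp add: sum.distrib algebra_simps)
    qed
    finally show ?case .
  qed
qed

end

section \<open>Fluctuations of the kernel form\<close>

text \<open>The variance estimate treats the kernel as an arbitrary function of mean 1 with finite
  second moment; integration by parts is added only in \<open>iid_stein\<close>.\<close>

locale iid_kernel = iid_family4 M \<mu> X S for M :: "'a measure" and \<mu> and X :: "'i \<Rightarrow> 'a \<Rightarrow> real" and S +
  fixes \<phi> :: "real \<Rightarrow> real" and a :: "'i \<Rightarrow> 'i \<Rightarrow> real"
  assumes \<phi>_measurable [measurable]: "\<phi> \<in> borel_measurable borel"
    and \<phi>_square: "integrable \<mu> (\<lambda>x. (\<phi> x)\<^sup>2)"
    and \<phi>_mean: "(\<integral>x. \<phi> x \<partial>\<mu>) = 1"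
    and sym: "\<And>k l. k \<in> S \<Longrightarrow> l \<in> S \<Longrightarrow> a k l = a l k"
    and diag: "\<And>k. k \<in> S \<Longrightarrow> a k k = 0"
begin

abbreviation "s2 \<equiv> \<integral>x. (\<phi> x)\<^sup>2 \<partial>\<mu>"

definition "\<psi> x = \<phi> x - 1"
text \<open>Together with \<open>\<beta>\<close> these are the only mixed moments of
  \<open>\<psi>\<close> that survive in the cross terms. By Cauchy-Schwarz their squares are at most
  \<open>s2 - 1\<close> times \<open>m4\<close> and times 1.\<close>

definition "\<alpha> = (\<integral>x. \<psi> x * x\<^sup>2 \<partial>\<mu>)"
definition "\<beta> = (\<integral>x. \<psi> x * x \<partial>\<mu>)"

lemma \<psi>_measurable [measurable]: "\<psi> \<in> borel_measurable borel"
  unfolding \<psi>_def[abs_def] by measurable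

lemma \<phi>_integrable: "integrable \<mu> \<phi>"
  using law.square_integrable_imp_integrable[OF law.measurable_finite_borel[OF \<phi>_measurable] \<phi>_square] .

lemma \<psi>_mean: "integrable \<mu> \<psi>" "(\<integral>x. \<psi> x \<partial>\<mu>) = 0"
  using \<phi>_integrable \<phi>_mean law.prob_space by (simp_all add: \<psi>_def[abs_def])

lemma \<psi>_square: "integrable \<mu> (\<lambda>x. (\<psi> x)\<^sup>2)" "(\<integral>x. (\<psi> x)\<^sup>2 \<partial>\<mu>) = s2 - 1"
proof -
  have e: "(\<lambda>x. (\<psi> x)\<^sup>2) = (\<lambda>x. (\<phi> x)\<^sup>2 - 2 * \<phi> x + 1)"
    by (auto simp: \<psi>_def power2_eq_square algebra_simps)
  show "integrable \<mu> (\<lambda>x. (\<psi> x)\<^sup>2)" "(\<integral>x. (\<psi> x)\<^sup>2 \<partial>\<mu>) = s2 - 1"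
    unfolding e using \<phi>_square \<phi>_integrable \<phi>_mean law.prob_space by simp_all
qed

lemma s2_ge_1: "1 \<le> s2"
proof -
  have "0 \<le> (\<integral>x. (\<psi> x)\<^sup>2 \<partial>\<mu>)" by simp
  then show ?thesis by (simp add: \<psi>_square)
qed

lemma law_measurable: "p \<in> borel_measurable borel \<Longrightarrow> p \<in> borel_measurable \<mu>" for p :: "real \<Rightarrow> real"
  by (rule law.measurable_finite_borel)

lemma law_measurables: "\<psi> \<in> borel_measurable \<mu>" "(\<lambda>x. x) \<in> borel_measurable \<mu>" "(\<lambda>x. x\<^sup>2) \<in> borel_measurable \<mu>"
  by (rule law_measurable, simp)+

lemma \<psi>_moments_integrable: "integrable \<mu> (\<lambda>x. \<psi> x * x\<^sup>2)" "integrable \<mu> (\<lambda>x. \<psi> x * x)"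
proof -
  note m = law_measurables
  show "integrable \<mu> (\<lambda>x. \<psi> x * x\<^sup>2)" "integrable \<mu> (\<lambda>x. \<psi> x * x)"
    using integrable_mult_of_squares[OF m(1,3) \<psi>_square(1)] integrable_mult_of_squares[OF m(1,2) \<psi>_square(1)]
      law_integrable fourth by simp_all
qed

lemma \<alpha>_bound: "\<alpha>\<^sup>2 \<le> (s2 - 1) * m4"
  using integral_Cauchy_Schwarz[OF law_measurables(1,3) \<psi>_square(1)] m4_ge_1 fourth \<psi>_square
  by (simp add: \<alpha>_def)

lemma \<beta>_bound: "\<beta>\<^sup>2 \<le> s2 - 1"
  using integral_Cauchy_Schwarz[OF law_measurables(1,2) \<psi>_square(1)] second law_integrable \<psi>_square
  by (simp add: \<beta>_def)

text \<open>Integrates out coordinate \<open>k\<close> after expanding the square. The term with W^2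
  drops out because \<open>\<psi>\<close> is centred, so every surviving term carries the
  coefficient \<open>c\<close>, which will be a matrix entry.\<close>

lemma centered_product:
  assumes k: "k \<in> S" "k \<notin> J" "J \<subseteq> S"
    and W: "W \<in> borel_measurable (generated J)" and Y: "Y \<in> borel_measurable (generated J)"
    and i: "integrable M Y" "integrable M (\<lambda>\<omega>. W \<omega> * Y \<omega>)" "integrable M (\<lambda>\<omega>. (W \<omega>)\<^sup>2 * Y \<omega>)"
  shows "has_bochner_integral M (\<lambda>\<omega>. \<psi> (X k \<omega>) * (c * X k \<omega> + W \<omega>)\<^sup>2 * Y \<omega>)
    (c\<^sup>2 * \<alpha> * expectation Y + 2 * c * \<beta> * expectation (\<lambda>\<omega>. W \<omega> * Y \<omega>))"
proof -
  have meas: "(\<lambda>\<omega>. W \<omega> * Y \<omega>) \<in> borel_measurable (generated J)"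
    "(\<lambda>\<omega>. (W \<omega>)\<^sup>2 * Y \<omega>) \<in> borel_measurable (generated J)"
    using W Y by simp_all
  have "has_bochner_integral M (\<lambda>\<omega>. c\<^sup>2 * (\<psi> (X k \<omega>) * (X k \<omega>)\<^sup>2 * Y \<omega>)
      + 2 * c * (\<psi> (X k \<omega>) * X k \<omega> * (W \<omega> * Y \<omega>)) + \<psi> (X k \<omega>) * ((W \<omega>)\<^sup>2 * Y \<omega>))
    (c\<^sup>2 * ((\<integral>x. \<psi> x * x\<^sup>2 \<partial>\<mu>) * expectation Y) + 2 * c * ((\<integral>x. \<psi> x * x \<partial>\<mu>) * expectation (\<lambda>\<omega>. W \<omega> * Y \<omega>))
     + (\<integral>x. \<psi> x \<partial>\<mu>) * expectation (\<lambda>\<omega>. (W \<omega>)\<^sup>2 * Y \<omega>))"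
    by (intro has_bochner_integral_add has_bochner_integral_mult_right
        has_integral_product[OF k, where p="\<lambda>x. \<psi> x * x\<^sup>2", OF Y _ \<psi>_moments_integrable(1) i(1)]
        has_integral_product[OF k, where p="\<lambda>x. \<psi> x * x", OF meas(1) _ \<psi>_moments_integrable(2) i(2)]
        has_integral_product[OF k, where p="\<psi>", OF meas(2) _ \<psi>_mean(1) i(3)]) simp_all
  moreover have "(\<lambda>\<omega>. c\<^sup>2 * (\<psi> (X k \<omega>) * (X k \<omega>)\<^sup>2 * Y \<omega>)
      + 2 * c * (\<psi> (X k \<omega>) * X k \<omega> * (W \<omega> * Y \<omega>)) + \<psi> (X k \<omega>) * ((W \<omega>)\<^sup>2 * Y \<omega>))
     = (\<lambda>\<omega>. \<psi> (X k \<omega>) * (c * X k \<omega> + W \<omega>)\<^sup>2 * Y \<omega>)"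
    by (auto simp: power2_eq_square algebra_simps)
  ultimately show ?thesis by (simp add: \<psi>_mean(2) \<alpha>_def \<beta>_def mult.assoc)
qed

text \<open>Omitting the index \<open>k\<close> leaves the row form unchanged, as the diagonal
  vanishes, and makes its independence of \<open>X k\<close> visible.\<close>

abbreviation V :: "'i \<Rightarrow> 'a \<Rightarrow> real" where
  "V k \<equiv> lin (a k) (S - {k})"

definition row :: "'i \<Rightarrow> real" where
  "row k = (\<Sum>l\<in>S. (a k l)\<^sup>2)"

lemma row_nonneg: "0 \<le> row k"
  unfolding row_def by (intro sum_nonneg) auto

lemma sum_squares_le_row: "J \<subseteq> S \<Longrightarrow> (\<Sum>l\<in>J. (a k l)\<^sup>2) \<le> row k"
  unfolding row_def using finite_S by (intro sum_mono2) auto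

lemma entry_le_row: "l \<in> S \<Longrightarrow> (a k l)\<^sup>2 \<le> row k"
  using sum_squares_le_row[of "{l}" k] by simp

lemma diagonal_term:
  assumes k: "k \<in> S"
  obtains v where "has_bochner_integral M (\<lambda>\<omega>. (\<psi> (X k \<omega>) * (V k \<omega>)\<^sup>2) * (\<psi> (X k \<omega>) * (V k \<omega>)\<^sup>2)) v"
    "v \<le> (s2 - 1) * (2 + m4) * (row k)\<^sup>2"
proof -
  have m: "(\<lambda>\<omega>. V k \<omega> ^ 4) \<in> borel_measurable (generated (S - {k}))"
    using lin_generated[of "S - {k}" "S - {k}" "a k"] by simp
  have "has_bochner_integral M (\<lambda>\<omega>. (\<psi> (X k \<omega>))\<^sup>2 * V k \<omega> ^ 4)
     ((\<integral>x. (\<psi> x)\<^sup>2 \<partial>\<mu>) * expectation (\<lambda>\<omega>. V k \<omega> ^ 4))"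
    by (rule has_integral_product[where p="\<lambda>x. (\<psi> x)\<^sup>2", OF k _ _ m _ \<psi>_square(1)])
      (auto intro!: L4_power L4_lin)
  moreover have "(\<lambda>\<omega>. (\<psi> (X k \<omega>))\<^sup>2 * V k \<omega> ^ 4) = (\<lambda>\<omega>. (\<psi> (X k \<omega>) * (V k \<omega>)\<^sup>2) * (\<psi> (X k \<omega>) * (V k \<omega>)\<^sup>2))"
    by (auto simp: power2_eq_square power4_eq_xxxx algebra_simps)
  ultimately have 1: "has_bochner_integral M (\<lambda>\<omega>. (\<psi> (X k \<omega>) * (V k \<omega>)\<^sup>2) * (\<psi> (X k \<omega>) * (V k \<omega>)\<^sup>2))
     ((s2 - 1) * expectation (\<lambda>\<omega>. V k \<omega> ^ 4))" by (simp add: \<psi>_square)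
  have "expectation (\<lambda>\<omega>. V k \<omega> ^ 4) \<le> (2 + m4) * (\<Sum>l\<in>S - {k}. (a k l)\<^sup>2)\<^sup>2"
    using lin_moments[of "S - {k}" "a k"] by auto
  also have "\<dots> \<le> (2 + m4) * (row k)\<^sup>2"
    using m4_ge_1 sum_squares_le_row[of "S - {k}" k]
    by (intro mult_left_mono power_mono) (auto intro: sum_nonneg)
  finally have "(s2 - 1) * expectation (\<lambda>\<omega>. V k \<omega> ^ 4) \<le> (s2 - 1) * ((2 + m4) * (row k)\<^sup>2)"
    using s2_ge_1 by (intro mult_left_mono) auto
  with 1 that show thesis by (simp add: mult.assoc)
qed

text \<open>With \<open>c = a k q\<close>, the forms \<open>V k\<close> and \<open>V q\<close> are c
  * X q + Wk and c * X k + Wq, where Wk and Wq avoid both indices. Applying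
  \<open>centered_product\<close> first to \<open>X k\<close> and then to \<open>X q\<close> leaves
  c^4 * \<alpha>^2 + 4 * c^2 * \<beta>^2 * E[Wk * Wq], and the last expectation is at most half the
  sum of the two row sums.\<close>

lemma cross_term:
  assumes kq: "k \<in> S" "q \<in> S" "k \<noteq> q"
  obtains v where "has_bochner_integral M (\<lambda>\<omega>. (\<psi> (X k \<omega>) * (V k \<omega>)\<^sup>2) * (\<psi> (X q \<omega>) * (V q \<omega>)\<^sup>2)) v"
    "v \<le> (a k q)^4 * \<alpha>\<^sup>2 + 2 * (a k q)\<^sup>2 * \<beta>\<^sup>2 * (row k + row q)"
proof -
  define R where "R = S - {k, q}"
  define c where "c = a k q"
  define Wk where "Wk = lin (a k) R"
  define Wq where "Wq = lin (a q) R"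
  have ins: "insert q R = S - {k}" "insert k R = S - {q}" "q \<notin> R" "k \<notin> R" "finite R" "R \<subseteq> S"
    using kq finite_S by (auto simp: R_def)
  have Vk: "V k \<omega> = c * X q \<omega> + Wk \<omega>" and Vq: "V q \<omega> = c * X k \<omega> + Wq \<omega>" for \<omega>
    using lin_insert[OF ins(5,3), of "a k" \<omega>] lin_insert[OF ins(5,4), of "a q" \<omega>] sym[OF kq(1,2)]
    unfolding ins(1,2) Wk_def Wq_def c_def by simp_all
  have LW: "L4 Wk" "L4 Wq" using ins unfolding Wk_def Wq_def by (auto intro: L4_lin)
  have mW: "Wk \<in> borel_measurable (generated R)" "Wq \<in> borel_measurable (generated R)"
    using ins unfolding Wk_def Wq_def by (auto intro: lin_generated)
  have mW': "Wq \<in> borel_measurable (generated (S - {k}))"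
    unfolding Wq_def by (intro lin_generated) (auto simp: R_def)
  have mV: "V k \<in> borel_measurable (generated (S - {k}))" by (intro lin_generated) auto
  have mX: "X q \<in> borel_measurable (generated (S - {k}))" using kq by (intro X_generated) auto
  have 1: "has_bochner_integral M (\<lambda>\<omega>. \<psi> (X q \<omega>) * (c * X q \<omega> + Wk \<omega>)\<^sup>2 * Wq \<omega> ^ i)
    (c\<^sup>2 * \<alpha> * expectation (\<lambda>\<omega>. Wq \<omega> ^ i) + 2 * c * \<beta> * expectation (\<lambda>\<omega>. Wk \<omega> * Wq \<omega> ^ i))" if "i \<le> 2" for i
    using that mW L4_power[OF LW(2), of i] L4_product[OF LW, of 1 i] L4_product[OF LW, of 2 i]
    by (intro centered_product[OF kq(2) ins(3,6)]) auto
  define Y where "Y = (\<lambda>\<omega>. \<psi> (X q \<omega>) * (V k \<omega>)\<^sup>2)"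
  \<comment> \<open>The cases \<open>i = 0\<close> and \<open>i = 1\<close> supply the values for
    the other application of \<open>centered_product\<close>; \<open>i = 2\<close> supplies its
    third integrability condition.\<close>
  have YW: "has_bochner_integral M (\<lambda>\<omega>. Wq \<omega> ^ i * Y \<omega>)
    (c\<^sup>2 * \<alpha> * expectation (\<lambda>\<omega>. Wq \<omega> ^ i) + 2 * c * \<beta> * expectation (\<lambda>\<omega>. Wk \<omega> * Wq \<omega> ^ i))" if "i \<le> 2" for i
    using 1[OF that] by (simp add: Y_def Vk mult.commute)
  have mom: "expectation Wk = 0" "expectation Wq = 0" "expectation (\<lambda>\<omega>. (Wk \<omega>)\<^sup>2) = (\<Sum>l\<in>R. (a k l)\<^sup>2)"
    "expectation (\<lambda>\<omega>. (Wq \<omega>)\<^sup>2) = (\<Sum>l\<in>R. (a q l)\<^sup>2)"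
    using lin_moments[OF ins(6)] unfolding Wk_def Wq_def by auto
  have mY: "Y \<in> borel_measurable (generated (S - {k}))"
    unfolding Y_def using mV measurable_compose[OF mX \<psi>_measurable] by simp
  have "has_bochner_integral M (\<lambda>\<omega>. \<psi> (X k \<omega>) * (c * X k \<omega> + Wq \<omega>)\<^sup>2 * Y \<omega>)
    (c\<^sup>2 * \<alpha> * expectation Y + 2 * c * \<beta> * expectation (\<lambda>\<omega>. Wq \<omega> * Y \<omega>))"
    using YW[of 0] YW[of 1] YW[of 2]
    by (intro centered_product[OF kq(1) _ _ mW' mY]) (auto simp: has_bochner_integral_iff)
  moreover have "expectation Y = c\<^sup>2 * \<alpha>" "expectation (\<lambda>\<omega>. Wq \<omega> * Y \<omega>) = 2 * c * \<beta> * expectation (\<lambda>\<omega>. Wk \<omega> * Wq \<omega>)"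
    using YW[of 0] YW[of 1] mom prob_space by (auto simp: has_bochner_integral_iff)
  ultimately have "has_bochner_integral M (\<lambda>\<omega>. (\<psi> (X k \<omega>) * (V k \<omega>)\<^sup>2) * (\<psi> (X q \<omega>) * (V q \<omega>)\<^sup>2))
     (c\<^sup>2 * \<alpha> * (c\<^sup>2 * \<alpha>) + 2 * c * \<beta> * (2 * c * \<beta> * expectation (\<lambda>\<omega>. Wk \<omega> * Wq \<omega>)))"
    by (simp add: Y_def Vq mult_ac)
  moreover have "c\<^sup>2 * \<alpha> * (c\<^sup>2 * \<alpha>) + 2 * c * \<beta> * (2 * c * \<beta> * expectation (\<lambda>\<omega>. Wk \<omega> * Wq \<omega>))
     \<le> (a k q)^4 * \<alpha>\<^sup>2 + 2 * (a k q)\<^sup>2 * \<beta>\<^sup>2 * (row k + row q)"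
  proof -
    have "2 * expectation (\<lambda>\<omega>. Wk \<omega> * Wq \<omega>) = expectation (\<lambda>\<omega>. 2 * (Wk \<omega> * Wq \<omega>))" by simp
    also have "\<dots> \<le> expectation (\<lambda>\<omega>. (Wk \<omega>)\<^sup>2 + (Wq \<omega>)\<^sup>2)"
      using L4_product[OF LW, of 1 1] L4_power[OF LW(1), of 2] L4_power[OF LW(2), of 2]
      by (intro integral_mono) (auto simp: sum_squares_bound[unfolded mult.assoc])
    also have "\<dots> = (\<Sum>l\<in>R. (a k l)\<^sup>2) + (\<Sum>l\<in>R. (a q l)\<^sup>2)"
      using L4_power[OF LW(1), of 2] L4_power[OF LW(2), of 2] mom by simp
    also have "\<dots> \<le> row k + row q" using ins by (intro add_mono sum_squares_le_row)
    finally have "2 * (c\<^sup>2 * \<beta>\<^sup>2) * (2 * expectation (\<lambda>\<omega>. Wk \<omega> * Wq \<omega>)) \<le> 2 * (c\<^sup>2 * \<beta>\<^sup>2) * (row k + row q)"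
      by (intro mult_left_mono) auto
    then show ?thesis by (simp add: c_def power2_eq_square power4_eq_xxxx mult_ac)
  qed
  ultimately show thesis using that by blast
qed

definition fluctuation :: "'a \<Rightarrow> real" where
  "fluctuation \<omega> = (\<Sum>k\<in>S. \<psi> (X k \<omega>) * (V k \<omega>)\<^sup>2)"

text \<open>Each cross term carries a factor (a k q)^2 besides a row sum or another squared entry.
  Bounding the latter by a multiple of \<open>L\<close> and summing the former over \<open>q\<close>
  leaves \<open>row k\<close>, so the double sum is at most a multiple of \<open>L\<close> times the
  total instead of the squared total.\<close>

lemma fluctuation_bound:
  assumes L: "\<And>k. k \<in> S \<Longrightarrow> row k \<le> L"
  shows "integrable M (\<lambda>\<omega>. (fluctuation \<omega>)\<^sup>2)"
    "expectation (\<lambda>\<omega>. (fluctuation \<omega>)\<^sup>2) \<le> (s2 - 1) * (2 * m4 + 6) * (L * (\<Sum>k\<in>S. row k))"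
proof -
  \<comment> \<open>One bound for both kinds of terms: the second summand vanishes on the diagonal
    since \<open>a k k = 0\<close>, and its sum over \<open>q\<close> reproduces
    \<open>row k\<close>.\<close>
  define u where "u k q = (if k = q then (s2 - 1) * (2 + m4) * (L * row k) else 0) + (a k q)\<^sup>2 * (L * (\<alpha>\<^sup>2 + 4 * \<beta>\<^sup>2))" for k q
  have ex: "\<exists>v. has_bochner_integral M (\<lambda>\<omega>. (\<psi> (X k \<omega>) * (V k \<omega>)\<^sup>2) * (\<psi> (X q \<omega>) * (V q \<omega>)\<^sup>2)) v \<and> v \<le> u k q"
    if kq: "k \<in> S" "q \<in> S" for k q
  proof (cases "k = q")
    case True
    obtain v where v: "has_bochner_integral M (\<lambda>\<omega>. (\<psi> (X k \<omega>) * (V k \<omega>)\<^sup>2) * (\<psi> (X k \<omega>) * (V k \<omega>)\<^sup>2)) v"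
      "v \<le> (s2 - 1) * (2 + m4) * (row k)\<^sup>2" using diagonal_term[OF kq(1)] by blast
    have "(s2 - 1) * (2 + m4) * (row k)\<^sup>2 \<le> (s2 - 1) * (2 + m4) * (L * row k)"
      using s2_ge_1 m4_ge_1 L[OF kq(1)] row_nonneg[of k]
      by (intro mult_left_mono) (auto simp: power2_eq_square intro: mult_right_mono)
    with v True diag[OF kq(1)] show ?thesis by (auto simp: u_def)
  next
    case False
    obtain v where v: "has_bochner_integral M (\<lambda>\<omega>. (\<psi> (X k \<omega>) * (V k \<omega>)\<^sup>2) * (\<psi> (X q \<omega>) * (V q \<omega>)\<^sup>2)) v"
      "v \<le> (a k q)^4 * \<alpha>\<^sup>2 + 2 * (a k q)\<^sup>2 * \<beta>\<^sup>2 * (row k + row q)" using cross_term[OF kq False] by blast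
    have "(a k q)^4 * \<alpha>\<^sup>2 = (a k q)\<^sup>2 * (a k q)\<^sup>2 * \<alpha>\<^sup>2" by (simp add: power2_eq_square power4_eq_xxxx)
    also have "\<dots> \<le> (a k q)\<^sup>2 * L * \<alpha>\<^sup>2"
      using entry_le_row[OF kq(2), of k] L[OF kq(1)] by (intro mult_right_mono mult_left_mono) auto
    finally have "v \<le> (a k q)\<^sup>2 * L * \<alpha>\<^sup>2 + 2 * (a k q)\<^sup>2 * \<beta>\<^sup>2 * (row k + row q)" using v(2) by simp
    also have "\<dots> \<le> (a k q)\<^sup>2 * L * \<alpha>\<^sup>2 + 2 * (a k q)\<^sup>2 * \<beta>\<^sup>2 * (2 * L)"
      using L[OF kq(1)] L[OF kq(2)] by (intro add_left_mono mult_left_mono) auto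
    also have "\<dots> = u k q" using False by (simp add: u_def algebra_simps)
    finally show ?thesis using v(1) by auto
  qed
  define v where "v k q = (SOME v. has_bochner_integral M (\<lambda>\<omega>. (\<psi> (X k \<omega>) * (V k \<omega>)\<^sup>2) * (\<psi> (X q \<omega>) * (V q \<omega>)\<^sup>2)) v \<and> v \<le> u k q)" for k q
  have v: "has_bochner_integral M (\<lambda>\<omega>. (\<psi> (X k \<omega>) * (V k \<omega>)\<^sup>2) * (\<psi> (X q \<omega>) * (V q \<omega>)\<^sup>2)) (v k q)" "v k q \<le> u k q"
    if kq: "k \<in> S" "q \<in> S" for k q
    using someI_ex[OF ex[OF kq]] unfolding v_def by auto
  have "has_bochner_integral M (\<lambda>\<omega>. \<Sum>k\<in>S. \<Sum>q\<in>S. (\<psi> (X k \<omega>) * (V k \<omega>)\<^sup>2) * (\<psi> (X q \<omega>) * (V q \<omega>)\<^sup>2)) (\<Sum>k\<in>S. \<Sum>q\<in>S. v k q)"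
    by (intro has_bochner_integral_sum v)
  then have h: "has_bochner_integral M (\<lambda>\<omega>. (fluctuation \<omega>)\<^sup>2) (\<Sum>k\<in>S. \<Sum>q\<in>S. v k q)"
    by (simp add: fluctuation_def power2_eq_square sum_product)
  then show "integrable M (\<lambda>\<omega>. (fluctuation \<omega>)\<^sup>2)" by (simp add: has_bochner_integral_iff)
  have "expectation (\<lambda>\<omega>. (fluctuation \<omega>)\<^sup>2) = (\<Sum>k\<in>S. \<Sum>q\<in>S. v k q)"
    using h by (simp add: has_bochner_integral_iff)
  also have "\<dots> \<le> (\<Sum>k\<in>S. \<Sum>q\<in>S. u k q)" by (intro sum_mono v)
  also have "\<dots> = (\<Sum>k\<in>S. (s2 - 1) * (2 + m4) * (L * row k) + row k * (L * (\<alpha>\<^sup>2 + 4 * \<beta>\<^sup>2)))"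
  proof (intro sum.cong refl)
    fix k assume "k \<in> S"
    then show "(\<Sum>q\<in>S. u k q) = (s2 - 1) * (2 + m4) * (L * row k) + row k * (L * (\<alpha>\<^sup>2 + 4 * \<beta>\<^sup>2))"
      using finite_S by (simp add: u_def sum.distrib row_def sum_distrib_right)
  qed
  also have "\<dots> = ((s2 - 1) * (2 + m4) + (\<alpha>\<^sup>2 + 4 * \<beta>\<^sup>2)) * (L * (\<Sum>k\<in>S. row k))"
    unfolding sum_distrib_left by (intro sum.cong) (auto simp: algebra_simps)
  also have "\<dots> \<le> ((s2 - 1) * (2 * m4 + 6)) * (L * (\<Sum>k\<in>S. row k))"
  proof (rule mult_right_mono)
    \<comment> \<open>The bounds for \<open>\<alpha>\<close> and \<open>\<beta>\<close> contribute
      m4 + 4, and (2 + m4) + (m4 + 4) is the factor 2 * m4 + 6.\<close>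
    show "(s2 - 1) * (2 + m4) + (\<alpha>\<^sup>2 + 4 * \<beta>\<^sup>2) \<le> (s2 - 1) * (2 * m4 + 6)"
      using \<alpha>_bound \<beta>_bound by (simp add: algebra_simps)
    show "0 \<le> L * (\<Sum>k\<in>S. row k)"
    proof (cases "S = {}")
      case False
      then obtain k where "k \<in> S" by blast
      then have "0 \<le> L" using L[of k] row_nonneg[of k] by simp
      then show ?thesis by (simp add: row_nonneg sum_nonneg)
    qed simp
  qed
  finally show "expectation (\<lambda>\<omega>. (fluctuation \<omega>)\<^sup>2) \<le> (s2 - 1) * (2 * m4 + 6) * (L * (\<Sum>k\<in>S. row k))" .
qed

end

section \<open>The centred second moment of the kernel form\<close>

context iid_kernel
begin

definition gram :: "'i \<Rightarrow> 'i \<Rightarrow> real" where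
  "gram l m = (\<Sum>k\<in>S. a k l * a k m)"

definition kernel_form :: "'a \<Rightarrow> real" where
  "kernel_form \<omega> = (\<Sum>k\<in>S. \<phi> (X k \<omega>) * (V k \<omega>)\<^sup>2)"

lemma V_eq_lin: "k \<in> S \<Longrightarrow> V k \<omega> = lin (a k) S \<omega>"
  using finite_S diag by (simp add: lin_def sum.remove[of S k "\<lambda>l. a k l * X l \<omega>"])

lemma sum_V_squares: "(\<Sum>k\<in>S. (V k \<omega>)\<^sup>2) = quad gram S \<omega>"
proof -
  have "(\<Sum>k\<in>S. (V k \<omega>)\<^sup>2) = (\<Sum>k\<in>S. \<Sum>l\<in>S. \<Sum>m\<in>S. a k l * a k m * X l \<omega> * X m \<omega>)"
  proof (intro sum.cong refl)
    fix k assume k: "k \<in> S"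
    show "(V k \<omega>)\<^sup>2 = (\<Sum>l\<in>S. \<Sum>m\<in>S. a k l * a k m * X l \<omega> * X m \<omega>)"
      unfolding V_eq_lin[OF k] by (simp add: lin_def power2_eq_square sum_product mult_ac)
  qed
  also have "\<dots> = (\<Sum>l\<in>S. \<Sum>k\<in>S. \<Sum>m\<in>S. a k l * a k m * X l \<omega> * X m \<omega>)" by (rule sum.swap)
  also have "\<dots> = (\<Sum>l\<in>S. \<Sum>m\<in>S. \<Sum>k\<in>S. a k l * a k m * X l \<omega> * X m \<omega>)"
    by (rule sum.cong[OF refl]) (rule sum.swap)
  also have "\<dots> = quad gram S \<omega>" by (simp add: quad_def gram_def sum_distrib_right)
  finally show ?thesis .
qed

lemma gram_diag: "l \<in> S \<Longrightarrow> gram l l = row l"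
  unfolding gram_def row_def power2_eq_square[symmetric]
  by (intro sum.cong) (auto simp: sym)

lemma fluctuation_measurable: "fluctuation \<in> borel_measurable M"
proof -
  have [measurable]: "V k \<in> borel_measurable M" for k
    using generated_measurable[OF lin_generated[of "S - {k}" "S - {k}"]] by auto
  have [measurable]: "k \<in> S \<Longrightarrow> X k \<in> borel_measurable M" for k by (rule X_measurable)
  show ?thesis unfolding fluctuation_def[abs_def] by measurable
qed

lemma quad_measurable: "quad b S \<in> borel_measurable M"
  using generated_measurable[OF quad_generated[of S S]] by auto

text \<open>The trace of \<open>gram\<close> is \<open>\<rho>\<close>, so \<open>\<rho>\<close> is
  the right centring for the sum of the squares of the \<open>V k\<close>. The two parts are
  separated by (u + v)^2 \<le> 2 * u^2 + 2 * v^2, which avoids their covariance at the price of a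
  factor 2.\<close>

lemma kernel_form_variance:
  assumes L: "\<And>k. k \<in> S \<Longrightarrow> row k \<le> L"
  defines "\<rho> \<equiv> \<Sum>k\<in>S. row k"
  shows "kernel_form \<in> borel_measurable M" "integrable M (\<lambda>\<omega>. (kernel_form \<omega> - \<rho>)\<^sup>2)"
    "expectation (\<lambda>\<omega>. (kernel_form \<omega> - \<rho>)\<^sup>2) \<le> 2 * ((s2 - 1) * (2 * m4 + 6) * (L * \<rho>))
       + 2 * (2 * (\<Sum>l\<in>S. \<Sum>m\<in>S. (gram l m)\<^sup>2) + (m4 - 3) * (\<Sum>l\<in>S. (row l)\<^sup>2))"
proof -
  define G where "G \<omega> = quad gram S \<omega> - \<rho>" for \<omega>
  have split: "kernel_form \<omega> - \<rho> = fluctuation \<omega> + G \<omega>" for \<omega>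
    by (simp add: kernel_form_def fluctuation_def G_def \<psi>_def left_diff_distrib sum_subtractf sum_V_squares)
  have tr: "(\<Sum>l\<in>S. gram l l) = \<rho>" by (simp add: gram_diag \<rho>_def)
  have "has_bochner_integral M (\<lambda>\<omega>. (quad gram S \<omega> - (\<Sum>l\<in>S. gram l l))\<^sup>2)
    (2 * (\<Sum>l\<in>S. \<Sum>m\<in>S. (gram l m)\<^sup>2) + (m4 - 3) * (\<Sum>l\<in>S. (gram l l)\<^sup>2))"
    by (rule quad_variance) (auto simp: gram_def mult.commute)
  then have G: "integrable M (\<lambda>\<omega>. (G \<omega>)\<^sup>2)"
    "expectation (\<lambda>\<omega>. (G \<omega>)\<^sup>2) = 2 * (\<Sum>l\<in>S. \<Sum>m\<in>S. (gram l m)\<^sup>2) + (m4 - 3) * (\<Sum>l\<in>S. (row l)\<^sup>2)"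
    unfolding tr G_def has_bochner_integral_iff by (simp_all add: gram_diag)
  have mG: "G \<in> borel_measurable M" unfolding G_def[abs_def] using quad_measurable by simp
  have eq: "kernel_form = (\<lambda>\<omega>. fluctuation \<omega> + G \<omega> + \<rho>)" using split by (auto simp: fun_eq_iff algebra_simps)
  show mk: "kernel_form \<in> borel_measurable M"
    unfolding eq using fluctuation_measurable mG by simp
  have i2: "integrable M (\<lambda>\<omega>. 2 * (fluctuation \<omega>)\<^sup>2 + 2 * (G \<omega>)\<^sup>2)"
    using fluctuation_bound(1)[OF L] G(1) by simp
  have le: "(kernel_form \<omega> - \<rho>)\<^sup>2 \<le> 2 * (fluctuation \<omega>)\<^sup>2 + 2 * (G \<omega>)\<^sup>2" for \<omega>
    using sum_squares_bound[of "fluctuation \<omega>" "G \<omega>"] by (simp add: split power2_sum)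
  show i: "integrable M (\<lambda>\<omega>. (kernel_form \<omega> - \<rho>)\<^sup>2)"
    by (rule Bochner_Integration.integrable_bound[OF i2]) (use mk le in \<open>auto simp: abs_of_nonneg\<close>)
  have "expectation (\<lambda>\<omega>. (kernel_form \<omega> - \<rho>)\<^sup>2) \<le> expectation (\<lambda>\<omega>. 2 * (fluctuation \<omega>)\<^sup>2 + 2 * (G \<omega>)\<^sup>2)"
    using i i2 le by (rule integral_mono)
  also have "\<dots> = 2 * expectation (\<lambda>\<omega>. (fluctuation \<omega>)\<^sup>2) + 2 * expectation (\<lambda>\<omega>. (G \<omega>)\<^sup>2)"
    using fluctuation_bound(1)[OF L] G(1) by simp
  also have "\<dots> \<le> 2 * ((s2 - 1) * (2 * m4 + 6) * (L * \<rho>))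
       + 2 * (2 * (\<Sum>l\<in>S. \<Sum>m\<in>S. (gram l m)\<^sup>2) + (m4 - 3) * (\<Sum>l\<in>S. (row l)\<^sup>2))"
    using fluctuation_bound(2)[OF L] unfolding G(2) \<rho>_def by simp
  finally show "expectation (\<lambda>\<omega>. (kernel_form \<omega> - \<rho>)\<^sup>2) \<le> 2 * ((s2 - 1) * (2 * m4 + 6) * (L * \<rho>))
       + 2 * (2 * (\<Sum>l\<in>S. \<Sum>m\<in>S. (gram l m)\<^sup>2) + (m4 - 3) * (\<Sum>l\<in>S. (row l)\<^sup>2))" .
qed

text \<open>The variance formula with vanishing diagonal. Under the normalization E[Q^2] = 1 it
  fixes the sum of the row sums at 1/2.\<close>

lemma quad_square:
  "integrable M (\<lambda>\<omega>. (quad a S \<omega>)\<^sup>2)" "expectation (\<lambda>\<omega>. (quad a S \<omega>)\<^sup>2) = 2 * (\<Sum>k\<in>S. row k)"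
proof -
  have "has_bochner_integral M (\<lambda>\<omega>. (quad a S \<omega> - (\<Sum>l\<in>S. a l l))\<^sup>2)
    (2 * (\<Sum>l\<in>S. \<Sum>m\<in>S. (a l m)\<^sup>2) + (m4 - 3) * (\<Sum>l\<in>S. (a l l)\<^sup>2))"
    by (rule quad_variance) (auto simp: sym)
  then show "integrable M (\<lambda>\<omega>. (quad a S \<omega>)\<^sup>2)" "expectation (\<lambda>\<omega>. (quad a S \<omega>)\<^sup>2) = 2 * (\<Sum>k\<in>S. row k)"
    by (simp_all add: has_bochner_integral_iff diag row_def)
qed

lemma quad_eq_sum: "quad a S \<omega> = (\<Sum>k\<in>S. X k \<omega> * V k \<omega>)"
  unfolding quad_def
proof (intro sum.cong refl)
  fix k assume k: "k \<in> S"
  show "(\<Sum>m\<in>S. a k m * X k \<omega> * X m \<omega>) = X k \<omega> * V k \<omega>"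
    unfolding V_eq_lin[OF k] by (simp add: lin_def sum_distrib_left mult_ac)
qed

lemma quad_split: "k \<in> S \<Longrightarrow> quad a S \<omega> = 2 * X k \<omega> * V k \<omega> + quad a (S - {k}) \<omega>"
  using quad_insert[of "S - {k}" k a \<omega>] finite_S diag by (simp add: insert_absorb sym)

end

section \<open>Stein's identity for the quadratic form\<close>

locale iid_stein = iid_kernel +
  assumes stein: "\<And>g g' C. (\<And>x. (g has_real_derivative g' x) (at x)) \<Longrightarrow> continuous_on UNIV g' \<Longrightarrow>
    (\<And>x. \<bar>g' x\<bar> \<le> C) \<Longrightarrow> (\<integral>x. x * g x \<partial>\<mu>) = (\<integral>x. \<phi> x * g' x \<partial>\<mu>)"
begin

abbreviation "Q \<equiv> quad a S"

text \<open>With all coordinates but \<open>X k\<close> frozen, \<open>Q\<close> is the affine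
  function 2 * x * v + u of \<open>x\<close>. The kernel identity is applied to v * f (2 * x * v +
  u), whose derivative contributes the second factor \<open>v\<close> and the 2.\<close>

lemma stein_term:
  assumes f: "\<And>x. (f has_real_derivative f' x) (at x)" and c: "continuous_on UNIV f'"
    and b: "\<And>x. \<bar>f' x\<bar> \<le> C" and k: "k \<in> S"
  shows "integrable M (\<lambda>\<omega>. X k \<omega> * V k \<omega> * f (Q \<omega>))"
    "integrable M (\<lambda>\<omega>. \<phi> (X k \<omega>) * (V k \<omega>)\<^sup>2 * f' (Q \<omega>))"
    "expectation (\<lambda>\<omega>. X k \<omega> * V k \<omega> * f (Q \<omega>)) = expectation (\<lambda>\<omega>. 2 * (\<phi> (X k \<omega>) * (V k \<omega>)\<^sup>2 * f' (Q \<omega>)))"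
proof -
  have C: "0 \<le> C" using b[of 0] by simp
  have mf' [measurable]: "f' \<in> borel_measurable borel" by (rule borel_measurable_continuous_onI[OF c])
  have mf [measurable]: "f \<in> borel_measurable borel"
    by (intro borel_measurable_continuous_onI DERIV_continuous_on[of UNIV f f'] DERIV_subset[OF f]) auto
  have mQ [measurable]: "Q \<in> borel_measurable M" by (rule quad_measurable)
  have mX [measurable]: "X k \<in> borel_measurable M" using k by (rule X_measurable)
  have gV: "V k \<in> borel_measurable (generated (S - {k}))" by (intro lin_generated) auto
  have gU: "quad a (S - {k}) \<in> borel_measurable (generated (S - {k}))" by (intro quad_generated) auto
  have mV [measurable]: "V k \<in> borel_measurable M" using generated_measurable[OF gV] by auto
  \<comment> \<open>Linear growth makes \<open>f (Q \<omega>)\<close> square integrable along with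
    \<open>Q\<close>, so its product with \<open>X k * V k\<close> is integrable.\<close>
  have growth: "\<bar>f x\<bar> \<le> \<bar>f 0\<bar> + C * \<bar>x\<bar>" for x
  proof -
    have "\<bar>f x - f 0\<bar> \<le> C * \<bar>x - 0\<bar>"
      by (rule field_differentiable_bound[of UNIV f f', simplified real_norm_def])
        (use f b in \<open>auto intro: DERIV_subset\<close>)
    then show ?thesis by simp
  qed
  have "integrable M (\<lambda>\<omega>. (f (Q \<omega>))\<^sup>2)"
  proof (rule Bochner_Integration.integrable_bound)
    show "integrable M (\<lambda>\<omega>. 2 * (f 0)\<^sup>2 + 2 * C\<^sup>2 * (Q \<omega>)\<^sup>2)" using quad_square by simp
    have "(f x)\<^sup>2 \<le> 2 * (f 0)\<^sup>2 + 2 * C\<^sup>2 * x\<^sup>2" for x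
    proof -
      have "(f x)\<^sup>2 \<le> (\<bar>f 0\<bar> + C * \<bar>x\<bar>)\<^sup>2" using growth[of x] by (metis abs_ge_zero power2_abs power_mono)
      also have "\<dots> \<le> 2 * \<bar>f 0\<bar>\<^sup>2 + 2 * (C * \<bar>x\<bar>)\<^sup>2"
        using sum_squares_bound[of "\<bar>f 0\<bar>" "C * \<bar>x\<bar>"] by (simp add: power2_sum)
      finally show ?thesis by (simp add: power_mult_distrib)
    qed
    then show "AE \<omega> in M. norm ((f (Q \<omega>))\<^sup>2) \<le> norm (2 * (f 0)\<^sup>2 + 2 * C\<^sup>2 * (Q \<omega>)\<^sup>2)"
      by (auto simp: abs_of_nonneg)
  qed measurable
  moreover have "integrable M (\<lambda>\<omega>. (X k \<omega> * V k \<omega>)\<^sup>2)"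
    using L4_product[OF L4_X[OF k] L4_lin[of "S - {k}" "a k"], of 2 2] by (simp add: power_mult_distrib)
  ultimately show 1: "integrable M (\<lambda>\<omega>. X k \<omega> * V k \<omega> * f (Q \<omega>))"
    by (intro integrable_mult_of_squares) simp_all
  have "has_bochner_integral M (\<lambda>\<omega>. \<phi> (X k \<omega>) * (V k \<omega>)\<^sup>2) ((\<integral>x. \<phi> x \<partial>\<mu>) * expectation (\<lambda>\<omega>. (V k \<omega>)\<^sup>2))"
    by (rule has_integral_product[OF k _ _ _ \<phi>_measurable \<phi>_integrable, of "S - {k}"])
      (use gV L4_power[OF L4_lin[of "S - {k}" "a k"]] in auto)
  then have "integrable M (\<lambda>\<omega>. C * (\<phi> (X k \<omega>) * (V k \<omega>)\<^sup>2))" by (simp add: has_bochner_integral_iff)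
  then show 2: "integrable M (\<lambda>\<omega>. \<phi> (X k \<omega>) * (V k \<omega>)\<^sup>2 * f' (Q \<omega>))"
  proof (rule Bochner_Integration.integrable_bound)
    show "AE \<omega> in M. norm (\<phi> (X k \<omega>) * (V k \<omega>)\<^sup>2 * f' (Q \<omega>)) \<le> norm (C * (\<phi> (X k \<omega>) * (V k \<omega>)\<^sup>2))"
    proof (intro AE_I2)
      fix \<omega>
      have "\<bar>f' (Q \<omega>)\<bar> * \<bar>\<phi> (X k \<omega>) * (V k \<omega>)\<^sup>2\<bar> \<le> C * \<bar>\<phi> (X k \<omega>) * (V k \<omega>)\<^sup>2\<bar>"
        by (intro mult_right_mono b) auto
      then show "norm (\<phi> (X k \<omega>) * (V k \<omega>)\<^sup>2 * f' (Q \<omega>)) \<le> norm (C * (\<phi> (X k \<omega>) * (V k \<omega>)\<^sup>2))"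
        using C by (simp add: abs_mult mult_ac)
    qed
  qed measurable
  define R where "R \<omega> = (quad a (S - {k}) \<omega>, V k \<omega>)" for \<omega>
  define A where "A = (\<lambda>(x, u, v). x * v * f (2 * x * v + u))"
  define B where "B = (\<lambda>(x, u, v). 2 * (\<phi> x * v\<^sup>2 * f' (2 * x * v + u)))"
  have AB: "A (X k \<omega>, R \<omega>) = X k \<omega> * V k \<omega> * f (Q \<omega>)"
    "B (X k \<omega>, R \<omega>) = 2 * (\<phi> (X k \<omega>) * (V k \<omega>)\<^sup>2 * f' (Q \<omega>))" for \<omega>
    by (simp_all add: A_def B_def R_def quad_split[OF k])
  have "expectation (\<lambda>\<omega>. A (X k \<omega>, R \<omega>)) = expectation (\<lambda>\<omega>. B (X k \<omega>, R \<omega>))"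
  proof (rule moment_eqI[OF k])
    show "R \<in> measurable (generated (S - {k})) (borel \<Otimes>\<^sub>M borel)"
      unfolding R_def using gU gV by (rule measurable_Pair)
    show "A \<in> borel_measurable (borel \<Otimes>\<^sub>M (borel \<Otimes>\<^sub>M borel))" unfolding A_def by measurable
    show "B \<in> borel_measurable (borel \<Otimes>\<^sub>M (borel \<Otimes>\<^sub>M borel))" unfolding B_def by measurable
    fix r :: "real \<times> real"
    obtain u v where r: "r = (u, v)" by force
    have "(\<integral>x. x * (v * f (2 * x * v + u)) \<partial>\<mu>) = (\<integral>x. \<phi> x * (2 * v\<^sup>2 * f' (2 * x * v + u)) \<partial>\<mu>)"
    proof (rule stein)
      show "((\<lambda>x. v * f (2 * x * v + u)) has_real_derivative 2 * v\<^sup>2 * f' (2 * x * v + u)) (at x)" for x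
        by (auto intro!: derivative_eq_intros DERIV_chain2[OF f] simp: power2_eq_square)
      show "continuous_on UNIV (\<lambda>x. 2 * v\<^sup>2 * f' (2 * x * v + u))"
        by (intro continuous_intros continuous_on_compose2[OF c]) auto
      show "\<bar>2 * v\<^sup>2 * f' (2 * x * v + u)\<bar> \<le> 2 * v\<^sup>2 * C" for x
        using b[of "2 * x * v + u"] by (simp add: abs_mult mult_left_mono)
    qed
    then show "(\<integral>x. A (x, r) \<partial>\<mu>) = (\<integral>x. B (x, r) \<partial>\<mu>)"
      by (simp add: A_def B_def r mult_ac)
  qed (use 1 2 in \<open>auto simp: AB\<close>)
  then show "expectation (\<lambda>\<omega>. X k \<omega> * V k \<omega> * f (Q \<omega>)) = expectation (\<lambda>\<omega>. 2 * (\<phi> (X k \<omega>) * (V k \<omega>)\<^sup>2 * f' (Q \<omega>)))"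
    by (simp only: AB)
qed

lemma stein_quad:
  assumes f: "\<And>x. (f has_real_derivative f' x) (at x)" and c: "continuous_on UNIV f'"
    and b: "\<And>x. \<bar>f' x\<bar> \<le> C"
  shows "integrable M (\<lambda>\<omega>. Q \<omega> * f (Q \<omega>))" "integrable M (\<lambda>\<omega>. 2 * kernel_form \<omega> * f' (Q \<omega>))"
    "expectation (\<lambda>\<omega>. Q \<omega> * f (Q \<omega>)) = expectation (\<lambda>\<omega>. 2 * kernel_form \<omega> * f' (Q \<omega>))"
proof -
  note t = stein_term[OF assms]
  have e: "(\<lambda>\<omega>. Q \<omega> * f (Q \<omega>)) = (\<lambda>\<omega>. \<Sum>k\<in>S. X k \<omega> * V k \<omega> * f (Q \<omega>))"
    by (subst quad_eq_sum) (simp add: sum_distrib_right)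
  have e': "(\<lambda>\<omega>. 2 * kernel_form \<omega> * f' (Q \<omega>)) = (\<lambda>\<omega>. \<Sum>k\<in>S. 2 * (\<phi> (X k \<omega>) * (V k \<omega>)\<^sup>2 * f' (Q \<omega>)))"
    by (simp add: kernel_form_def sum_distrib_right sum_distrib_left mult.assoc)
  have t2: "k \<in> S \<Longrightarrow> integrable M (\<lambda>\<omega>. 2 * (\<phi> (X k \<omega>) * (V k \<omega>)\<^sup>2 * f' (Q \<omega>)))" for k
    using t(2) by (rule integrable_mult_right)
  show "integrable M (\<lambda>\<omega>. Q \<omega> * f (Q \<omega>))" "integrable M (\<lambda>\<omega>. 2 * kernel_form \<omega> * f' (Q \<omega>))"
    unfolding e e' using t t2 by (auto intro: Bochner_Integration.integrable_sum)
  show "expectation (\<lambda>\<omega>. Q \<omega> * f (Q \<omega>)) = expectation (\<lambda>\<omega>. 2 * kernel_form \<omega> * f' (Q \<omega>))"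
  proof -
    have "expectation (\<lambda>\<omega>. Q \<omega> * f (Q \<omega>)) = (\<Sum>k\<in>S. expectation (\<lambda>\<omega>. X k \<omega> * V k \<omega> * f (Q \<omega>)))"
      unfolding e by (rule Bochner_Integration.integral_sum) (rule t(1))
    also have "\<dots> = (\<Sum>k\<in>S. expectation (\<lambda>\<omega>. 2 * (\<phi> (X k \<omega>) * (V k \<omega>)\<^sup>2 * f' (Q \<omega>))))"
      by (rule sum.cong[OF refl]) (rule t(3))
    also have "\<dots> = expectation (\<lambda>\<omega>. 2 * kernel_form \<omega> * f' (Q \<omega>))"
      unfolding e' by (rule Bochner_Integration.integral_sum[symmetric]) (rule t2)
    finally show ?thesis .
  qed
qed

lemma stein_bound:
  assumes f: "\<And>x. (f has_real_derivative f' x) (at x)" and c: "continuous_on UNIV f'"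
    and b: "\<And>x. \<bar>f' x\<bar> \<le> C" and eq: "\<And>x. f' x = x * f x + h x - m"
    and L: "\<And>k. k \<in> S \<Longrightarrow> row k \<le> L" and half: "(\<Sum>k\<in>S. row k) = 1/2"
  shows "\<bar>expectation (\<lambda>\<omega>. h (Q \<omega>)) - m\<bar> \<le> 2 * C * sqrt (expectation (\<lambda>\<omega>. (kernel_form \<omega> - 1/2)\<^sup>2))"
proof -
  note k = kernel_form_variance(1,2)[OF L, unfolded half]
  note s = stein_quad[OF f c b]
  have C: "0 \<le> C" using b[of 0] by simp
  have [measurable]: "Q \<in> borel_measurable M" "kernel_form \<in> borel_measurable M" using quad_measurable k(1) by auto
  have [measurable]: "f' \<in> borel_measurable borel" by (rule borel_measurable_continuous_onI[OF c])
  have i': "integrable M (\<lambda>\<omega>. f' (Q \<omega>))"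
    by (rule integrable_const_bound[where B=C]) (use b in auto)
  have mk: "(\<lambda>\<omega>. kernel_form \<omega> - 1/2) \<in> borel_measurable M" by measurable
  have ik: "integrable M (\<lambda>\<omega>. kernel_form \<omega> - 1/2)"
    by (rule square_integrable_imp_integrable[OF mk k(2)])
  have "(\<lambda>\<omega>. h (Q \<omega>)) = (\<lambda>\<omega>. f' (Q \<omega>) - Q \<omega> * f (Q \<omega>) + m)" by (auto simp: eq)
  then have "expectation (\<lambda>\<omega>. h (Q \<omega>)) - m = expectation (\<lambda>\<omega>. f' (Q \<omega>)) - expectation (\<lambda>\<omega>. 2 * kernel_form \<omega> * f' (Q \<omega>))"
    using i' s prob_space by simp
  also have "\<dots> = expectation (\<lambda>\<omega>. f' (Q \<omega>) - 2 * kernel_form \<omega> * f' (Q \<omega>))"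
    using i' s by simp
  also have "(\<lambda>\<omega>. f' (Q \<omega>) - 2 * kernel_form \<omega> * f' (Q \<omega>)) = (\<lambda>\<omega>. - 2 * ((kernel_form \<omega> - 1/2) * f' (Q \<omega>)))"
    by (auto simp: algebra_simps)
  finally have "\<bar>expectation (\<lambda>\<omega>. h (Q \<omega>)) - m\<bar> = 2 * \<bar>expectation (\<lambda>\<omega>. (kernel_form \<omega> - 1/2) * f' (Q \<omega>))\<bar>"
    by (simp add: abs_mult)
  also have "\<bar>expectation (\<lambda>\<omega>. (kernel_form \<omega> - 1/2) * f' (Q \<omega>))\<bar> \<le> expectation (\<lambda>\<omega>. \<bar>(kernel_form \<omega> - 1/2) * f' (Q \<omega>)\<bar>)"
    by (rule integral_abs_bound)
  also have "\<dots> \<le> expectation (\<lambda>\<omega>. C * \<bar>kernel_form \<omega> - 1/2\<bar>)"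
  proof (rule integral_mono')
    show "integrable M (\<lambda>\<omega>. C * \<bar>kernel_form \<omega> - 1/2\<bar>)" using ik by simp
    show "\<bar>(kernel_form \<omega> - 1/2) * f' (Q \<omega>)\<bar> \<le> C * \<bar>kernel_form \<omega> - 1/2\<bar>" for \<omega>
      using mult_left_mono[OF b, of "\<bar>kernel_form \<omega> - 1/2\<bar>"] by (simp add: abs_mult mult.commute)
  qed (use C in auto)
  also have "\<dots> = C * expectation (\<lambda>\<omega>. \<bar>kernel_form \<omega> - 1/2\<bar>)" by simp
  also have "\<dots> \<le> C * sqrt (expectation (\<lambda>\<omega>. (kernel_form \<omega> - 1/2)\<^sup>2))"
  proof (rule mult_left_mono[OF real_le_rsqrt C])
    have "(expectation (\<lambda>\<omega>. \<bar>kernel_form \<omega> - 1/2\<bar> * 1))\<^sup>2 \<le>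
       expectation (\<lambda>\<omega>. \<bar>kernel_form \<omega> - 1/2\<bar>\<^sup>2) * expectation (\<lambda>\<omega>. 1\<^sup>2)"
      by (rule integral_Cauchy_Schwarz) (use k prob_space in auto)
    then show "(expectation (\<lambda>\<omega>. \<bar>kernel_form \<omega> - 1/2\<bar>))\<^sup>2 \<le> expectation (\<lambda>\<omega>. (kernel_form \<omega> - 1/2)\<^sup>2)"
      using prob_space by simp
  qed
  finally show ?thesis by simp
qed

end

section \<open>Distances to the normal law\<close>

lemma prob_outer_approx:
  fixes P :: "real measure"
  assumes "prob_space P" "sets P = sets borel" "A \<in> sets borel" "0 < e"
  obtains U where "open U" "A \<subseteq> U" "measure P U \<le> measure P A + e"
proof -
  interpret prob_space P by fact
  have "(INF U \<in> {U. A \<subseteq> U \<and> open U}. emeasure P U) < ennreal (measure P A + e)"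
  proof -
    have "emeasure P A < ennreal (measure P A + e)"
      using \<open>0 < e\<close> by (simp add: emeasure_eq_measure ennreal_less_iff)
    then show ?thesis using outer_regular[OF assms(2) _ assms(3)] by simp
  qed
  then obtain U where "A \<subseteq> U" "open U" "emeasure P U < ennreal (measure P A + e)"
    by (auto simp: INF_less_iff)
  moreover from this have "measure P U < measure P A + e"
    unfolding emeasure_eq_measure by (subst (asm) ennreal_less_iff) auto
  ultimately show thesis using that[of U] by simp
qed

text \<open>The indicator of \<open>A\<close> is approximated in the mean under both laws by one
  continuous function with values in [0, 1], so the bound \<open>c\<close> passes to Borel sets
  unchanged.\<close>

lemma measure_diff_le_of_continuous:
  fixes P1 P2 :: "real measure"
  assumes P: "prob_space P1" "prob_space P2" "sets P1 = sets borel" "sets P2 = sets borel"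
    and A: "A \<in> sets borel"
    and bound: "\<And>h. continuous_on UNIV h \<Longrightarrow> (\<And>x. 0 \<le> h x) \<Longrightarrow> (\<And>x. h x \<le> 1)
      \<Longrightarrow> \<bar>(\<integral>x. h x \<partial>P1) - (\<integral>x. h x \<partial>P2)\<bar> \<le> c"
  shows "\<bar>measure P1 A - measure P2 A\<bar> \<le> (c :: real)"
proof (rule field_le_epsilon)
  fix e :: real assume e: "0 < e"
  have e2: "e / 2 > 0" using e by simp
  have cA: "- A \<in> sets borel" using A by (rule borel_comp)
  obtain U1 where U1: "open U1" "A \<subseteq> U1" "measure P1 U1 \<le> measure P1 A + e/2"
    using prob_outer_approx[OF P(1,3) A e2] .
  obtain U2 where U2: "open U2" "A \<subseteq> U2" "measure P2 U2 \<le> measure P2 A + e/2"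
    using prob_outer_approx[OF P(2,4) A e2] .
  obtain W1 where W1: "open W1" "- A \<subseteq> W1" "measure P1 W1 \<le> measure P1 (- A) + e/2"
    using prob_outer_approx[OF P(1,3) cA e2] .
  obtain W2 where W2: "open W2" "- A \<subseteq> W2" "measure P2 W2 \<le> measure P2 (- A) + e/2"
    using prob_outer_approx[OF P(2,4) cA e2] .
  \<comment> \<open>The complement of \<open>W1 \<inter> W2\<close> lies in \<open>A\<close> and
    that of \<open>U1 \<inter> U2\<close> in \<open>- A\<close>; hence they are disjoint and a
    Urysohn function separates them. Intersecting makes one function serve both laws.\<close>
  have cl: "closed (- (W1 \<inter> W2))" "closed (- (U1 \<inter> U2))" "- (W1 \<inter> W2) \<inter> - (U1 \<inter> U2) = {}"
    using U1 U2 W1 W2 by auto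
  obtain h where h: "continuous_on UNIV h" "\<And>x. h x \<in> closed_segment 1 (0::real)"
    "\<And>x. x \<in> - (W1 \<inter> W2) \<Longrightarrow> h x = 1" "\<And>x. x \<in> - (U1 \<inter> U2) \<Longrightarrow> h x = 0"
    using Urysohn[OF cl, of 1 0] by metis
  have h01: "0 \<le> h x" "h x \<le> 1" for x using h(2)[of x] by (auto simp: closed_segment_eq_real_ivl)
  have hm: "h \<in> borel_measurable borel" by (rule borel_measurable_continuous_onI[OF h(1)])
  have approx: "\<bar>(\<integral>x. h x \<partial>P) - measure P A\<bar> \<le> e/2"
    if P: "prob_space P" "sets P = sets borel" and U: "open U" "measure P U \<le> measure P A + e/2" "U1 \<inter> U2 \<subseteq> U"
      and W: "open W" "measure P W \<le> measure P (- A) + e/2" "W1 \<inter> W2 \<subseteq> W" for P U W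
  proof -
    interpret prob_space P by fact
    have sp: "space P = UNIV" using sets_eq_imp_space_eq[OF P(2)] by simp
    have "h \<in> borel_measurable P" unfolding measurable_cong_sets[OF P(2) refl] by (rule hm)
    then have hP: "integrable P h" by (intro integrable_const_bound[where B=1]) (use h01 in auto)
    have ind: "integrable P (indicator E :: real \<Rightarrow> real)" "(\<integral>x. indicator E x \<partial>P) = measure P E" if "E \<in> sets borel" for E
      using that P(2) by (auto simp: sp integrable_indicator_iff emeasure_eq_measure)
    have Ub: "U \<in> sets borel" "- W \<in> sets borel" using U(1) W(1) by (auto intro: borel_open borel_closed)
    have "(\<integral>x. h x \<partial>P) \<le> (\<integral>x. indicator U x \<partial>P)"
    proof (rule integral_mono[OF hP ind(1)[OF Ub(1)]])
      show "h x \<le> indicator U x" for x using h01[of x] h(4)[of x] U(3) by (auto simp: indicator_def)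
    qed
    then have 1: "(\<integral>x. h x \<partial>P) \<le> measure P A + e/2" using ind(2)[OF Ub(1)] U(2) by simp
    have "(\<integral>x. indicator (- W) x \<partial>P) \<le> (\<integral>x. h x \<partial>P)"
    proof (rule integral_mono[OF ind(1)[OF Ub(2)] hP])
      show "indicator (- W) x \<le> h x" for x using h01[of x] h(3)[of x] W(3) by (auto simp: indicator_def)
    qed
    moreover have "measure P (- E) = 1 - measure P E" if "E \<in> sets borel" for E
      using that prob_compl[of E] P(2) by (simp add: sp Compl_eq_Diff_UNIV)
    ultimately have "measure P A - e/2 \<le> (\<integral>x. h x \<partial>P)"
      using ind(2)[OF Ub(2)] W(1,2) A by simp
    with 1 show ?thesis by linarith
  qed
  have "\<bar>(\<integral>x. h x \<partial>P1) - measure P1 A\<bar> \<le> e/2" by (rule approx[OF P(1,3) U1(1,3) _ W1(1,3)]) auto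
  moreover have "\<bar>(\<integral>x. h x \<partial>P2) - measure P2 A\<bar> \<le> e/2" by (rule approx[OF P(2,4) U2(1,3) _ W2(1,3)]) auto
  moreover have "\<bar>(\<integral>x. h x \<partial>P1) - (\<integral>x. h x \<partial>P2)\<bar> \<le> c" using h(1) h01 by (rule bound)
  ultimately show "\<bar>measure P1 A - measure P2 A\<bar> \<le> c + e" by linarith
qed

lemma std_normal_expectation:
  assumes "distributed N lborel Z std_normal_density" "h \<in> borel_measurable borel"
  shows "(\<integral>\<omega>. h (Z \<omega>) \<partial>N) = gauss_mean h"
  using distributed_integral[OF assms(1), of h] assms(2) by (simp add: gauss_mean_def mult.commute)

text \<open>Here \<open>s\<close> and \<open>m\<close> are the moments of kernel and law,
  \<open>l\<close> the maximal row sum, \<open>t\<close> the sum of squared Gram entries,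
  \<open>d\<close> the sum of squared row sums and \<open>p\<close> the subtracted term. In the
  difference of the two sides the only negative contribution besides the compensated
  \<open>p\<close> is 2 * m * d, absorbed by 2 * m * l as \<open>d \<le> l / 2\<close>.\<close>

lemma variance_numeric_aux:
  fixes s m l t d p :: real
  assumes "1 \<le> s" "1 \<le> m" "0 \<le> l" "0 \<le> d" "d \<le> l / 2" "d \<le> t" "p \<le> d"
  shows "2 * ((s - 1) * (2 * m + 6) * (l * (1/2))) + 2 * (2 * t + (m - 3) * d)
    \<le> 4 * (s * (2 + m) * l + 2 * t - p)"
proof -
  have "m * d \<le> m * (l / 2)" using assms by (intro mult_left_mono) auto
  moreover have "0 \<le> s * m * l" "0 \<le> s * l" "0 \<le> m * l" using assms by auto
  moreover have "4 * (s * (2 + m) * l + 2 * t - p)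
      - (2 * ((s - 1) * (2 * m + 6) * (l * (1/2))) + 2 * (2 * t + (m - 3) * d))
    = 2 * (s * m * l) + 2 * (s * l) + 2 * (m * l) + 6 * l + 4 * (t - p) - 2 * (m * d) + 6 * d"
    by (simp add: algebra_simps)
  moreover have "0 \<le> 2 * (s * m * l) + 2 * (s * l) + 2 * (m * l) + 6 * l + 4 * (t - p) - 2 * (m * d) + 6 * d"
  proof -
    have "0 \<le> 2 * x + 2 * y + 2 * z + 6 * l + 4 * (t - p) - 2 * w + 6 * d"
      if "0 \<le> x" "0 \<le> y" "0 \<le> z" "w \<le> z / 2" for x y z w
      using that assms by argo
    then show ?thesis using calculation(1-4) by simp
  qed
  ultimately show ?thesis by (metis diff_ge_0_iff_ge)
qed

context iid_stein
begin

text \<open>The variable \<open>v\<close> stands for the radicand. The two distances differ only in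
  the derivative bound \<open>C\<close> put into \<open>main\<close>, 1 for Lipschitz functions and
  2 for functions with values in [0, 1].\<close>

lemma distance_bounds:
  fixes N :: "'z measure" and Z :: "'z \<Rightarrow> real"
  assumes N: "prob_space N" "distributed N lborel Z std_normal_density"
    and L: "\<And>k. k \<in> S \<Longrightarrow> row k \<le> L" and half: "(\<Sum>k\<in>S. row k) = 1/2"
    and v: "expectation (\<lambda>\<omega>. (kernel_form \<omega> - 1/2)\<^sup>2) \<le> 4 * v"
  shows "dist_W M Q N Z \<le> ereal (4 * sqrt v)" "dist_TV M Q N Z \<le> ereal (8 * sqrt v)"
proof -
  have "sqrt (expectation (\<lambda>\<omega>. (kernel_form \<omega> - 1/2)\<^sup>2)) \<le> sqrt (4 * v)" using v by simp
  also have "\<dots> = 2 * sqrt v" by (simp add: real_sqrt_mult)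
  finally have sv: "sqrt (expectation (\<lambda>\<omega>. (kernel_form \<omega> - 1/2)\<^sup>2)) \<le> 2 * sqrt v" .
  have main: "\<bar>expectation (\<lambda>\<omega>. h (Q \<omega>)) - (\<integral>\<omega>. h (Z \<omega>) \<partial>N)\<bar> \<le> 4 * C * sqrt v"
    if h: "continuous_on UNIV h" "integrable lborel (\<lambda>t. h t * std_normal_density t)"
      "\<And>x. \<bar>x * stein_sol h x + h x - gauss_mean h\<bar> \<le> C" for h C
  proof -
    have C: "0 \<le> C" using h(3)[of 0] by simp
    have "\<bar>expectation (\<lambda>\<omega>. h (Q \<omega>)) - gauss_mean h\<bar> \<le> 2 * C * sqrt (expectation (\<lambda>\<omega>. (kernel_form \<omega> - 1/2)\<^sup>2))"
      by (rule stein_bound[OF stein_sol_has_derivative[OF h(1,2)] stein_sol_deriv_continuous[OF h(1,2)] h(3) refl L half])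
    also have "\<dots> \<le> 2 * C * (2 * sqrt v)" using sv C by (intro mult_left_mono) auto
    finally show ?thesis
      using std_normal_expectation[OF N(2) borel_measurable_continuous_onI[OF h(1)]] by simp
  qed
  show "dist_W M Q N Z \<le> ereal (4 * sqrt v)"
    unfolding dist_W_def
  proof (rule SUP_least)
    fix h :: "real \<Rightarrow> real" assume "h \<in> {h. 1-lipschitz_on UNIV h}"
    then have h: "1-lipschitz_on UNIV h" by simp
    then have "continuous_on UNIV h" by (rule lipschitz_on_continuous_on)
    from main[OF this lipschitz_integrable_std_normal[OF h] stein_sol_lipschitz[OF h]]
    show "ereal \<bar>expectation (\<lambda>\<omega>. h (Q \<omega>)) - (\<integral>\<omega>. h (Z \<omega>) \<partial>N)\<bar> \<le> ereal (4 * sqrt v)" by simp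
  qed
  show "dist_TV M Q N Z \<le> ereal (8 * sqrt v)"
    unfolding dist_TV_def
  proof (rule SUP_least)
    fix A :: "real set" assume A: "A \<in> sets borel"
    have mQ: "Q \<in> borel_measurable M" by (rule quad_measurable)
    have mZ: "Z \<in> borel_measurable N" using distributed_measurable[OF N(2)] by simp
    have "\<bar>measure (distr M borel Q) A - measure (distr N borel Z) A\<bar> \<le> 8 * sqrt v"
    proof (rule measure_diff_le_of_continuous)
      show "prob_space (distr M borel Q)" "prob_space (distr N borel Z)"
        using prob_space_distr[OF mQ] prob_space.prob_space_distr[OF N(1) mZ] by auto
      fix h :: "real \<Rightarrow> real" assume h: "continuous_on UNIV h" "\<And>x. 0 \<le> h x" "\<And>x. h x \<le> 1"
      note hm = borel_measurable_continuous_onI[OF h(1)]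
      show "\<bar>(\<integral>x. h x \<partial>distr M borel Q) - (\<integral>x. h x \<partial>distr N borel Z)\<bar> \<le> 8 * sqrt v"
        using main[OF h(1) stein_sol_bounded[OF h]] hm mQ mZ by (simp add: integral_distr)
    qed (use A in auto)
    moreover have "measure (distr M borel Q) A = measure M {\<omega> \<in> space M. Q \<omega> \<in> A}"
      "measure (distr N borel Z) A = measure N {\<omega> \<in> space N. Z \<omega> \<in> A}"
      using A mQ mZ by (auto simp: measure_distr intro!: arg_cong2[where f=measure])
    ultimately show "ereal \<bar>measure M {\<omega> \<in> space M. Q \<omega> \<in> A} - measure N {\<omega> \<in> space N. Z \<omega> \<in> A}\<bar> \<le> ereal (8 * sqrt v)"
      by simp
  qed
qed

text \<open>The squared row sums are the squared diagonal entries of \<open>gram\<close>, hence part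
  of the sum over all its entries; this is what leaves room for the subtracted term
  \<open>p\<close>. Bounding one factor by \<open>L\<close> and summing the other to 1/2 gives the
  comparison with \<open>L / 2\<close>.\<close>

lemma variance_numeric:
  assumes L: "\<And>k. k \<in> S \<Longrightarrow> row k \<le> L" and half: "(\<Sum>k\<in>S. row k) = 1/2"
    and p: "p \<le> (\<Sum>k\<in>S. (row k)\<^sup>2)"
  shows "expectation (\<lambda>\<omega>. (kernel_form \<omega> - 1/2)\<^sup>2) \<le>
    4 * (s2 * (2 + m4) * L + 2 * (\<Sum>q\<in>S. \<Sum>l\<in>S. (gram q l)\<^sup>2) - p)"
proof -
  let ?N = "\<Sum>q\<in>S. \<Sum>l\<in>S. (gram q l)\<^sup>2" and ?D = "\<Sum>k\<in>S. (row k)\<^sup>2"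
  have "?D \<le> (\<Sum>k\<in>S. L * row k)"
    using L row_nonneg by (intro sum_mono) (auto simp: power2_eq_square intro: mult_right_mono)
  also have "\<dots> = L / 2" by (simp add: half flip: sum_distrib_left)
  finally have D: "?D \<le> L / 2" .
  have "?D = (\<Sum>q\<in>S. \<Sum>l\<in>{q}. (gram q l)\<^sup>2)" by (simp add: gram_diag)
  also have "\<dots> \<le> ?N" using finite_S by (intro sum_mono sum_mono2) auto
  finally have DN: "?D \<le> ?N" .
  have "0 \<le> ?D" by (intro sum_nonneg) auto
  then have L0: "0 \<le> L" using D by simp
  have "expectation (\<lambda>\<omega>. (kernel_form \<omega> - 1/2)\<^sup>2) \<le>
     2 * ((s2 - 1) * (2 * m4 + 6) * (L * (1/2))) + 2 * (2 * ?N + (m4 - 3) * ?D)"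
    using kernel_form_variance(3)[OF L, unfolded half] by simp
  also have "\<dots> \<le> 4 * (s2 * (2 + m4) * L + 2 * ?N - p)"
    by (rule variance_numeric_aux[OF s2_ge_1 m4_ge_1 L0 \<open>0 \<le> ?D\<close> D DN p])
  finally show ?thesis .
qed

end

theorem corollary6p4:
  fixes M :: "'a measure" and N :: "'b measure"
    and X :: "nat \<Rightarrow> 'a \<Rightarrow> real" and Z :: "'b \<Rightarrow> real"
    and I :: "real set" and n :: nat and a :: "nat \<Rightarrow> nat \<Rightarrow> real"
  assumes "n \<ge> 2"
    and "prob_space M"
    and "prob_space.indep_vars M (\<lambda>_. borel) X {1..}"
    and "\<And>k. k \<ge> 1 \<Longrightarrow> distr M borel (X k) = distr M borel (X 1)"
    and "\<And>k. k \<ge> 1 \<Longrightarrow> prob_space.expectation M (X k) = 0"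
    and "\<And>k. k \<ge> 1 \<Longrightarrow> prob_space.expectation M (\<lambda>\<omega>. (X k \<omega>)\<^sup>2) = 1"
    and "is_interval I"
    and "AE \<omega> in M. X 1 \<omega> \<in> I"
    and "\<And>y. y \<in> interior I \<Longrightarrow> cdf (distr M borel (X 1)) differentiable (at y)"
    and "continuous_on (interior I) (deriv (cdf (distr M borel (X 1))))"
    and "\<And>y. y \<in> interior I \<Longrightarrow> deriv (cdf (distr M borel (X 1))) y \<noteq> 0"
    and "\<And>k l. k \<in> {1..n} \<Longrightarrow> l \<in> {1..n} \<Longrightarrow> a k l = a l k"
    and "\<And>k. k \<in> {1..n} \<Longrightarrow> a k k = 0"
    and "prob_space.expectation M (quad_form n a X) = 0"
    and "prob_space.expectation M (\<lambda>\<omega>. (quad_form n a X \<omega>)\<^sup>2) = 1"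
    and "prob_space N"
    and "distributed N lborel Z std_normal_density"
  shows "let B = 4 * sqrt_ereal
             (pos_expectation M (\<lambda>\<omega>. (stein_kernel (distr M borel (X 1)) (X 1 \<omega>))\<^sup>2)
                * (2 + pos_expectation M (\<lambda>\<omega>. (X 1 \<omega>) ^ 4)) * ereal (max_row_sq n a)
              + ereal (2 * (\<Sum>q=1..n. \<Sum>l=1..n. (\<Sum>k=1..n. a k q * a k l)\<^sup>2))
              - ereal (\<Sum>k=1..n. (\<Sum>l\<in>{1..<k}. (a k l)\<^sup>2)\<^sup>2))
         in dist_W M (quad_form n a X) N Z \<le> B \<and> dist_TV M (quad_form n a X) N Z \<le> 2 * B"
proof -
  note One_nat_def [simp del]
  define \<mu> where "\<mu> = distr M borel (X 1)"
  define \<phi> where "\<phi> = stein_kernel \<mu>"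
  define S where "S = {1..n}"
  interpret prob_space M by fact
  have indep: "indep_vars (\<lambda>_. borel) X S"
    by (rule indep_vars_subset[OF assms(3)]) (auto simp: S_def)
  have mX [measurable]: "X 1 \<in> borel_measurable M" using assms(3) by (auto simp: indep_vars_def)
  interpret \<mu>: real_distribution \<mu>
    unfolding \<mu>_def by (rule real_distribution_distr[OF mX])
  have mean: "(\<integral>x. x \<partial>\<mu>) = 0" and var: "(\<integral>x. x\<^sup>2 \<partial>\<mu>) = 1"
    using assms(5,6)[of 1] by (simp_all add: \<mu>_def integral_distr)
  have Ib: "I \<in> sets borel" using assms(7) by (rule real_interval_borel_measurable)
  interpret K: centered_interval_law \<mu> I
  proof
    show "AE x in \<mu>. x \<in> I"
      unfolding \<mu>_def by (subst AE_distr_iff[OF mX]) (use assms(8) Ib in simp_all)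
    \<comment> \<open>The integral is 1, whereas the Bochner integral of a non-integrable function
      is 0 by convention.\<close>
    show "integrable \<mu> (\<lambda>x. x\<^sup>2)" using var not_integrable_integral_eq by fastforce
  qed (use assms(7,9-11) mean in \<open>auto simp: \<mu>_def\<close>)
  have m\<phi> [measurable]: "\<phi> \<in> borel_measurable borel" unfolding \<phi>_def by (rule K.stein_kernel_measurable)
  have \<phi>1: "(\<integral>x. \<phi> x \<partial>\<mu>) = 1" using K.stein_kernel_mean var by (simp add: \<phi>_def)
  define \<sigma> where "\<sigma> = (\<integral>\<^sup>+x. ennreal ((\<phi> x)\<^sup>2) \<partial>\<mu>)"
  define \<tau> where "\<tau> = (\<integral>\<^sup>+x. ennreal (x ^ 4) \<partial>\<mu>)"
  define L where "L = max_row_sq n a"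
  define P where "P = (\<Sum>k=1..n. (\<Sum>l\<in>{1..<k}. (a k l)\<^sup>2)\<^sup>2)"
  define G where "G = (\<Sum>q=1..n. \<Sum>l=1..n. (\<Sum>k=1..n. a k q * a k l)\<^sup>2)"
  have pos: "pos_expectation M (\<lambda>\<omega>. (stein_kernel (distr M borel (X 1)) (X 1 \<omega>))\<^sup>2) = enn2ereal \<sigma>"
    "pos_expectation M (\<lambda>\<omega>. (X 1 \<omega>) ^ 4) = enn2ereal \<tau>"
    unfolding pos_expectation_def \<sigma>_def \<tau>_def \<mu>_def[symmetric] \<phi>_def[symmetric]
    by (simp_all add: \<mu>_def nn_integral_distr)
  define B where "B = 4 * sqrt_ereal (enn2ereal \<sigma> * (2 + enn2ereal \<tau>) * ereal L + ereal (2 * G) - ereal P)"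
  have row_le: "(\<Sum>l=1..n. (a k l)\<^sup>2) \<le> L" if "k \<in> {1..n}" for k
    unfolding L_def max_row_sq_def using that by (intro Max_ge) auto
  \<comment> \<open>Strict positivity matters because \<infinity> * 0 = 0 in \<open>ereal\<close>:
    the infinite case needs every factor of the product nonzero. A zero matrix would contradict
    E[Q^2] = 1.\<close>
  have L0: "0 < L"
  proof (rule ccontr)
    assume "\<not> 0 < L"
    have "a k l = 0" if "k \<in> {1..n}" "l \<in> {1..n}" for k l
    proof -
      have "(a k l)\<^sup>2 \<le> (\<Sum>l=1..n. (a k l)\<^sup>2)" using that by (intro member_le_sum) auto
      then have "(a k l)\<^sup>2 \<le> 0" using row_le[OF that(1)] \<open>\<not> 0 < L\<close> by linarith
      then show ?thesis by simp
    qed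
    then have "quad_form n a X \<omega> = 0" for \<omega> by (simp add: quad_form_def)
    then show False using assms(15) by simp
  qed
  \<comment> \<open>Needed for the same reason: with an infinite fourth moment the product is
    infinite only if the kernel factor is not 0. A kernel vanishing almost everywhere would
    contradict its mean 1.\<close>
  have \<sigma>0: "\<sigma> \<noteq> 0"
  proof
    assume "\<sigma> = 0"
    then have "AE x in \<mu>. \<phi> x = 0"
      unfolding \<sigma>_def by (subst (asm) nn_integral_0_iff_AE) auto
    then have "(\<integral>x. \<phi> x \<partial>\<mu>) = (\<integral>x. 0 \<partial>\<mu>)" by (intro integral_cong_AE) auto
    then show False using \<phi>1 by simp
  qed
  have "dist_W M (quad_form n a X) N Z \<le> B \<and> dist_TV M (quad_form n a X) N Z \<le> 2 * B"
  proof (cases "\<sigma> = \<infinity> \<or> \<tau> = \<infinity>")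
    case True
    have "enn2ereal \<sigma> \<noteq> 0" using \<sigma>0 enn2ereal_inject[of \<sigma> 0] by (simp add: zero_ennreal.rep_eq)
    then have "0 < enn2ereal \<sigma>" by (simp add: less_le enn2ereal_nonneg)
    moreover have "0 < 2 + enn2ereal \<tau>"
      by (simp add: add_pos_nonneg enn2ereal_nonneg)
    moreover have "enn2ereal \<sigma> = \<infinity> \<or> 2 + enn2ereal \<tau> = \<infinity>" using True by auto
    ultimately have inf: "enn2ereal \<sigma> * (2 + enn2ereal \<tau>) * ereal L = \<infinity>"
      using L0 by (auto simp: ereal_mult_infty ereal_infty_mult)
    have "B = \<infinity>" unfolding B_def inf by (simp add: sqrt_ereal_def)
    then show ?thesis by simp
  next
    case False
    have fin: "\<sigma> < \<infinity>" "\<tau> < \<infinity>" using False by (auto simp: less_top[symmetric])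
    have \<phi>2: "integrable \<mu> (\<lambda>x. (\<phi> x)\<^sup>2)"
      using fin by (intro integrableI_bounded) (simp_all add: \<sigma>_def)
    have x4: "integrable \<mu> (\<lambda>x. x ^ 4)"
      using fin by (intro integrableI_bounded) (simp_all add: \<tau>_def)
    interpret Q: iid_stein M \<mu> X S \<phi> a
    proof
      show "distr M borel (X k) = \<mu>" if "k \<in> S" for k using assms(4)[of k] that by (simp add: S_def \<mu>_def)
      show "(\<integral>x. x * g x \<partial>\<mu>) = (\<integral>x. \<phi> x * g' x \<partial>\<mu>)"
        if "\<And>x. (g has_real_derivative g' x) (at x)" "continuous_on UNIV g'" "\<And>x. \<bar>g' x\<bar> \<le> C" for g g' C
        using K.stein_kernel_identity[OF that] by (simp add: \<phi>_def)
    qed (use indep mean var \<phi>1 \<phi>2 x4 assms(12,13) in \<open>auto simp: S_def\<close>)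
    have QQ: "quad_form n a X = Q.quad a S"
      by (auto simp: fun_eq_iff quad_form_def Q.quad_def S_def)
    have half: "(\<Sum>k\<in>S. Q.row k) = 1/2" using Q.quad_square(2) assms(15) by (simp add: QQ)
    have L: "Q.row k \<le> L" if "k \<in> S" for k unfolding Q.row_def using row_le that by (simp add: S_def)
    have P: "P \<le> (\<Sum>k\<in>S. (Q.row k)\<^sup>2)"
      unfolding P_def S_def[symmetric]
    proof (intro sum_mono power_mono)
      fix k assume "k \<in> S"
      then show "(\<Sum>l\<in>{1..<k}. (a k l)\<^sup>2) \<le> Q.row k" by (intro Q.sum_squares_le_row) (auto simp: S_def)
    qed (auto intro: sum_nonneg)
    have GG: "G = (\<Sum>q\<in>S. \<Sum>l\<in>S. (Q.gram q l)\<^sup>2)" unfolding G_def Q.gram_def by (simp add: S_def)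
    have \<sigma>: "\<sigma> = ennreal Q.s2" and \<tau>: "\<tau> = ennreal Q.m4"
      unfolding \<sigma>_def \<tau>_def using \<phi>2 x4 by (auto intro!: nn_integral_eq_integral)
    have "B = ereal (4 * sqrt (Q.s2 * (2 + Q.m4) * L + 2 * G - P))"
      unfolding B_def \<sigma> \<tau> using Q.s2_ge_1 Q.m4_ge_1
      by (simp add: sqrt_ereal_def numeral_eq_ereal enn2ereal_ennreal)
    moreover have v: "expectation (\<lambda>\<omega>. (Q.kernel_form \<omega> - 1/2)\<^sup>2)
      \<le> 4 * (Q.s2 * (2 + Q.m4) * L + 2 * G - P)"
      unfolding GG using L half P by (rule Q.variance_numeric)
    moreover have "dist_W M Q.Q N Z \<le> ereal (4 * sqrt (Q.s2 * (2 + Q.m4) * L + 2 * G - P))"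
      "dist_TV M Q.Q N Z \<le> ereal (8 * sqrt (Q.s2 * (2 + Q.m4) * L + 2 * G - P))"
      by (rule Q.distance_bounds[OF assms(16,17) L half v]; assumption)+
    ultimately show ?thesis unfolding QQ by (simp add: numeral_eq_ereal)
  qed
  then show ?thesis
    unfolding Let_def pos B_def L_def G_def P_def .
qed

end
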